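(* Let $(R,\mathfrak m)$ be a commutative noetherian local ring, $I$ an ideal of $R$, and let $\mathcal P$ be the class of all $I$-generated $R$-modules. For every $R$-module $M$, if $M^{\circ\circ}\in\mathcal P$ then $M\in\mathcal P$. Moreover, if $M$ is a flat $R$-module, then $$M\in\mathcal P\iff I_{\mathfrak p}\cong R_{\mathfrak p}\text{ for all }\mathfrak p\in\operatorname{Koass}(M).$$
   Context: $E$ is the injective hull of the residue field $R/\mathfrak m$, $M^\circ=\operatorname{Hom}_R(M,E)$ is the Matlis dual of an $R$-module $M$, and $M^{\circ\circ}=(M^\circ)^\circ$. An $R$-module $M$ is $I$-generated if there is an epimorphism $I^{(\Lambda)}\twoheadrightarrow M$ for some index set $\Lambda$ (direct sum of copies of $I$). $I_{\mathfrak p}=IR_{\mathfrak p}$, and $I_{\mathfrak p}\cong R_{\mathfrak p}$ means isomorphism of $R_{\mathfrak p}$-modules. $\operatorname{Koass}(M)$ is the set of coassociated primes of $M$, i.e. prime ideals $\mathfrak p$ of the form $\mathfrak p=\operatorname{Ann}_R(M/U)$ with $U\subset M$ a submodule such that $M/U$ is artinian; equivalently $\operatorname{Koass}(M)=\operatorname{Ass}(M^\circ)$. *)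

theory Defs
  imports "HOL-Algebra.Algebra"
begin

text \<open>
  Modules are HOL-Algebra modules. The record type \<^type>\<open>module\<close> extends \<^type>\<open>ring\<close>, so the module
  records below also have fields \<open>mult\<close> and \<open>one\<close>; these play no role for a module and are left
  \<^const>\<open>undefined\<close> wherever there is no obvious value.

  HOL cannot quantify over types inside a definition. Where a notion refers to all modules or to
  all index sets, the text at the definition says which type is used and why it suffices.
\<close>

section \<open>Rings and modules\<close>

definition noetherian_local_ring :: "('r, 'x) ring_scheme \<Rightarrow> 'r set \<Rightarrow> bool" where
  "noetherian_local_ring R \<mm> \<longleftrightarrow>
     cring R \<and> noetherian_ring R \<and> maximalideal \<mm> R \<and> (\<forall>\<nn>. maximalideal \<nn> R \<longrightarrow> \<nn> = \<mm>)"

definition mhom :: "('r, 'x) ring_scheme \<Rightarrow> ('r, 'm) module \<Rightarrow> ('r, 'n) module \<Rightarrow> ('m \<Rightarrow> 'n) set" where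
  "mhom R M N = {f \<in> carrier M \<rightarrow> carrier N.
     (\<forall>x\<in>carrier M. \<forall>y\<in>carrier M. f (x \<oplus>\<^bsub>M\<^esub> y) = f x \<oplus>\<^bsub>N\<^esub> f y) \<and>
     (\<forall>r\<in>carrier R. \<forall>x\<in>carrier M. f (r \<odot>\<^bsub>M\<^esub> x) = r \<odot>\<^bsub>N\<^esub> f x)}"

definition mod_iso :: "('r, 'x) ring_scheme \<Rightarrow> ('r, 'm) module \<Rightarrow> ('r, 'n) module \<Rightarrow> bool" where
  "mod_iso R M N \<longleftrightarrow> (\<exists>f\<in>mhom R M N. bij_betw f (carrier M) (carrier N))"

text \<open>An ideal as a module over the ring; \<open>ideal_module R (carrier R)\<close> is the ring as a module over
  itself.\<close>

definition ideal_module :: "('r, 'x) ring_scheme \<Rightarrow> 'r set \<Rightarrow> ('r, 'r) module" where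
  "ideal_module R J = \<lparr>carrier = J, monoid.mult = (\<otimes>\<^bsub>R\<^esub>), one = \<one>\<^bsub>R\<^esub>,
     ring.zero = \<zero>\<^bsub>R\<^esub>, ring.add = (\<oplus>\<^bsub>R\<^esub>), smult = (\<otimes>\<^bsub>R\<^esub>)\<rparr>"

abbreviation self_module :: "('r, 'x) ring_scheme \<Rightarrow> ('r, 'r) module" where
  "self_module R \<equiv> ideal_module R (carrier R)"

definition quot_module :: "('r, 'm) module \<Rightarrow> 'm set \<Rightarrow> ('r, 'm set) module" where
  "quot_module M U = \<lparr>carrier = a_rcosets\<^bsub>M\<^esub> U, monoid.mult = undefined, one = undefined,
     ring.zero = U, ring.add = set_add M, smult = (\<lambda>r C. \<Union>x\<in>C. U +>\<^bsub>M\<^esub> (r \<odot>\<^bsub>M\<^esub> x))\<rparr>"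

text \<open>The direct sum of copies of \<open>N\<close> indexed by \<open>\<Lambda>\<close>.\<close>

definition copower :: "('r, 'n) module \<Rightarrow> 'i set \<Rightarrow> ('r, 'i \<Rightarrow> 'n) module" where
  "copower N \<Lambda> = \<lparr>carrier = {f \<in> \<Lambda> \<rightarrow>\<^sub>E carrier N. finite {i\<in>\<Lambda>. f i \<noteq> \<zero>\<^bsub>N\<^esub>}},
     monoid.mult = undefined, one = undefined,
     ring.zero = (\<lambda>i\<in>\<Lambda>. \<zero>\<^bsub>N\<^esub>), ring.add = (\<lambda>f g. \<lambda>i\<in>\<Lambda>. f i \<oplus>\<^bsub>N\<^esub> g i),
     smult = (\<lambda>r f. \<lambda>i\<in>\<Lambda>. r \<odot>\<^bsub>N\<^esub> f i)\<rparr>"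

definition submodule_span :: "('r, 'x) ring_scheme \<Rightarrow> ('r, 'm) module \<Rightarrow> 'm set \<Rightarrow> 'm set" where
  "submodule_span R M S = \<Inter>{U. submodule U R M \<and> S \<subseteq> U}"

section \<open>Generation by an ideal\<close>

text \<open>
  The index sets range over the sets of maps \<open>R \<rightarrow> M\<close>, which is no restriction: an epimorphism from
  a direct sum of copies of \<open>I\<close> is a family of homomorphisms \<open>I \<rightarrow> M\<close> whose images together generate
  \<open>M\<close>, and this family may be indexed without repetitions by its own members.
\<close>

definition ideal_generated ::
    "('r, 'x) ring_scheme \<Rightarrow> 'r set \<Rightarrow> ('r, 'm) module \<Rightarrow> bool" where
  "ideal_generated R I M \<longleftrightarrow> module R M \<and>
     (\<exists>\<Lambda> :: ('r \<Rightarrow> 'm) set. \<exists>e\<in>mhom R (copower (ideal_module R I) \<Lambda>) M.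
        e ` carrier (copower (ideal_module R I) \<Lambda>) = carrier M)"

section \<open>Injective hulls and the Matlis dual\<close>

text \<open>
  Injectivity is tested on modules \<open>A\<close>, \<open>B\<close> whose carriers consist of elements of type \<open>'r\<close>. These
  include the ideals of \<open>R\<close> and \<open>R\<close> itself, so by Baer's criterion the extension property then
  holds for modules of all types.
\<close>

definition injective_module :: "('r, 'x) ring_scheme \<Rightarrow> ('r, 'e) module \<Rightarrow> bool" where
  "injective_module R E \<longleftrightarrow> module R E \<and>
     (\<forall>(A :: ('r, 'r) module) (B :: ('r, 'r) module) f g.
        module R A \<and> module R B \<and> f \<in> mhom R A B \<and> inj_on f (carrier A) \<and> g \<in> mhom R A E \<longrightarrow>
        (\<exists>h\<in>mhom R B E. \<forall>a\<in>carrier A. h (f a) = g a))"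

definition injective_hull ::
    "('r, 'x) ring_scheme \<Rightarrow> ('r, 'k) module \<Rightarrow> ('r, 'e) module \<Rightarrow> bool" where
  "injective_hull R K E \<longleftrightarrow> injective_module R E \<and>
     (\<exists>\<iota>\<in>mhom R K E. inj_on \<iota> (carrier K) \<and>
        (\<forall>U. submodule U R E \<and> U \<noteq> {\<zero>\<^bsub>E\<^esub>} \<longrightarrow> U \<inter> \<iota> ` carrier K \<noteq> {\<zero>\<^bsub>E\<^esub>}))"

text \<open>\<open>Hom\<^sub>R(M, E)\<close>. Restricting to extensional functions makes equality of homomorphisms the
  equality on the carrier of \<open>M\<close>.\<close>

definition matlis_dual ::
    "('r, 'x) ring_scheme \<Rightarrow> ('r, 'e) module \<Rightarrow> ('r, 'm) module \<Rightarrow> ('r, 'm \<Rightarrow> 'e) module" where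
  "matlis_dual R E M = \<lparr>carrier = mhom R M E \<inter> extensional (carrier M),
     monoid.mult = undefined, one = undefined,
     ring.zero = (\<lambda>x\<in>carrier M. \<zero>\<^bsub>E\<^esub>), ring.add = (\<lambda>f g. \<lambda>x\<in>carrier M. f x \<oplus>\<^bsub>E\<^esub> g x),
     smult = (\<lambda>r f. \<lambda>x\<in>carrier M. r \<odot>\<^bsub>E\<^esub> f x)\<rparr>"

section \<open>Tensor products and flatness\<close>

abbreviation free_on_pairs ::
    "('r, 'x) ring_scheme \<Rightarrow> ('r, 'm) module \<Rightarrow> ('r, 'n) module \<Rightarrow> ('r, 'm \<times> 'n \<Rightarrow> 'r) module" where
  "free_on_pairs R M N \<equiv> copower (self_module R) (carrier M \<times> carrier N)"

definition pair_basis ::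
    "('r, 'x) ring_scheme \<Rightarrow> ('r, 'm) module \<Rightarrow> ('r, 'n) module \<Rightarrow> 'm \<Rightarrow> 'n \<Rightarrow> 'm \<times> 'n \<Rightarrow> 'r" where
  "pair_basis R M N x y =
     (\<lambda>p\<in>carrier M \<times> carrier N. if p = (x, y) then \<one>\<^bsub>R\<^esub> else \<zero>\<^bsub>R\<^esub>)"

definition bilinear_relations ::
    "('r, 'x) ring_scheme \<Rightarrow> ('r, 'm) module \<Rightarrow> ('r, 'n) module \<Rightarrow> ('m \<times> 'n \<Rightarrow> 'r) set" where
  "bilinear_relations R M N = (let F = free_on_pairs R M N; b = pair_basis R M N in
     {b (x \<oplus>\<^bsub>M\<^esub> x') y \<ominus>\<^bsub>F\<^esub> (b x y \<oplus>\<^bsub>F\<^esub> b x' y) | x x' y.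
        x \<in> carrier M \<and> x' \<in> carrier M \<and> y \<in> carrier N} \<union>
     {b x (y \<oplus>\<^bsub>N\<^esub> y') \<ominus>\<^bsub>F\<^esub> (b x y \<oplus>\<^bsub>F\<^esub> b x y') | x y y'.
        x \<in> carrier M \<and> y \<in> carrier N \<and> y' \<in> carrier N} \<union>
     {b (r \<odot>\<^bsub>M\<^esub> x) y \<ominus>\<^bsub>F\<^esub> (r \<odot>\<^bsub>F\<^esub> b x y) | r x y.
        r \<in> carrier R \<and> x \<in> carrier M \<and> y \<in> carrier N} \<union>
     {b x (r \<odot>\<^bsub>N\<^esub> y) \<ominus>\<^bsub>F\<^esub> (r \<odot>\<^bsub>F\<^esub> b x y) | r x y.
        r \<in> carrier R \<and> x \<in> carrier M \<and> y \<in> carrier N})"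

abbreviation tensor_kernel ::
    "('r, 'x) ring_scheme \<Rightarrow> ('r, 'm) module \<Rightarrow> ('r, 'n) module \<Rightarrow> ('m \<times> 'n \<Rightarrow> 'r) set" where
  "tensor_kernel R M N \<equiv> submodule_span R (free_on_pairs R M N) (bilinear_relations R M N)"

definition tensor ::
    "('r, 'x) ring_scheme \<Rightarrow> ('r, 'm) module \<Rightarrow> ('r, 'n) module \<Rightarrow>
     ('r, ('m \<times> 'n \<Rightarrow> 'r) set) module" where
  "tensor R M N = quot_module (free_on_pairs R M N) (tensor_kernel R M N)"

definition pure_tensor ::
    "('r, 'x) ring_scheme \<Rightarrow> ('r, 'm) module \<Rightarrow> ('r, 'n) module \<Rightarrow> 'm \<Rightarrow> 'n \<Rightarrow>
     ('m \<times> 'n \<Rightarrow> 'r) set" where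
  "pure_tensor R M N x y = tensor_kernel R M N +>\<^bsub>free_on_pairs R M N\<^esub> pair_basis R M N x y"

text \<open>
  Tensoring with \<open>M\<close> preserves injectivity. The map \<open>\<phi>\<close> is \<open>f \<otimes> M\<close>: there is exactly one
  homomorphism with the stated values on pure tensors. As for injectivity, the carriers of the test
  modules are of type \<open>'r\<close>; inclusions of ideals into \<open>R\<close> are among the tests, so by the ideal
  criterion for flatness the property then holds for modules of all types.
\<close>

definition flat_module :: "('r, 'x) ring_scheme \<Rightarrow> ('r, 'm) module \<Rightarrow> bool" where
  "flat_module R M \<longleftrightarrow> module R M \<and>
     (\<forall>(A :: ('r, 'r) module) (B :: ('r, 'r) module) f.
        module R A \<and> module R B \<and> f \<in> mhom R A B \<and> inj_on f (carrier A) \<longrightarrow>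
        (\<exists>\<phi>\<in>mhom R (tensor R A M) (tensor R B M).
           (\<forall>a\<in>carrier A. \<forall>x\<in>carrier M.
              \<phi> (pure_tensor R A M a x) = pure_tensor R B M (f a) x) \<and>
           inj_on \<phi> (carrier (tensor R A M))))"

section \<open>Coassociated primes\<close>

definition artinian_module :: "('r, 'x) ring_scheme \<Rightarrow> ('r, 'm) module \<Rightarrow> bool" where
  "artinian_module R M \<longleftrightarrow> module R M \<and>
     (\<forall>U :: nat \<Rightarrow> 'm set. (\<forall>n. submodule (U n) R M) \<and> (\<forall>n. U (Suc n) \<subseteq> U n) \<longrightarrow>
        (\<exists>k. \<forall>n\<ge>k. U n = U k))"

definition annihilator :: "('r, 'x) ring_scheme \<Rightarrow> ('r, 'm) module \<Rightarrow> 'r set" where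
  "annihilator R M = {r \<in> carrier R. \<forall>x\<in>carrier M. r \<odot>\<^bsub>M\<^esub> x = \<zero>\<^bsub>M\<^esub>}"

definition Koass :: "('r, 'x) ring_scheme \<Rightarrow> ('r, 'm) module \<Rightarrow> 'r set set" where
  "Koass R M = {\<pp>. primeideal \<pp> R \<and>
     (\<exists>U. submodule U R M \<and> artinian_module R (quot_module M U) \<and>
        \<pp> = annihilator R (quot_module M U))}"

section \<open>Localization at a prime\<close>

text \<open>The fraction \<open>a/s\<close> is the class of all pairs \<open>(b, t)\<close> with \<open>u (t a - s b) = 0\<close> for some
  \<open>u \<notin> \<pp>\<close>.\<close>

definition fraction :: "('r, 'x) ring_scheme \<Rightarrow> 'r set \<Rightarrow> 'r \<Rightarrow> 'r \<Rightarrow> ('r \<times> 'r) set" where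
  "fraction R \<pp> a s = {(b, t). b \<in> carrier R \<and> t \<in> carrier R - \<pp> \<and>
     (\<exists>u\<in>carrier R - \<pp>. u \<otimes>\<^bsub>R\<^esub> (t \<otimes>\<^bsub>R\<^esub> a) = u \<otimes>\<^bsub>R\<^esub> (s \<otimes>\<^bsub>R\<^esub> b))}"

definition localization :: "('r, 'x) ring_scheme \<Rightarrow> 'r set \<Rightarrow> ('r \<times> 'r) set ring" where
  "localization R \<pp> = \<lparr>carrier = {fraction R \<pp> a s | a s. a \<in> carrier R \<and> s \<in> carrier R - \<pp>},
     monoid.mult = (\<lambda>C D. \<Union>(a, s)\<in>C. \<Union>(b, t)\<in>D. fraction R \<pp> (a \<otimes>\<^bsub>R\<^esub> b) (s \<otimes>\<^bsub>R\<^esub> t)),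
     one = fraction R \<pp> \<one>\<^bsub>R\<^esub> \<one>\<^bsub>R\<^esub>,
     ring.zero = fraction R \<pp> \<zero>\<^bsub>R\<^esub> \<one>\<^bsub>R\<^esub>,
     ring.add = (\<lambda>C D. \<Union>(a, s)\<in>C. \<Union>(b, t)\<in>D.
       fraction R \<pp> ((a \<otimes>\<^bsub>R\<^esub> t) \<oplus>\<^bsub>R\<^esub> (b \<otimes>\<^bsub>R\<^esub> s)) (s \<otimes>\<^bsub>R\<^esub> t))\<rparr>"

definition localized_ideal :: "('r, 'x) ring_scheme \<Rightarrow> 'r set \<Rightarrow> 'r set \<Rightarrow> ('r \<times> 'r) set set" where
  "localized_ideal R \<pp> I = Idl\<^bsub>localization R \<pp>\<^esub> ((\<lambda>a. fraction R \<pp> a \<one>\<^bsub>R\<^esub>) ` I)"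

end

theory Submission
  imports Defs
begin

text \<open>
  Write \<open>M\<^sup>o = Hom(M, E)\<close>. A module is generated by \<open>I\<close> iff the trace of \<open>I\<close> in it, the sum of the
  images of all homomorphisms from \<open>I\<close>, is the whole module (\<open>ideal_generated_iff\<close>). Both claims rest
  on one fact about an injective module \<open>Q\<close> and an arbitrary module \<open>N\<close>: the map
  \<open>I \<otimes> Hom(N, Q) \<rightarrow> Hom(Hom(I, N), Q)\<close> that sends \<open>a \<otimes> u\<close> to \<open>g \<mapsto> u (g a)\<close> is injective, because \<open>I\<close> has
  finitely many generators with finitely many relations. In the form
  \<open>trace_orthogonal_tensor_zero\<close> it says that if \<open>u\<close> vanishes on the trace of \<open>I\<close> in \<open>N\<close>, then every
  bilinear map on \<open>I \<times> Hom(N, Q)\<close> vanishes at all \<open>(a, u)\<close>.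

  Suppose that \<open>M\<^sup>o\<^sup>o\<close> is generated by \<open>I\<close> and that the trace of \<open>I\<close> in \<open>M\<close> misses \<open>x\<close>. Since \<open>E\<close> is an
  injective cogenerator, some \<open>u \<in> M\<^sup>o\<close> vanishes on the trace but not at \<open>x\<close>. A homomorphism
  \<open>I \<rightarrow> M\<^sup>o\<^sup>o\<close> is a bilinear map \<open>I \<times> M\<^sup>o \<rightarrow> E\<close>, so the fact for \<open>N = M\<close> and \<open>Q = E\<close> puts the trace of \<open>I\<close> in
  \<open>M\<^sup>o\<^sup>o\<close> inside the kernel of evaluation at \<open>u\<close>. This is a proper submodule: evaluation at \<open>x\<close> is an
  element of \<open>M\<^sup>o\<^sup>o\<close> outside of it.

  Now let \<open>T\<close> be the set of all \<open>g a\<close> with \<open>g : I \<rightarrow> R\<close> and \<open>a \<in> I\<close>. If \<open>T M\<close> generates \<open>M\<close>, then so does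
  \<open>I\<close>, by the maps \<open>b \<mapsto> g(b) y\<close>. If \<open>M\<close> is flat, then \<open>M\<^sup>o\<close> is injective (\<open>flat_dual_injective\<close>), and the
  fact for \<open>N = R\<close> and \<open>Q = M\<^sup>o\<close> gives the converse: a functional that kills \<open>T M\<close> kills the trace of
  \<open>I\<close> in \<open>M\<close> (\<open>flat_ideal_generated_trace\<close>). Next, \<open>T M\<close> fails to generate \<open>M\<close> iff \<open>T\<close> lies in a
  coassociated prime: among the nonzero functionals \<open>M \<rightarrow> E\<close> that kill \<open>T M\<close>, one with maximal
  annihilator has a prime annihilator, and its image is artinian because \<open>E\<close> is
  (\<open>Koass_above_annihilator\<close>, \<open>injective_hull_artinian\<close>). Finally \<open>T \<subseteq> \<pp>\<close> fails iff \<open>I\<^sub>\<pp>\<close> is free of rank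
  one: from \<open>g a \<notin> \<pp>\<close> and \<open>g(a) b = g(b) a\<close> it follows that \<open>a\<close> is a regular generator of \<open>I\<^sub>\<pp>\<close>, and
  conversely the inverse of multiplication by such a generator, cleared of denominators, maps \<open>I\<close>
  to \<open>R\<close> (\<open>localized_ideal_free_if_trace\<close>, \<open>trace_if_localized_ideal_free\<close>).
\<close>


section \<open>Modules, homomorphisms and submodules\<close>

lemma (in abelian_group) eq_if_minus_zero:
  assumes "x \<in> carrier G" "y \<in> carrier G" "x \<ominus> y = \<zero>"
  shows "x = y"
proof -
  have "x = (x \<ominus> y) \<oplus> y" using assms(1,2) by (simp add: a_minus_def a_assoc l_neg)
  then show ?thesis using assms by simp
qed

lemma mhomI:
  assumes "\<And>x. x \<in> carrier M \<Longrightarrow> f x \<in> carrier N"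
    and "\<And>x y. x \<in> carrier M \<Longrightarrow> y \<in> carrier M \<Longrightarrow> f (x \<oplus>\<^bsub>M\<^esub> y) = f x \<oplus>\<^bsub>N\<^esub> f y"
    and "\<And>r x. r \<in> carrier R \<Longrightarrow> x \<in> carrier M \<Longrightarrow> f (r \<odot>\<^bsub>M\<^esub> x) = r \<odot>\<^bsub>N\<^esub> f x"
  shows "f \<in> mhom R M N"
  using assms unfolding mhom_def by auto

lemma mhomD:
  assumes "f \<in> mhom R M N"
  shows "x \<in> carrier M \<Longrightarrow> f x \<in> carrier N"
    and "x \<in> carrier M \<Longrightarrow> y \<in> carrier M \<Longrightarrow> f (x \<oplus>\<^bsub>M\<^esub> y) = f x \<oplus>\<^bsub>N\<^esub> f y"
    and "r \<in> carrier R \<Longrightarrow> x \<in> carrier M \<Longrightarrow> f (r \<odot>\<^bsub>M\<^esub> x) = r \<odot>\<^bsub>N\<^esub> f x"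
  using assms unfolding mhom_def by auto

lemma mhom_comp:
  "f \<in> mhom R M N \<Longrightarrow> g \<in> mhom R N P \<Longrightarrow> (\<lambda>x. g (f x)) \<in> mhom R M P"
  by (auto intro!: mhomI simp: mhomD)

lemma mhom_zero:
  assumes "module R M" "module R N" "f \<in> mhom R M N"
  shows "f \<zero>\<^bsub>M\<^esub> = \<zero>\<^bsub>N\<^esub>"
proof -
  interpret M: module R M by fact
  interpret N: module R N by fact
  have "f (\<zero>\<^bsub>R\<^esub> \<odot>\<^bsub>M\<^esub> \<zero>\<^bsub>M\<^esub>) = \<zero>\<^bsub>R\<^esub> \<odot>\<^bsub>N\<^esub> f \<zero>\<^bsub>M\<^esub>"
    by (rule mhomD(3)[OF assms(3)]) auto
  then show ?thesis using mhomD(1)[OF assms(3), of "\<zero>\<^bsub>M\<^esub>"] by simp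
qed

lemma mhom_minus:
  assumes "module R M" "module R N" "f \<in> mhom R M N" "x \<in> carrier M" "y \<in> carrier M"
  shows "f (x \<ominus>\<^bsub>M\<^esub> y) = f x \<ominus>\<^bsub>N\<^esub> f y"
proof -
  interpret M: module R M by fact
  interpret N: module R N by fact
  have eq: "z \<ominus>\<^bsub>M\<^esub> w = z \<oplus>\<^bsub>M\<^esub> (\<ominus>\<^bsub>R\<^esub> \<one>\<^bsub>R\<^esub>) \<odot>\<^bsub>M\<^esub> w" if "w \<in> carrier M" for z w
    using that by (simp add: a_minus_def M.smult_l_minus)
  have eq': "z \<ominus>\<^bsub>N\<^esub> w = z \<oplus>\<^bsub>N\<^esub> (\<ominus>\<^bsub>R\<^esub> \<one>\<^bsub>R\<^esub>) \<odot>\<^bsub>N\<^esub> w" if "w \<in> carrier N" for z w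
    using that by (simp add: a_minus_def N.smult_l_minus)
  show ?thesis
    using assms(4,5) by (simp add: eq eq' mhomD[OF assms(3)])
qed

lemma mhom_finsum:
  assumes "module R M" "module R N" "f \<in> mhom R M N" "finite A" "g \<in> A \<rightarrow> carrier M"
  shows "f (finsum M g A) = finsum N (\<lambda>i. f (g i)) A"
proof -
  interpret M: module R M by fact
  interpret N: module R N by fact
  show ?thesis using assms(4,5)
  proof (induction A rule: finite_induct)
    case empty
    then show ?case by (simp add: mhom_zero[OF assms(1-3)])
  next
    case (insert a A)
    then have "g \<in> A \<rightarrow> carrier M" "g a \<in> carrier M" by auto
    moreover have "(\<lambda>i. f (g i)) \<in> A \<rightarrow> carrier N"
      using insert.prems by (auto intro: mhomD(1)[OF assms(3)])
    ultimately show ?case using insert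
      by (simp add: mhomD[OF assms(3)])
  qed
qed

lemma (in abelian_monoid) finsum_swap:
  assumes "finite A" "finite B" "\<And>a b. a \<in> A \<Longrightarrow> b \<in> B \<Longrightarrow> f a b \<in> carrier G"
  shows "finsum G (\<lambda>a. finsum G (f a) B) A = finsum G (\<lambda>b. finsum G (\<lambda>a. f a b) A) B"
  using assms(1,3)
proof (induction A rule: finite_induct)
  case empty
  then show ?case using assms(2) by simp
next
  case (insert x A)
  have "finsum G (\<lambda>b. finsum G (\<lambda>a. f a b) (insert x A)) B
      = finsum G (\<lambda>b. f x b \<oplus> finsum G (\<lambda>a. f a b) A) B"
    using insert by (intro finsum_cong') (auto simp: Pi_def)
  also have "\<dots> = finsum G (f x) B \<oplus> finsum G (\<lambda>b. finsum G (\<lambda>a. f a b) A) B"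
    using insert.prems by (intro finsum_addf) (auto intro!: finsum_closed)
  finally show ?case using insert by (auto simp: Pi_def)
qed

lemma submoduleI':
  assumes "module R M" "U \<subseteq> carrier M" "\<zero>\<^bsub>M\<^esub> \<in> U"
    and "\<And>x y. x \<in> U \<Longrightarrow> y \<in> U \<Longrightarrow> x \<oplus>\<^bsub>M\<^esub> y \<in> U"
    and "\<And>r x. r \<in> carrier R \<Longrightarrow> x \<in> U \<Longrightarrow> r \<odot>\<^bsub>M\<^esub> x \<in> U"
  shows "submodule U R M"
proof -
  interpret M: module R M by fact
  show ?thesis
  proof (rule M.submoduleI)
    fix a assume "a \<in> U"
    then have "(\<ominus>\<^bsub>R\<^esub> \<one>\<^bsub>R\<^esub>) \<odot>\<^bsub>M\<^esub> a \<in> U" using assms by auto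
    moreover have "(\<ominus>\<^bsub>R\<^esub> \<one>\<^bsub>R\<^esub>) \<odot>\<^bsub>M\<^esub> a = \<ominus>\<^bsub>M\<^esub> a"
      using \<open>a \<in> U\<close> assms(2) M.smult_l_minus[of "\<one>\<^bsub>R\<^esub>" a] by auto
    ultimately show "\<ominus>\<^bsub>M\<^esub> a \<in> U" by simp
  qed (use assms in auto)
qed

lemma submoduleD:
  assumes "module R M" "submodule U R M"
  shows "U \<subseteq> carrier M" "\<zero>\<^bsub>M\<^esub> \<in> U"
    and "\<And>x y. x \<in> U \<Longrightarrow> y \<in> U \<Longrightarrow> x \<oplus>\<^bsub>M\<^esub> y \<in> U"
    and "\<And>x y. x \<in> U \<Longrightarrow> y \<in> U \<Longrightarrow> x \<ominus>\<^bsub>M\<^esub> y \<in> U"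
    and "\<And>r x. r \<in> carrier R \<Longrightarrow> x \<in> U \<Longrightarrow> r \<odot>\<^bsub>M\<^esub> x \<in> U"
proof -
  interpret M: module R M by fact
  note E = M.submoduleE[OF assms(2)]
  show "U \<subseteq> carrier M" using E by auto
  obtain x where x: "x \<in> U" "x \<in> carrier M" using E by auto
  then have "\<zero>\<^bsub>R\<^esub> \<odot>\<^bsub>M\<^esub> x \<in> U" using E(4)[OF M.R.zero_closed] by blast
  then show "\<zero>\<^bsub>M\<^esub> \<in> U" using M.smult_l_null[OF x(2)] by simp
qed (use module.submoduleE[OF assms] in \<open>auto simp: a_minus_def\<close>)

lemma submodule_vimage:
  assumes "module R M" "module R N" "f \<in> mhom R M N" "submodule U R N"
  shows "submodule {x \<in> carrier M. f x \<in> U} R M"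
proof -
  interpret M: module R M by fact
  show ?thesis
    using submoduleD[OF assms(2,4)] mhom_zero[OF assms(1-3)]
    by (intro submoduleI'[OF assms(1)]) (auto simp: mhomD[OF assms(3)])
qed

lemma submodule_zero: assumes "module R M" shows "submodule {\<zero>\<^bsub>M\<^esub>} R M"
proof -
  interpret M: module R M by fact
  show ?thesis by (rule submoduleI'[OF assms]) auto
qed

lemma submodule_kernel:
  assumes "module R M" "module R N" "f \<in> mhom R M N"
  shows "submodule {x \<in> carrier M. f x = \<zero>\<^bsub>N\<^esub>} R M"
  using submodule_vimage[OF assms submodule_zero[OF assms(2)]] by simp

lemma submodule_equalizer:
  assumes "module R M" "module R N" "f \<in> mhom R M N" "g \<in> mhom R M N"
  shows "submodule {x \<in> carrier M. f x = g x} R M"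
proof -
  interpret M: module R M by fact
  show ?thesis
    using mhom_zero[OF assms(1-3)] mhom_zero[OF assms(1,2,4)]
    by (intro submoduleI'[OF assms(1)]) (auto simp: mhomD[OF assms(3)] mhomD[OF assms(4)])
qed

lemma submodule_Int:
  assumes "module R M" "submodule U R M" "submodule V R M"
  shows "submodule (U \<inter> V) R M"
  using submoduleD[OF assms(1,2)] submoduleD[OF assms(1,3)]
  by (intro submoduleI'[OF assms(1)]) auto

lemma submodule_image:
  assumes "module R M" "module R N" "f \<in> mhom R M N" "submodule U R M"
  shows "submodule (f ` U) R N"
proof -
  note U = submoduleD[OF assms(1,4)]
  show ?thesis
  proof (rule submoduleI'[OF assms(2)])
    show "f ` U \<subseteq> carrier N" using U(1) mhomD(1)[OF assms(3)] by auto
    show "\<zero>\<^bsub>N\<^esub> \<in> f ` U" using mhom_zero[OF assms(1-3)] U(2) by (metis image_eqI)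
    show "x \<oplus>\<^bsub>N\<^esub> y \<in> f ` U" if "x \<in> f ` U" "y \<in> f ` U" for x y
    proof -
      from that obtain x' y' where *: "x = f x'" "y = f y'" "x' \<in> U" "y' \<in> U" by blast
      then have "f (x' \<oplus>\<^bsub>M\<^esub> y') \<in> f ` U" using U(3) by auto
      then show ?thesis using * U(1) mhomD(2)[OF assms(3), of x' y'] by (simp add: subset_iff)
    qed
    show "r \<odot>\<^bsub>N\<^esub> x \<in> f ` U" if "r \<in> carrier R" "x \<in> f ` U" for r x
    proof -
      from that obtain x' where *: "x = f x'" "x' \<in> U" by auto
      then have "f (r \<odot>\<^bsub>M\<^esub> x') \<in> f ` U" using U(5) that by auto
      then show ?thesis using * U(1) that mhomD(3)[OF assms(3), of r x'] by (simp add: subset_iff)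
    qed
  qed
qed

lemma submodule_span_least:
  assumes "module R M" "S \<subseteq> carrier M"
  shows "submodule (submodule_span R M S) R M" "S \<subseteq> submodule_span R M S"
    and "\<And>U. submodule U R M \<Longrightarrow> S \<subseteq> U \<Longrightarrow> submodule_span R M S \<subseteq> U"
proof -
  interpret M: module R M by fact
  have c: "submodule (carrier M) R M" by (rule M.carrier_is_submodule)
  show "submodule (submodule_span R M S) R M"
  proof (rule submoduleI'[OF assms(1)])
    show "submodule_span R M S \<subseteq> carrier M" unfolding submodule_span_def using c assms(2) by auto
  qed (auto simp: submodule_span_def submoduleD[OF assms(1)])
qed (auto simp: submodule_span_def)

lemma submodule_span_mono: "S \<subseteq> T \<Longrightarrow> submodule_span R M S \<subseteq> submodule_span R M T"
  unfolding submodule_span_def by auto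

lemma ideal_module_simps [simp]:
  "carrier (ideal_module R J) = J" "\<zero>\<^bsub>ideal_module R J\<^esub> = \<zero>\<^bsub>R\<^esub>"
  "x \<oplus>\<^bsub>ideal_module R J\<^esub> y = x \<oplus>\<^bsub>R\<^esub> y" "r \<odot>\<^bsub>ideal_module R J\<^esub> x = r \<otimes>\<^bsub>R\<^esub> x"
  by (auto simp: ideal_module_def)

lemma module_self: fixes R (structure) assumes "cring R" shows "module R (self_module R)"
proof -
  interpret cring R by fact
  show ?thesis
    by (intro moduleI abelian_groupI)
      (auto simp: assms a_ac l_distr r_distr m_assoc intro: l_neg)
qed

text \<open>
  This turns the closure operations on submodules (kernels, images, spans) into ways of producing
  ideals.
\<close>

lemma ideal_iff_submodule:
  fixes R (structure)
  assumes "cring R"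
  shows "ideal J R \<longleftrightarrow> submodule J R (self_module R)"
proof -
  interpret cring R by fact
  interpret S: module R "self_module R" by (rule module_self) fact
  show ?thesis
  proof
    assume "ideal J R"
    then interpret J: ideal J R .
    show "submodule J R (self_module R)"
      by (rule submoduleI'[OF S.module_axioms]) (auto simp: J.I_l_closed)
  next
    assume J: "submodule J R (self_module R)"
    note J = submoduleD[OF S.module_axioms this]
    have inv: "\<ominus> x \<in> J" if "x \<in> J" for x
    proof -
      have "(\<ominus> \<one>) \<odot>\<^bsub>self_module R\<^esub> x \<in> J" using that J(5) by blast
      moreover have "x \<in> carrier R" using J(1) that by auto
      ultimately show ?thesis by (simp add: l_minus)
    qed
    show "ideal J R"
    proof (rule idealI[OF ring_axioms])
      show "subgroup J (add_monoid R)"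
      proof (rule group.subgroupI[OF add.group_axioms])
        show "J \<subseteq> carrier (add_monoid R)" "J \<noteq> {}" using J(1,2) by auto
        show "inv\<^bsub>add_monoid R\<^esub> a \<in> J" if "a \<in> J" for a
          using inv[OF that] by (simp add: a_inv_def)
        show "a \<otimes>\<^bsub>add_monoid R\<^esub> b \<in> J" if "a \<in> J" "b \<in> J" for a b
          using J(3)[OF that] by simp
      qed
      show "x \<otimes> a \<in> J" if "a \<in> J" "x \<in> carrier R" for a x
        using J(5)[OF that(2,1)] by simp
      show "a \<otimes> x \<in> J" if "a \<in> J" "x \<in> carrier R" for a x
        using J(1) J(5)[OF that(2,1)] that m_comm[of a x] by auto
    qed
  qed
qed

lemma module_ideal:
  assumes "cring R" "ideal J R" shows "module R (ideal_module R J)"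
proof -
  have "submodule J R (self_module R)" using assms ideal_iff_submodule by auto
  from submodule.submodule_is_module[OF this module_self[OF assms(1)]]
  show ?thesis by (simp add: ideal_module_def)
qed

lemma module_quot:
  assumes "module R M" "submodule U R M"
  shows "module R (quot_module M U)"
    and "(\<lambda>x. U +>\<^bsub>M\<^esub> x) \<in> mhom R M (quot_module M U)"
    and "carrier (quot_module M U) = (\<lambda>x. U +>\<^bsub>M\<^esub> x) ` carrier M"
    and "\<And>x. x \<in> carrier M \<Longrightarrow> U +>\<^bsub>M\<^esub> x = \<zero>\<^bsub>quot_module M U\<^esub> \<longleftrightarrow> x \<in> U"
proof -
  interpret M: module R M by fact
  note U = submoduleD[OF assms]
  have "abelian_subgroup U M"
    using assms(2) by (intro abelian_subgroupI3 additive_subgroup.intro M.abelian_group_axioms)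
      (auto simp: submodule_def)
  then interpret U: abelian_subgroup U M .
  let ?Q = "quot_module M U"
  let ?c = "\<lambda>x. U +>\<^bsub>M\<^esub> x"
  show car: "carrier ?Q = ?c ` carrier M"
    by (auto simp: quot_module_def A_RCOSETS_def' )
  have zero: "\<zero>\<^bsub>?Q\<^esub> = ?c \<zero>\<^bsub>M\<^esub>" using U(1) M.a_coset_add_zero[of U] by (simp add: quot_module_def)
  have add: "?c x \<oplus>\<^bsub>?Q\<^esub> ?c y = ?c (x \<oplus>\<^bsub>M\<^esub> y)" if "x \<in> carrier M" "y \<in> carrier M" for x y
    using U.a_rcos_sum[OF that] by (simp add: quot_module_def)
  have smult: "r \<odot>\<^bsub>?Q\<^esub> ?c x = ?c (r \<odot>\<^bsub>M\<^esub> x)" if "r \<in> carrier R" "x \<in> carrier M" for r x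
  proof -
    have "?c (r \<odot>\<^bsub>M\<^esub> y) = ?c (r \<odot>\<^bsub>M\<^esub> x)" if y: "y \<in> ?c x" for y
    proof -
      obtain u where u: "u \<in> U" "y = u \<oplus>\<^bsub>M\<^esub> x" using y by (auto simp: a_r_coset_def')
      then have "r \<odot>\<^bsub>M\<^esub> y = r \<odot>\<^bsub>M\<^esub> u \<oplus>\<^bsub>M\<^esub> r \<odot>\<^bsub>M\<^esub> x"
        using U(1) \<open>r \<in> carrier R\<close> \<open>x \<in> carrier M\<close> by (auto simp: M.smult_r_distr)
      then have "r \<odot>\<^bsub>M\<^esub> y \<in> ?c (r \<odot>\<^bsub>M\<^esub> x)"
        using U(5)[OF \<open>r \<in> carrier R\<close> u(1)] by (auto simp: a_r_coset_def')
      then show ?thesis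
        using \<open>r \<in> carrier R\<close> \<open>x \<in> carrier M\<close> M.smult_closed[of r x]
        by (intro M.a_repr_independence[symmetric]) (auto simp: U.a_subgroup)
    qed
    moreover have "x \<in> ?c x" using U.a_rcos_self that by simp
    ultimately have "(\<Union>y\<in>?c x. ?c (r \<odot>\<^bsub>M\<^esub> y)) = ?c (r \<odot>\<^bsub>M\<^esub> x)"
      by (intro SUP_eq_const) blast+
    then show ?thesis by (simp add: quot_module_def)
  qed
  show "?c \<in> mhom R M ?Q"
    by (rule mhomI) (auto simp: car add smult)
  show "module R ?Q"
  proof (rule moduleI)
    show "cring R" by (rule M.R.is_cring)
    show "abelian_group ?Q"
    proof (rule abelian_groupI)
      show "\<exists>y\<in>carrier ?Q. y \<oplus>\<^bsub>?Q\<^esub> x = \<zero>\<^bsub>?Q\<^esub>" if x: "x \<in> carrier ?Q" for x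
      proof -
        obtain z where z: "z \<in> carrier M" "x = ?c z" using x car by auto
        then have "?c (\<ominus>\<^bsub>M\<^esub> z) \<oplus>\<^bsub>?Q\<^esub> x = \<zero>\<^bsub>?Q\<^esub>" using add zero by (simp add: M.l_neg)
        then show ?thesis using z car by auto
      qed
    qed (auto simp: car zero add M.a_ac)
  qed (auto simp: car add smult M.smult_l_distr M.smult_r_distr M.smult_assoc1)
  show "?c x = \<zero>\<^bsub>?Q\<^esub> \<longleftrightarrow> x \<in> U" if "x \<in> carrier M" for x
    using U.a_rcos_self[OF that] M.a_coset_join2[OF that U.a_subgroup]
    by (auto simp: quot_module_def)
qed

section \<open>Direct sums of copies of a module\<close>

lemma copower_simps [simp]:
  "\<zero>\<^bsub>copower N \<Lambda>\<^esub> = (\<lambda>i\<in>\<Lambda>. \<zero>\<^bsub>N\<^esub>)"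
  "f \<oplus>\<^bsub>copower N \<Lambda>\<^esub> g = (\<lambda>i\<in>\<Lambda>. f i \<oplus>\<^bsub>N\<^esub> g i)"
  "r \<odot>\<^bsub>copower N \<Lambda>\<^esub> f = (\<lambda>i\<in>\<Lambda>. r \<odot>\<^bsub>N\<^esub> f i)"
  by (auto simp: copower_def)

lemma copower_carrier:
  "f \<in> carrier (copower N \<Lambda>) \<longleftrightarrow> f \<in> \<Lambda> \<rightarrow>\<^sub>E carrier N \<and> finite {i\<in>\<Lambda>. f i \<noteq> \<zero>\<^bsub>N\<^esub>}"
  by (auto simp: copower_def)

lemma copower_carrier_finite: "finite \<Lambda> \<Longrightarrow> carrier (copower N \<Lambda>) = \<Lambda> \<rightarrow>\<^sub>E carrier N"
  by (auto simp: copower_def)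

lemma module_copower:
  assumes "module R N" shows "module R (copower N \<Lambda>)"
proof -
  interpret N: module R N by fact
  let ?C = "copower N \<Lambda>"
  have val: "f i \<in> carrier N" if "f \<in> carrier ?C" "i \<in> \<Lambda>" for f i
    using that by (auto simp: copower_carrier)
  have add: "f \<oplus>\<^bsub>?C\<^esub> g \<in> carrier ?C" if "f \<in> carrier ?C" "g \<in> carrier ?C" for f g
  proof -
    have "finite ({i\<in>\<Lambda>. f i \<noteq> \<zero>\<^bsub>N\<^esub>} \<union> {i\<in>\<Lambda>. g i \<noteq> \<zero>\<^bsub>N\<^esub>})" using that by (auto simp: copower_carrier)
    then have "finite {i\<in>\<Lambda>. f i \<oplus>\<^bsub>N\<^esub> g i \<noteq> \<zero>\<^bsub>N\<^esub>}" by (rule rev_finite_subset) auto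
    then show ?thesis using val that by (simp add: copower_carrier cong: conj_cong)
  qed
  have smult: "r \<odot>\<^bsub>?C\<^esub> f \<in> carrier ?C" if "f \<in> carrier ?C" "r \<in> carrier R" for f r
  proof -
    have "finite {i\<in>\<Lambda>. f i \<noteq> \<zero>\<^bsub>N\<^esub>}" using that by (auto simp: copower_carrier)
    then have "finite {i\<in>\<Lambda>. r \<odot>\<^bsub>N\<^esub> f i \<noteq> \<zero>\<^bsub>N\<^esub>}" by (rule rev_finite_subset) (use that in auto)
    then show ?thesis using val that by (simp add: copower_carrier cong: conj_cong)
  qed
  have ext: "(\<lambda>i\<in>\<Lambda>. f i) = f" if "f \<in> carrier ?C" for f
    using that by (auto simp: copower_carrier PiE_restrict)
  show ?thesis
  proof (rule moduleI)
    show "cring R" by (rule N.R.is_cring)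
    show "abelian_group ?C"
    proof (rule abelian_groupI)
      show "\<zero>\<^bsub>?C\<^esub> \<in> carrier ?C" by (auto simp: copower_carrier cong: conj_cong)
      fix f assume f: "f \<in> carrier ?C"
      show "\<zero>\<^bsub>?C\<^esub> \<oplus>\<^bsub>?C\<^esub> f = f"
        using val[OF f] ext[OF f] by (auto cong: restrict_cong)
      show "\<exists>g\<in>carrier ?C. g \<oplus>\<^bsub>?C\<^esub> f = \<zero>\<^bsub>?C\<^esub>"
        using val[OF f] smult[OF f, of "\<ominus>\<^bsub>R\<^esub> \<one>\<^bsub>R\<^esub>"]
        by (intro bexI[of _ "(\<ominus>\<^bsub>R\<^esub> \<one>\<^bsub>R\<^esub>) \<odot>\<^bsub>?C\<^esub> f"])
          (auto simp: N.smult_l_minus N.l_neg cong: restrict_cong)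
    qed (use add val in \<open>auto simp: N.a_ac intro!: restrict_ext\<close>)
    show "\<one>\<^bsub>R\<^esub> \<odot>\<^bsub>?C\<^esub> f = f" if "f \<in> carrier ?C" for f
      using val[OF that] ext[OF that] by (auto cong: restrict_cong)
  qed (use add smult val in \<open>auto simp: N.smult_l_distr N.smult_r_distr N.smult_assoc1
        intro!: restrict_ext\<close>)
qed

definition single :: "('r, 'n) module \<Rightarrow> 'i set \<Rightarrow> 'i \<Rightarrow> 'n \<Rightarrow> 'i \<Rightarrow> 'n" where
  "single N \<Lambda> i a = (\<lambda>j\<in>\<Lambda>. if j = i then a else \<zero>\<^bsub>N\<^esub>)"

lemma single_mhom:
  assumes "module R N" "i \<in> \<Lambda>" shows "single N \<Lambda> i \<in> mhom R N (copower N \<Lambda>)"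
proof -
  interpret N: module R N by fact
  show ?thesis
  proof (rule mhomI)
    fix x assume "x \<in> carrier N"
    moreover have "finite {j\<in>\<Lambda>. single N \<Lambda> i x j \<noteq> \<zero>\<^bsub>N\<^esub>}"
      by (rule finite_subset[of _ "{i}"]) (auto simp: single_def)
    ultimately show "single N \<Lambda> i x \<in> carrier (copower N \<Lambda>)"
      by (auto simp: copower_carrier single_def)
  qed (auto simp: single_def intro!: restrict_ext)
qed

lemma copower_induct:
  assumes "module R N" "submodule U R (copower N \<Lambda>)"
    and "\<And>i a. i \<in> \<Lambda> \<Longrightarrow> a \<in> carrier N \<Longrightarrow> single N \<Lambda> i a \<in> U"
  shows "carrier (copower N \<Lambda>) \<subseteq> U"
proof -
  interpret N: module R N by fact
  note U = submoduleD[OF module_copower[OF assms(1)] assms(2)]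
  have "f \<in> U" if "finite T" "f \<in> carrier (copower N \<Lambda>)" "{i\<in>\<Lambda>. f i \<noteq> \<zero>\<^bsub>N\<^esub>} \<subseteq> T" for T f
    using that
  proof (induction T arbitrary: f rule: finite_induct)
    case empty
    then have "f = \<zero>\<^bsub>copower N \<Lambda>\<^esub>"
      by (auto simp: copower_carrier PiE_def extensional_def)
    then show ?case using U(2) by metis
  next
    case (insert i T)
    show ?case
    proof (cases "i \<in> \<Lambda>")
      case False
      then show ?thesis using insert by auto
    next
      case True
      have val: "f j \<in> carrier N" if "j \<in> \<Lambda>" for j
        using insert.prems(1) that by (auto simp: copower_carrier)
      let ?g = "\<lambda>j\<in>\<Lambda>. if j = i then \<zero>\<^bsub>N\<^esub> else f j"
      have "finite {j\<in>\<Lambda>. ?g j \<noteq> \<zero>\<^bsub>N\<^esub>}"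
        using insert by (auto intro: finite_subset[of _ T])
      then have "?g \<in> carrier (copower N \<Lambda>)"
        using val by (auto simp: copower_carrier)
      then have "?g \<in> U" by (rule insert.IH) (use insert.prems(2) in auto)
      moreover have "single N \<Lambda> i (f i) \<in> U" using True val assms(3) by auto
      ultimately have "single N \<Lambda> i (f i) \<oplus>\<^bsub>copower N \<Lambda>\<^esub> ?g \<in> U" by (intro U(3))
      also have "single N \<Lambda> i (f i) \<oplus>\<^bsub>copower N \<Lambda>\<^esub> ?g = f"
        using insert.prems(1) val
        by (auto simp: copower_carrier PiE_def extensional_def single_def fun_eq_iff)
      finally show ?thesis .
    qed
  qed
  then show ?thesis by (auto simp: copower_carrier)
qed

text \<open>
  Summing over the support only keeps the sum finite for infinite index sets.
\<close>

definition copower_map ::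
    "('r, 'n) module \<Rightarrow> ('r, 'm) module \<Rightarrow> 'i set \<Rightarrow> ('i \<Rightarrow> 'n \<Rightarrow> 'm) \<Rightarrow> ('i \<Rightarrow> 'n) \<Rightarrow> 'm" where
  "copower_map N Q \<Lambda> h F = finsum Q (\<lambda>i. h i (F i)) {i\<in>\<Lambda>. F i \<noteq> \<zero>\<^bsub>N\<^esub>}"

lemma copower_map:
  assumes "module R N" "module R Q" "\<And>i. i \<in> \<Lambda> \<Longrightarrow> h i \<in> mhom R N Q"
  shows "copower_map N Q \<Lambda> h \<in> mhom R (copower N \<Lambda>) Q"
    and "\<And>i a. i \<in> \<Lambda> \<Longrightarrow> a \<in> carrier N \<Longrightarrow> copower_map N Q \<Lambda> h (single N \<Lambda> i a) = h i a"
proof -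
  interpret N: module R N by fact
  interpret Q: module R Q by fact
  let ?C = "copower N \<Lambda>"
  interpret C: module R ?C by (rule module_copower) fact
  have h0: "h i \<zero>\<^bsub>N\<^esub> = \<zero>\<^bsub>Q\<^esub>" if "i \<in> \<Lambda>" for i
    using mhom_zero[OF assms(1,2)] assms(3) that by auto
  have h: "h i (F i) \<in> carrier Q" if "i \<in> \<Lambda>" "F \<in> carrier ?C" for F i
    using that mhomD(1)[OF assms(3)] by (auto simp: copower_carrier)
  have val: "F i \<in> carrier N" if "i \<in> \<Lambda>" "F \<in> carrier ?C" for F i
    using that by (auto simp: copower_carrier)
  have eq: "copower_map N Q \<Lambda> h F = finsum Q (\<lambda>i. h i (F i)) T"
    if "finite T" "T \<subseteq> \<Lambda>" "F \<in> carrier ?C" "{i\<in>\<Lambda>. F i \<noteq> \<zero>\<^bsub>N\<^esub>} \<subseteq> T" for F T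
    unfolding copower_map_def
    using that h h0 by (intro Q.add.finprod_mono_neutral_cong_left) auto
  show "copower_map N Q \<Lambda> h \<in> mhom R ?C Q"
  proof (rule mhomI)
    fix F assume F: "F \<in> carrier ?C"
    then show "copower_map N Q \<Lambda> h F \<in> carrier Q"
      unfolding copower_map_def by (intro Q.finsum_closed) (auto intro: h)
    fix G assume G: "G \<in> carrier ?C"
    let ?T = "{i\<in>\<Lambda>. F i \<noteq> \<zero>\<^bsub>N\<^esub>} \<union> {i\<in>\<Lambda>. G i \<noteq> \<zero>\<^bsub>N\<^esub>}"
    have T: "finite ?T" "?T \<subseteq> \<Lambda>" using F G by (auto simp: copower_carrier)
    have FG: "F \<oplus>\<^bsub>?C\<^esub> G \<in> carrier ?C" using F G by (rule C.a_closed)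
    have "copower_map N Q \<Lambda> h (F \<oplus>\<^bsub>?C\<^esub> G) = finsum Q (\<lambda>i. h i ((F \<oplus>\<^bsub>?C\<^esub> G) i)) ?T"
      by (rule eq[OF T FG]) auto
    also have "\<dots> = finsum Q (\<lambda>i. h i (F i) \<oplus>\<^bsub>Q\<^esub> h i (G i)) ?T"
      using F G by (intro Q.finsum_cong') (auto simp: h val mhomD(2)[OF assms(3)])
    also have "\<dots> = finsum Q (\<lambda>i. h i (F i)) ?T \<oplus>\<^bsub>Q\<^esub> finsum Q (\<lambda>i. h i (G i)) ?T"
      using F G by (intro Q.finsum_addf) (auto intro: h)
    finally show "copower_map N Q \<Lambda> h (F \<oplus>\<^bsub>?C\<^esub> G) =
        copower_map N Q \<Lambda> h F \<oplus>\<^bsub>Q\<^esub> copower_map N Q \<Lambda> h G"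
      using eq[OF T F] eq[OF T G] by auto
  next
    fix F r assume F: "F \<in> carrier ?C" and r: "r \<in> carrier R"
    let ?T = "{i\<in>\<Lambda>. F i \<noteq> \<zero>\<^bsub>N\<^esub>}"
    have T: "finite ?T" "?T \<subseteq> \<Lambda>" using F by (auto simp: copower_carrier)
    have rF: "r \<odot>\<^bsub>?C\<^esub> F \<in> carrier ?C" using r F by (rule C.smult_closed)
    have "copower_map N Q \<Lambda> h (r \<odot>\<^bsub>?C\<^esub> F) = finsum Q (\<lambda>i. h i ((r \<odot>\<^bsub>?C\<^esub> F) i)) ?T"
      by (rule eq[OF T rF]) (use r in auto)
    also have "\<dots> = finsum Q (\<lambda>i. r \<odot>\<^bsub>Q\<^esub> h i (F i)) ?T"
      using F r by (intro Q.finsum_cong') (auto simp: h val mhomD(3)[OF assms(3)])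
    also have "\<dots> = r \<odot>\<^bsub>Q\<^esub> finsum Q (\<lambda>i. h i (F i)) ?T"
      using T r F by (intro Q.finsum_smult_ldistr[symmetric]) (auto intro: h)
    finally show "copower_map N Q \<Lambda> h (r \<odot>\<^bsub>?C\<^esub> F) = r \<odot>\<^bsub>Q\<^esub> copower_map N Q \<Lambda> h F"
      using eq[OF T F] by auto
  qed
  fix i a assume i: "i \<in> \<Lambda>" and a: "a \<in> carrier N"
  have "copower_map N Q \<Lambda> h (single N \<Lambda> i a) = finsum Q (\<lambda>j. h j (single N \<Lambda> i a j)) {i}"
    using i a mhomD(1)[OF single_mhom[OF assms(1) i] a]
    by (intro eq) (auto simp: single_def)
  then show "copower_map N Q \<Lambda> h (single N \<Lambda> i a) = h i a"
    using i a mhomD(1)[OF assms(3)[OF i] a] by (simp add: single_def)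
qed

section \<open>Baer's criterion\<close>

text \<open>
  Only ideals serve as test objects, so this notion of injectivity involves no types besides those
  of \<open>R\<close> and \<open>Q\<close>; extension along inclusions of modules of every type is recovered in
  \<open>baer_criterion\<close>.
\<close>

definition baer_injective :: "('r, 'x) ring_scheme \<Rightarrow> ('r, 'm) module \<Rightarrow> bool" where
  "baer_injective R Q \<longleftrightarrow> module R Q \<and>
     (\<forall>A g. ideal A R \<and> g \<in> mhom R (ideal_module R A) Q \<longrightarrow>
        (\<exists>q\<in>carrier Q. \<forall>a\<in>A. g a = a \<odot>\<^bsub>Q\<^esub> q))"

lemma injective_module_baer:
  assumes "injective_module R E" shows "baer_injective R E"
  unfolding baer_injective_def
proof (intro conjI allI impI)
  show E: "module R E" using assms by (auto simp: injective_module_def)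
  then interpret E: module R E .
  fix A g assume A: "ideal A R \<and> g \<in> mhom R (ideal_module R A) E"
  have cr: "cring R" by (rule E.R.is_cring)
  have sub: "A \<subseteq> carrier R" using A ideal.Icarr by fastforce
  then have "(\<lambda>a. a) \<in> mhom R (ideal_module R A) (self_module R)"
    by (auto simp: mhom_def)
  with assms A module_self[OF cr] module_ideal[OF cr]
  obtain h where h: "h \<in> mhom R (self_module R) E" "\<forall>a\<in>carrier (ideal_module R A). h a = g a"
    unfolding injective_module_def by (metis inj_on_id2)
  show "\<exists>q\<in>carrier E. \<forall>a\<in>A. g a = a \<odot>\<^bsub>E\<^esub> q"
  proof (intro bexI ballI)
    show "h \<one>\<^bsub>R\<^esub> \<in> carrier E" using mhomD(1)[OF h(1)] by simp
    fix a assume "a \<in> A"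
    then show "g a = a \<odot>\<^bsub>E\<^esub> h \<one>\<^bsub>R\<^esub>" using h sub mhomD(3)[OF h(1), of a "\<one>\<^bsub>R\<^esub>"] by auto
  qed
qed

text \<open>
  Homomorphisms from a submodule of \<open>N\<close> to \<open>Q\<close>, encoded by their graphs: an extension is then a
  superset, and by linearity being single-valued amounts to the last clause.
\<close>

definition partial_hom :: "('r, 'x) ring_scheme \<Rightarrow> ('r, 'n) module \<Rightarrow> ('r, 'm) module \<Rightarrow> ('n \<times> 'm) set \<Rightarrow> bool" where
  "partial_hom R N Q G \<longleftrightarrow> G \<subseteq> carrier N \<times> carrier Q \<and> (\<zero>\<^bsub>N\<^esub>, \<zero>\<^bsub>Q\<^esub>) \<in> G \<and>
     (\<forall>x y x' y'. (x, y) \<in> G \<longrightarrow> (x', y') \<in> G \<longrightarrow> (x \<oplus>\<^bsub>N\<^esub> x', y \<oplus>\<^bsub>Q\<^esub> y') \<in> G) \<and>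
     (\<forall>r x y. r \<in> carrier R \<longrightarrow> (x, y) \<in> G \<longrightarrow> (r \<odot>\<^bsub>N\<^esub> x, r \<odot>\<^bsub>Q\<^esub> y) \<in> G) \<and>
     (\<forall>y. (\<zero>\<^bsub>N\<^esub>, y) \<in> G \<longrightarrow> y = \<zero>\<^bsub>Q\<^esub>)"

lemma partial_homD:
  assumes "partial_hom R N Q G"
  shows "(x, y) \<in> G \<Longrightarrow> x \<in> carrier N" "(x, y) \<in> G \<Longrightarrow> y \<in> carrier Q" "(\<zero>\<^bsub>N\<^esub>, \<zero>\<^bsub>Q\<^esub>) \<in> G"
    "(x, y) \<in> G \<Longrightarrow> (x', y') \<in> G \<Longrightarrow> (x \<oplus>\<^bsub>N\<^esub> x', y \<oplus>\<^bsub>Q\<^esub> y') \<in> G"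
    "r \<in> carrier R \<Longrightarrow> (x, y) \<in> G \<Longrightarrow> (r \<odot>\<^bsub>N\<^esub> x, r \<odot>\<^bsub>Q\<^esub> y) \<in> G"
    "(\<zero>\<^bsub>N\<^esub>, y) \<in> G \<Longrightarrow> y = \<zero>\<^bsub>Q\<^esub>"
  using assms unfolding partial_hom_def by blast+

lemma partial_hom_unique:
  assumes "module R N" "module R Q" "partial_hom R N Q G" "(x, y) \<in> G" "(x, y') \<in> G"
  shows "y = y'"
proof -
  interpret N: module R N by fact
  interpret Q: module R Q by fact
  note G = partial_homD[OF assms(3)]
  have c: "x \<in> carrier N" "y \<in> carrier Q" "y' \<in> carrier Q" using G(1,2) assms(4,5) by auto
  let ?m = "\<ominus>\<^bsub>R\<^esub> \<one>\<^bsub>R\<^esub>"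
  have "(x \<oplus>\<^bsub>N\<^esub> ?m \<odot>\<^bsub>N\<^esub> x, y \<oplus>\<^bsub>Q\<^esub> ?m \<odot>\<^bsub>Q\<^esub> y') \<in> G"
    using assms(4,5) by (intro G(4,5)) auto
  then have "(\<zero>\<^bsub>N\<^esub>, y \<ominus>\<^bsub>Q\<^esub> y') \<in> G"
    using c by (simp add: N.smult_l_minus Q.smult_l_minus N.r_neg a_minus_def)
  then have "y \<ominus>\<^bsub>Q\<^esub> y' = \<zero>\<^bsub>Q\<^esub>" by (rule G(6))
  then show ?thesis by (rule Q.eq_if_minus_zero[OF c(2,3)])
qed

text \<open>
  The multipliers \<open>r\<close> that move \<open>x\<close> into the domain form an ideal, on which the given map restricts to
  a homomorphism \<open>r \<mapsto> g r\<close> into \<open>Q\<close>. By assumption it is multiplication with some \<open>q\<close>, and \<open>x \<mapsto> q\<close> is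
  a consistent choice for the extension.
\<close>

lemma baer_extend_partial_hom:
  assumes "baer_injective R Q" "module R N" "partial_hom R N Q G" "x \<in> carrier N" "x \<notin> Domain G"
  shows "\<exists>G'. partial_hom R N Q G' \<and> G \<subset> G'"
proof -
  have Q: "module R Q" using assms(1) by (simp add: baer_injective_def)
  interpret Q: module R Q by fact
  interpret N: module R N by fact
  note G = partial_homD[OF assms(3)]
  note uniq = partial_hom_unique[OF assms(2) Q assms(3)]
  define A where "A = {r \<in> carrier R. r \<odot>\<^bsub>N\<^esub> x \<in> Domain G}"
  define g where "g r = (THE y. (r \<odot>\<^bsub>N\<^esub> x, y) \<in> G)" for r
  have g: "(r \<odot>\<^bsub>N\<^esub> x, y) \<in> G \<Longrightarrow> g r = y" for r y
    unfolding g_def using uniq by blast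
  have gA: "(r \<odot>\<^bsub>N\<^esub> x, g r) \<in> G" if "r \<in> A" for r
    using that g by (auto simp: A_def)
  have "submodule A R (self_module R)"
  proof (rule submoduleI'[OF module_self[OF Q.R.is_cring]])
    show "\<zero>\<^bsub>self_module R\<^esub> \<in> A" using G(3) assms(4) by (auto simp: A_def)
    show "a \<oplus>\<^bsub>self_module R\<^esub> b \<in> A" if "a \<in> A" "b \<in> A" for a b
      using G(4)[OF gA[OF that(1)] gA[OF that(2)]] that assms(4)
      by (auto simp: A_def N.smult_l_distr)
    show "r \<odot>\<^bsub>self_module R\<^esub> b \<in> A" if "r \<in> carrier R" "b \<in> A" for r b
      using G(5)[OF that(1) gA[OF that(2)]] that assms(4)
      by (auto simp: A_def N.smult_assoc1)
  qed (auto simp: A_def)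
  then have A: "ideal A R" using ideal_iff_submodule[OF Q.R.is_cring] by auto
  have "g \<in> mhom R (ideal_module R A) Q"
  proof (rule mhomI; simp)
    show "g a \<in> carrier Q" if "a \<in> A" for a using gA[OF that] G(2) by auto
    show "g (a \<oplus>\<^bsub>R\<^esub> b) = g a \<oplus>\<^bsub>Q\<^esub> g b" if "a \<in> A" "b \<in> A" for a b
      using G(4)[OF gA[OF that(1)] gA[OF that(2)]] that assms(4)
      by (intro g) (auto simp: A_def N.smult_l_distr)
    show "g (r \<otimes>\<^bsub>R\<^esub> b) = r \<odot>\<^bsub>Q\<^esub> g b" if "r \<in> carrier R" "b \<in> A" for r b
      using G(5)[OF that(1) gA[OF that(2)]] that assms(4)
      by (intro g) (auto simp: A_def N.smult_assoc1)
  qed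
  then obtain q where q: "q \<in> carrier Q" "\<forall>a\<in>A. g a = a \<odot>\<^bsub>Q\<^esub> q"
    using assms(1) A unfolding baer_injective_def by blast
  define G' where "G' = {(y \<oplus>\<^bsub>N\<^esub> r \<odot>\<^bsub>N\<^esub> x, e \<oplus>\<^bsub>Q\<^esub> r \<odot>\<^bsub>Q\<^esub> q) | y e r. (y, e) \<in> G \<and> r \<in> carrier R}"
  have "partial_hom R N Q G'"
    unfolding partial_hom_def
  proof (intro conjI allI impI)
    show "G' \<subseteq> carrier N \<times> carrier Q" using G(1,2) assms(4) q by (auto simp: G'_def)
    show "(\<zero>\<^bsub>N\<^esub>, \<zero>\<^bsub>Q\<^esub>) \<in> G'"
    proof -
      have "(\<zero>\<^bsub>N\<^esub> \<oplus>\<^bsub>N\<^esub> \<zero>\<^bsub>R\<^esub> \<odot>\<^bsub>N\<^esub> x, \<zero>\<^bsub>Q\<^esub> \<oplus>\<^bsub>Q\<^esub> \<zero>\<^bsub>R\<^esub> \<odot>\<^bsub>Q\<^esub> q) \<in> G'"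
        using G(3) unfolding G'_def by blast
      then show ?thesis using assms(4) q by simp
    qed
  next
    fix a b a' b' assume "(a, b) \<in> G'" "(a', b') \<in> G'"
    then obtain y e r y' e' r' where *:
      "a = y \<oplus>\<^bsub>N\<^esub> r \<odot>\<^bsub>N\<^esub> x" "b = e \<oplus>\<^bsub>Q\<^esub> r \<odot>\<^bsub>Q\<^esub> q" "(y, e) \<in> G" "r \<in> carrier R"
      "a' = y' \<oplus>\<^bsub>N\<^esub> r' \<odot>\<^bsub>N\<^esub> x" "b' = e' \<oplus>\<^bsub>Q\<^esub> r' \<odot>\<^bsub>Q\<^esub> q" "(y', e') \<in> G" "r' \<in> carrier R"
      unfolding G'_def by blast
    have c: "y \<in> carrier N" "y' \<in> carrier N" "e \<in> carrier Q" "e' \<in> carrier Q" using * G(1,2) by auto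
    have "((y \<oplus>\<^bsub>N\<^esub> y') \<oplus>\<^bsub>N\<^esub> (r \<oplus>\<^bsub>R\<^esub> r') \<odot>\<^bsub>N\<^esub> x, (e \<oplus>\<^bsub>Q\<^esub> e') \<oplus>\<^bsub>Q\<^esub> (r \<oplus>\<^bsub>R\<^esub> r') \<odot>\<^bsub>Q\<^esub> q) \<in> G'"
      using G(4)[OF *(3,7)] * unfolding G'_def by blast
    moreover have "(y \<oplus>\<^bsub>N\<^esub> y') \<oplus>\<^bsub>N\<^esub> (r \<oplus>\<^bsub>R\<^esub> r') \<odot>\<^bsub>N\<^esub> x = a \<oplus>\<^bsub>N\<^esub> a'"
      "(e \<oplus>\<^bsub>Q\<^esub> e') \<oplus>\<^bsub>Q\<^esub> (r \<oplus>\<^bsub>R\<^esub> r') \<odot>\<^bsub>Q\<^esub> q = b \<oplus>\<^bsub>Q\<^esub> b'"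
      using * c assms(4) q by (simp_all add: N.smult_l_distr Q.smult_l_distr N.a_ac Q.a_ac)
    ultimately show "(a \<oplus>\<^bsub>N\<^esub> a', b \<oplus>\<^bsub>Q\<^esub> b') \<in> G'" by simp
  next
    fix s a b assume s: "s \<in> carrier R" and "(a, b) \<in> G'"
    then obtain y e r where *:
      "a = y \<oplus>\<^bsub>N\<^esub> r \<odot>\<^bsub>N\<^esub> x" "b = e \<oplus>\<^bsub>Q\<^esub> r \<odot>\<^bsub>Q\<^esub> q" "(y, e) \<in> G" "r \<in> carrier R"
      unfolding G'_def by blast
    have c: "y \<in> carrier N" "e \<in> carrier Q" using * G(1,2) by auto
    have "(s \<odot>\<^bsub>N\<^esub> y \<oplus>\<^bsub>N\<^esub> (s \<otimes>\<^bsub>R\<^esub> r) \<odot>\<^bsub>N\<^esub> x, s \<odot>\<^bsub>Q\<^esub> e \<oplus>\<^bsub>Q\<^esub> (s \<otimes>\<^bsub>R\<^esub> r) \<odot>\<^bsub>Q\<^esub> q) \<in> G'"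
      using G(5)[OF s *(3)] * s unfolding G'_def by blast
    moreover have "s \<odot>\<^bsub>N\<^esub> y \<oplus>\<^bsub>N\<^esub> (s \<otimes>\<^bsub>R\<^esub> r) \<odot>\<^bsub>N\<^esub> x = s \<odot>\<^bsub>N\<^esub> a"
      "s \<odot>\<^bsub>Q\<^esub> e \<oplus>\<^bsub>Q\<^esub> (s \<otimes>\<^bsub>R\<^esub> r) \<odot>\<^bsub>Q\<^esub> q = s \<odot>\<^bsub>Q\<^esub> b"
      using * c s assms(4) q by (simp_all add: N.smult_r_distr Q.smult_r_distr N.smult_assoc1 Q.smult_assoc1)
    ultimately show "(s \<odot>\<^bsub>N\<^esub> a, s \<odot>\<^bsub>Q\<^esub> b) \<in> G'" by simp
  next
    fix b assume "(\<zero>\<^bsub>N\<^esub>, b) \<in> G'"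
    then obtain y e r where *:
      "\<zero>\<^bsub>N\<^esub> = y \<oplus>\<^bsub>N\<^esub> r \<odot>\<^bsub>N\<^esub> x" "b = e \<oplus>\<^bsub>Q\<^esub> r \<odot>\<^bsub>Q\<^esub> q" "(y, e) \<in> G" "r \<in> carrier R"
      unfolding G'_def by blast
    have c: "y \<in> carrier N" "e \<in> carrier Q" using * G(1,2) by auto
    have "r \<odot>\<^bsub>N\<^esub> x = \<ominus>\<^bsub>N\<^esub> y"
      using *(1,4) c assms(4) by (metis N.a_comm N.minus_equality N.smult_closed)
    moreover have "((\<ominus>\<^bsub>R\<^esub> \<one>\<^bsub>R\<^esub>) \<odot>\<^bsub>N\<^esub> y, (\<ominus>\<^bsub>R\<^esub> \<one>\<^bsub>R\<^esub>) \<odot>\<^bsub>Q\<^esub> e) \<in> G" using *(3) by (intro G(5)) auto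
    ultimately have rx: "(r \<odot>\<^bsub>N\<^esub> x, \<ominus>\<^bsub>Q\<^esub> e) \<in> G" using c by (simp add: N.smult_l_minus Q.smult_l_minus)
    then have "r \<in> A" using * by (auto simp: A_def)
    then have "r \<odot>\<^bsub>Q\<^esub> q = \<ominus>\<^bsub>Q\<^esub> e" using q(2) g[OF rx] by auto
    then show "b = \<zero>\<^bsub>Q\<^esub>" using * c by (simp add: Q.r_neg)
  qed
  moreover have "G \<subseteq> G'"
  proof
    fix p assume p: "p \<in> G"
    obtain y e where [simp]: "p = (y, e)" by force
    have "(y \<oplus>\<^bsub>N\<^esub> \<zero>\<^bsub>R\<^esub> \<odot>\<^bsub>N\<^esub> x, e \<oplus>\<^bsub>Q\<^esub> \<zero>\<^bsub>R\<^esub> \<odot>\<^bsub>Q\<^esub> q) \<in> G'" using p unfolding G'_def by auto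
    then show "p \<in> G'" using p G(1,2)[of y e] assms(4) q by simp
  qed
  moreover have "(x, q) \<in> G'"
  proof -
    have "(\<zero>\<^bsub>N\<^esub> \<oplus>\<^bsub>N\<^esub> \<one>\<^bsub>R\<^esub> \<odot>\<^bsub>N\<^esub> x, \<zero>\<^bsub>Q\<^esub> \<oplus>\<^bsub>Q\<^esub> \<one>\<^bsub>R\<^esub> \<odot>\<^bsub>Q\<^esub> q) \<in> G'"
      using G(3) unfolding G'_def by blast
    then show ?thesis using assms(4) q by simp
  qed
  ultimately show ?thesis using assms(5) by blast
qed

text \<open>
  By Zorn's lemma there is a maximal graph above \<open>G\<close>; the one-step extension shows that it is total.
\<close>

theorem baer_criterion:
  assumes "baer_injective R Q" "module R N" "partial_hom R N Q G"
  obtains f where "f \<in> mhom R N Q" "\<And>x y. (x, y) \<in> G \<Longrightarrow> f x = y"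
proof -
  have Q: "module R Q" using assms(1) by (simp add: baer_injective_def)
  define \<C> where "\<C> = {H. partial_hom R N Q H \<and> G \<subseteq> H}"
  have "\<exists>H\<in>\<C>. \<forall>K\<in>\<C>. H \<subseteq> K \<longrightarrow> K = H"
  proof (rule subset_Zorn_nonempty)
    show "\<C> \<noteq> {}" using assms(3) by (auto simp: \<C>_def)
    fix C assume C: "C \<noteq> {}" "subset.chain \<C> C"
    have p: "partial_hom R N Q H" "G \<subseteq> H" if "H \<in> C" for H
      using C(2) that by (auto simp: \<C>_def subset.chain_def)
    note D = partial_homD[OF p(1)]
    have common: "\<exists>H\<in>C. a \<in> H \<and> b \<in> H" if "a \<in> \<Union>C" "b \<in> \<Union>C" for a b
      using that C(2) unfolding subset.chain_def by blast
    have "partial_hom R N Q (\<Union>C)"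
      unfolding partial_hom_def
    proof (intro conjI allI impI)
      show "\<Union>C \<subseteq> carrier N \<times> carrier Q" using D(1,2) by auto
      show "(\<zero>\<^bsub>N\<^esub>, \<zero>\<^bsub>Q\<^esub>) \<in> \<Union>C" using D(3) C(1) by blast
      show "(x \<oplus>\<^bsub>N\<^esub> x', y \<oplus>\<^bsub>Q\<^esub> y') \<in> \<Union>C" if "(x, y) \<in> \<Union>C" "(x', y') \<in> \<Union>C" for x y x' y'
        using common[OF that] D(4) by blast
      show "(r \<odot>\<^bsub>N\<^esub> x, r \<odot>\<^bsub>Q\<^esub> y) \<in> \<Union>C" if "r \<in> carrier R" "(x, y) \<in> \<Union>C" for r x y
        using that D(5) by blast
      show "y = \<zero>\<^bsub>Q\<^esub>" if "(\<zero>\<^bsub>N\<^esub>, y) \<in> \<Union>C" for y using that D(6) by blast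
    qed
    then show "\<Union>C \<in> \<C>" using C(1) p(2) by (auto simp: \<C>_def)
  qed
  then obtain H where H: "partial_hom R N Q H" "G \<subseteq> H"
    and max: "\<And>K. partial_hom R N Q K \<Longrightarrow> H \<subseteq> K \<Longrightarrow> K = H"
    unfolding \<C>_def by auto
  have total: "x \<in> Domain H" if "x \<in> carrier N" for x
    using baer_extend_partial_hom[OF assms(1,2) H(1) that] max by blast
  define f where "f x = (THE y. (x, y) \<in> H)" for x
  have f: "(x, y) \<in> H \<Longrightarrow> f x = y" for x y
    unfolding f_def using partial_hom_unique[OF assms(2) Q H(1)] by blast
  have fH: "(x, f x) \<in> H" if "x \<in> carrier N" for x
    using total[OF that] f by blast
  note D = partial_homD[OF H(1)]
  have "f \<in> mhom R N Q"
    by (rule mhomI) (auto intro!: f D(4,5) fH D(2)[OF fH])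
  then show ?thesis using f H(2) that by blast
qed

text \<open>
  The map \<open>\<alpha> p \<mapsto> \<gamma> p\<close> is well defined on the image of \<open>\<alpha>\<close>; extend it to \<open>N\<close>.
\<close>

lemma baer_factorization:
  assumes "baer_injective R Q" "module R P" "module R N" "\<alpha> \<in> mhom R P N" "\<gamma> \<in> mhom R P Q"
    and ker: "\<And>p. p \<in> carrier P \<Longrightarrow> \<alpha> p = \<zero>\<^bsub>N\<^esub> \<Longrightarrow> \<gamma> p = \<zero>\<^bsub>Q\<^esub>"
  obtains f where "f \<in> mhom R N Q" "\<And>p. p \<in> carrier P \<Longrightarrow> f (\<alpha> p) = \<gamma> p"
proof -
  have mQ: "module R Q" using assms(1) by (simp add: baer_injective_def)
  interpret P: module R P by fact
  define G where "G = (\<lambda>p. (\<alpha> p, \<gamma> p)) ` carrier P"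
  have "partial_hom R N Q G"
    unfolding partial_hom_def
  proof (intro conjI allI impI)
    show "G \<subseteq> carrier N \<times> carrier Q" using mhomD(1)[OF assms(4)] mhomD(1)[OF assms(5)] by (auto simp: G_def)
    show "(\<zero>\<^bsub>N\<^esub>, \<zero>\<^bsub>Q\<^esub>) \<in> G"
      unfolding G_def mhom_zero[OF assms(2,3,4), symmetric] mhom_zero[OF assms(2) mQ assms(5), symmetric]
      by (rule imageI[OF P.zero_closed])
  next
    fix y e y' e' assume "(y, e) \<in> G" "(y', e') \<in> G"
    then obtain p p' where *: "p \<in> carrier P" "p' \<in> carrier P"
      "y = \<alpha> p" "e = \<gamma> p" "y' = \<alpha> p'" "e' = \<gamma> p'" unfolding G_def by blast
    have "(\<alpha> (p \<oplus>\<^bsub>P\<^esub> p'), \<gamma> (p \<oplus>\<^bsub>P\<^esub> p')) \<in> G"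
      using P.a_closed[OF *(1,2)] unfolding G_def by blast
    then show "(y \<oplus>\<^bsub>N\<^esub> y', e \<oplus>\<^bsub>Q\<^esub> e') \<in> G"
      using mhomD(2)[OF assms(4) *(1,2)] mhomD(2)[OF assms(5) *(1,2)] * by simp
  next
    fix r y e assume r: "r \<in> carrier R" and "(y, e) \<in> G"
    then obtain p where *: "p \<in> carrier P" "y = \<alpha> p" "e = \<gamma> p" unfolding G_def by blast
    have "(\<alpha> (r \<odot>\<^bsub>P\<^esub> p), \<gamma> (r \<odot>\<^bsub>P\<^esub> p)) \<in> G"
      using P.smult_closed[OF r *(1)] unfolding G_def by blast
    then show "(r \<odot>\<^bsub>N\<^esub> y, r \<odot>\<^bsub>Q\<^esub> e) \<in> G"
      using mhomD(3)[OF assms(4) r *(1)] mhomD(3)[OF assms(5) r *(1)] * by simp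
  next
    fix e assume "(\<zero>\<^bsub>N\<^esub>, e) \<in> G"
    then show "e = \<zero>\<^bsub>Q\<^esub>" using ker unfolding G_def by force
  qed
  then obtain f where "f \<in> mhom R N Q" "\<And>x y. (x, y) \<in> G \<Longrightarrow> f x = y"
    using baer_criterion[OF assms(1,3)] by blast
  then show ?thesis using that unfolding G_def by blast
qed

text \<open>
  Factor \<open>r \<mapsto> r e\<close> through the map \<open>r \<mapsto> r x + V\<close> from \<open>R\<close> to \<open>N/V\<close>.
\<close>

lemma baer_separates:
  assumes "baer_injective R E" "module R N" "submodule V R N" "x \<in> carrier N" "e \<in> carrier E"
    and ann: "\<And>r. r \<in> carrier R \<Longrightarrow> r \<odot>\<^bsub>N\<^esub> x \<in> V \<Longrightarrow> r \<odot>\<^bsub>E\<^esub> e = \<zero>\<^bsub>E\<^esub>"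
  obtains f where "f \<in> mhom R N E" "\<And>v. v \<in> V \<Longrightarrow> f v = \<zero>\<^bsub>E\<^esub>" "f x = e"
proof -
  have mE: "module R E" using assms(1) by (simp add: baer_injective_def)
  interpret E: module R E by fact
  interpret N: module R N by fact
  have mS: "module R (self_module R)" by (rule module_self[OF E.R.is_cring])
  note V = submoduleD[OF assms(2,3)] and q = module_quot[OF assms(2,3)]
  let ?c = "\<lambda>y. V +>\<^bsub>N\<^esub> y"
  have Nx: "(\<lambda>r. r \<odot>\<^bsub>N\<^esub> x) \<in> mhom R (self_module R) N"
    using assms(4) by (intro mhomI) (auto simp: N.smult_l_distr N.smult_assoc1)
  have Ee: "(\<lambda>r. r \<odot>\<^bsub>E\<^esub> e) \<in> mhom R (self_module R) E"
    using assms(5) by (intro mhomI) (auto simp: E.smult_l_distr E.smult_assoc1)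
  have ker: "r \<odot>\<^bsub>E\<^esub> e = \<zero>\<^bsub>E\<^esub>"
    if "r \<in> carrier (self_module R)" "?c (r \<odot>\<^bsub>N\<^esub> x) = \<zero>\<^bsub>quot_module N V\<^esub>" for r
    using that ann[of r] q(4)[of "r \<odot>\<^bsub>N\<^esub> x"] assms(4) by simp
  obtain h where h: "h \<in> mhom R (quot_module N V) E"
    "\<And>r. r \<in> carrier (self_module R) \<Longrightarrow> h (?c (r \<odot>\<^bsub>N\<^esub> x)) = r \<odot>\<^bsub>E\<^esub> e"
    by (rule baer_factorization[OF assms(1) mS q(1) mhom_comp[OF Nx q(2)] Ee], rule ker, assumption+, rule that)
  show ?thesis
  proof (rule that[of "\<lambda>y. h (?c y)"])
    show "(\<lambda>y. h (?c y)) \<in> mhom R N E" by (rule mhom_comp[OF q(2) h(1)])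
    show "h (?c v) = \<zero>\<^bsub>E\<^esub>" if "v \<in> V" for v
      using q(4)[of v] subsetD[OF V(1) that] that mhom_zero[OF q(1) mE h(1)] by simp
    show "h (?c x) = e" using h(2)[of "\<one>\<^bsub>R\<^esub>"] assms(4,5) by simp
  qed
qed

section \<open>Finitely generated modules over a noetherian ring\<close>

lemma eval_mhom: "i \<in> \<Lambda> \<Longrightarrow> (\<lambda>f. f i) \<in> mhom R (copower N \<Lambda>) N"
  by (auto simp: mhom_def copower_carrier)

lemma genideal_eq_span: "cring R \<Longrightarrow> Idl\<^bsub>R\<^esub> S = submodule_span R (self_module R) S"
  by (simp add: genideal_def submodule_span_def ideal_iff_submodule)

text \<open>
  Coordinates are treated one at a time. Once finitely many elements of \<open>K\<close> account for the
  coordinates in \<open>T\<close>, what remains are elements vanishing on \<open>T\<close>, and their next coordinates form an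
  ideal, which is finitely generated.
\<close>

lemma noetherian_finite_copower:
  assumes "noetherian_ring R" "cring R" "finite \<Lambda>" "submodule K R (copower (self_module R) \<Lambda>)"
  obtains S where "S \<subseteq> K" "finite S" "submodule_span R (copower (self_module R) \<Lambda>) S = K"
proof -
  let ?C = "copower (self_module R) \<Lambda>"
  let ?sp = "submodule_span R ?C"
  have sm: "module R (self_module R)" using assms(2) by (rule module_self)
  have mC: "module R ?C" by (rule module_copower[OF sm])
  interpret C: module R ?C by fact
  note K = submoduleD[OF mC assms(4)]
  have sp: "submodule (?sp S) R ?C" "S \<subseteq> ?sp S" "?sp S \<subseteq> K" if "S \<subseteq> K" for S
    using submodule_span_least[OF mC, of S] that K(1) assms(4) by auto
  have "\<exists>S\<subseteq>K. finite S \<and> (\<forall>v\<in>K. \<exists>w\<in>?sp S. \<forall>j\<in>T. v j = w j)" if "finite T" "T \<subseteq> \<Lambda>" for T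
    using that
  proof (induction T rule: finite_induct)
    case empty
    have "\<zero>\<^bsub>?C\<^esub> \<in> ?sp {}" using submoduleD(2)[OF mC sp(1)] by blast
    then show ?case by (intro exI[of _ "{}"]) blast
  next
    case (insert t T)
    then obtain S where S: "S \<subseteq> K" "finite S" "\<forall>v\<in>K. \<exists>w\<in>?sp S. \<forall>j\<in>T. v j = w j" by auto
    have ev: "(\<lambda>v. v j) \<in> mhom R ?C (self_module R)" if "j \<in> insert t T" for j
      using insert.prems that by (intro eval_mhom) auto
    define K0 where "K0 = {v\<in>K. \<forall>j\<in>T. v j = \<zero>\<^bsub>R\<^esub>}"
    have subK0: "submodule K0 R ?C"
    proof -
      have e: "(v \<oplus>\<^bsub>?C\<^esub> w) j = v j \<oplus>\<^bsub>R\<^esub> w j" "(r \<odot>\<^bsub>?C\<^esub> v) j = r \<otimes>\<^bsub>R\<^esub> v j" if "j \<in> T" for v w r j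
        using that insert.prems by auto
      have z: "\<zero>\<^bsub>?C\<^esub> j = \<zero>\<^bsub>R\<^esub>" if "j \<in> T" for j
        using that insert.prems by auto
      show ?thesis
        using K by (intro submoduleI'[OF mC]) (auto simp: K0_def e z simp del: copower_simps)
    qed
    have "submodule ((\<lambda>v. v t) ` K0) R (self_module R)"
      by (rule submodule_image[OF mC sm ev subK0]) simp
    then have "ideal ((\<lambda>v. v t) ` K0) R" using ideal_iff_submodule[OF assms(2)] by auto
    then obtain B where B: "B \<subseteq> carrier R" "finite B" "(\<lambda>v. v t) ` K0 = Idl\<^bsub>R\<^esub> B"
      using noetherian_ring.finetely_gen[OF assms(1)] by blast
    note B3 = B(3)[unfolded genideal_eq_span[OF assms(2)]]
    have "B \<subseteq> (\<lambda>v. v t) ` K0" using submodule_span_least(2)[OF sm, of B] B(1) B3 by simp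
    then obtain S' where S': "S' \<subseteq> K0" "finite S'" "B = (\<lambda>v. v t) ` S'"
      using finite_subset_image[OF B(2)] by metis
    have S'K: "S' \<subseteq> K" using S'(1) by (auto simp: K0_def)
    have spS': "?sp S' \<subseteq> K0"
      using submodule_span_least(3)[OF mC _ subK0 S'(1)] S'K K(1) by auto
    have "submodule ((\<lambda>v. v t) ` ?sp S') R (self_module R)"
      by (rule submodule_image[OF mC sm ev sp(1)[OF S'K]]) simp
    moreover have "B \<subseteq> (\<lambda>v. v t) ` ?sp S'" using S'(3) sp(2)[OF S'K] by auto
    ultimately have im: "(\<lambda>v. v t) ` K0 \<subseteq> (\<lambda>v. v t) ` ?sp S'"
      using submodule_span_least(3)[OF sm, of B] B(1) B3 by simp
    have SS: "S \<union> S' \<subseteq> K" using S(1) S'K by auto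
    note spp = submoduleD[OF mC sp(1)[OF SS]]
    show ?case
    proof (intro exI[of _ "S \<union> S'"] conjI ballI)
      show "S \<union> S' \<subseteq> K" "finite (S \<union> S')" using SS S(2) S'(2) by auto
      fix v assume v: "v \<in> K"
      then obtain w where w: "w \<in> ?sp S" "\<forall>j\<in>T. v j = w j" using S(3) by blast
      have wK: "w \<in> K" using w(1) sp(3)[OF S(1)] by auto
      have vw: "v \<in> carrier ?C" "w \<in> carrier ?C" using v wK K(1) by auto
      have val: "v j \<in> carrier R" "w j \<in> carrier R" if "j \<in> insert t T" for j
        using mhomD(1)[OF ev[OF that]] vw by auto
      have diff: "(v \<ominus>\<^bsub>?C\<^esub> w) j = v j \<ominus>\<^bsub>self_module R\<^esub> w j" if "j \<in> insert t T" for j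
        using mhom_minus[OF mC sm ev[OF that] vw] by simp
      interpret s: module R "self_module R" by fact
      have "v \<ominus>\<^bsub>?C\<^esub> w \<in> K0"
        using K(4)[OF v wK] w(2) val diff s.r_neg by (auto simp: K0_def a_minus_def)
      then obtain u where u: "u \<in> ?sp S'" "u t = (v \<ominus>\<^bsub>?C\<^esub> w) t" using im by force
      have uK: "u \<in> K0" using u(1) spS' by auto
      have "w \<oplus>\<^bsub>?C\<^esub> u \<in> ?sp (S \<union> S')"
        using w(1) u(1) submodule_span_mono[of S "S \<union> S'" R ?C]
          submodule_span_mono[of S' "S \<union> S'" R ?C]
        by (intro spp(3)) auto
      moreover have "v j = (w \<oplus>\<^bsub>?C\<^esub> u) j" if "j \<in> insert t T" for j
      proof -
        have add: "(w \<oplus>\<^bsub>?C\<^esub> u) j = w j \<oplus>\<^bsub>self_module R\<^esub> u j"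
          using that insert.prems by auto
        show ?thesis
        proof (cases "j \<in> T")
          case True
          then show ?thesis using add uK w(2) val(2)[of j] s.r_zero[of "w j"] by (auto simp: K0_def)
        next
          case False
          then have j: "j = t" using that by auto
          have "w t \<oplus>\<^bsub>self_module R\<^esub> (v t \<ominus>\<^bsub>self_module R\<^esub> w t) = v t"
            using val[of t] s.a_lcomm[of "w t" "v t" "\<ominus>\<^bsub>self_module R\<^esub> w t"] s.r_neg[of "w t"]
              s.r_zero[of "v t"] s.a_inv_closed[of "w t"]
            unfolding a_minus_def by simp
          then show ?thesis using add u(2) j diff[of t] by simp
        qed
      qed
      ultimately show "\<exists>w\<in>?sp (S \<union> S'). \<forall>j\<in>insert t T. v j = w j" by blast
    qed
  qed
  from this[OF assms(3) subset_refl] obtain S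
    where S: "S \<subseteq> K" "finite S" "\<forall>v\<in>K. \<exists>w\<in>?sp S. \<forall>j\<in>\<Lambda>. v j = w j" by blast
  have "K \<subseteq> ?sp S"
  proof
    fix v assume v: "v \<in> K"
    then obtain w where w: "w \<in> ?sp S" "\<forall>j\<in>\<Lambda>. v j = w j" using S(3) by blast
    have "v \<in> carrier ?C" "w \<in> carrier ?C" using v w(1) sp(3)[OF S(1)] K(1) by auto
    then have "v = w" using w(2) by (auto simp: copower_carrier intro: PiE_ext)
    then show "v \<in> ?sp S" using w by simp
  qed
  then show ?thesis using that S sp(3)[OF S(1)] by blast
qed

definition pairing :: "('r, 'n) module \<Rightarrow> 'i set \<Rightarrow> ('i \<Rightarrow> 'r) \<Rightarrow> ('i \<Rightarrow> 'n) \<Rightarrow> 'n" where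
  "pairing N A v x = finsum N (\<lambda>i. v i \<odot>\<^bsub>N\<^esub> x i) A"

lemma pairing_mhom_left:
  assumes "module R N" "finite A" "x \<in> A \<rightarrow> carrier N"
  shows "(\<lambda>v. pairing N A v x) \<in> mhom R (copower (self_module R) A) N"
proof -
  interpret N: module R N by fact
  have x: "x i \<in> carrier N" if "i \<in> A" for i using assms(3) that by auto
  show ?thesis
  proof (rule mhomI)
    fix v assume v: "v \<in> carrier (copower (self_module R) A)"
    then have vc: "v i \<in> carrier R" if "i \<in> A" for i using that by (auto simp: copower_carrier)
    show "pairing N A v x \<in> carrier N" unfolding pairing_def using vc x by auto
    {
      fix w assume w: "w \<in> carrier (copower (self_module R) A)"
      then have wc: "w i \<in> carrier R" if "i \<in> A" for i using that by (auto simp: copower_carrier)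
      have "pairing N A (v \<oplus>\<^bsub>copower (self_module R) A\<^esub> w) x
          = finsum N (\<lambda>i. v i \<odot>\<^bsub>N\<^esub> x i \<oplus>\<^bsub>N\<^esub> w i \<odot>\<^bsub>N\<^esub> x i) A"
        unfolding pairing_def using vc wc x by (intro N.finsum_cong') (auto simp: N.smult_l_distr)
      also have "\<dots> = pairing N A v x \<oplus>\<^bsub>N\<^esub> pairing N A w x"
        unfolding pairing_def using vc wc x by (intro N.finsum_addf) auto
      finally show "pairing N A (v \<oplus>\<^bsub>copower (self_module R) A\<^esub> w) x =
        pairing N A v x \<oplus>\<^bsub>N\<^esub> pairing N A w x" .
    }
    fix r assume r: "r \<in> carrier R"
    have "pairing N A (r \<odot>\<^bsub>copower (self_module R) A\<^esub> v) x
        = finsum N (\<lambda>i. r \<odot>\<^bsub>N\<^esub> (v i \<odot>\<^bsub>N\<^esub> x i)) A"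
      unfolding pairing_def using vc r x by (intro N.finsum_cong') (auto simp: N.smult_assoc1)
    also have "\<dots> = r \<odot>\<^bsub>N\<^esub> pairing N A v x"
      unfolding pairing_def using vc r x assms(2)
      by (intro N.finsum_smult_ldistr[symmetric]) auto
    finally show "pairing N A (r \<odot>\<^bsub>copower (self_module R) A\<^esub> v) x = r \<odot>\<^bsub>N\<^esub> pairing N A v x" .
  qed
qed

lemma pairing_mhom_right:
  assumes "module R N" "finite A" "v \<in> A \<rightarrow> carrier R"
  shows "pairing N A v \<in> mhom R (copower N A) N"
proof -
  interpret N: module R N by fact
  have vc: "v i \<in> carrier R" if "i \<in> A" for i using assms(3) that by auto
  show ?thesis
  proof (rule mhomI)
    fix x assume x: "x \<in> carrier (copower N A)"
    then have xc: "x i \<in> carrier N" if "i \<in> A" for i using that by (auto simp: copower_carrier)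
    show "pairing N A v x \<in> carrier N" unfolding pairing_def using vc xc by auto
    {
      fix y assume y: "y \<in> carrier (copower N A)"
      then have yc: "y i \<in> carrier N" if "i \<in> A" for i using that by (auto simp: copower_carrier)
      have "pairing N A v (x \<oplus>\<^bsub>copower N A\<^esub> y)
          = finsum N (\<lambda>i. v i \<odot>\<^bsub>N\<^esub> x i \<oplus>\<^bsub>N\<^esub> v i \<odot>\<^bsub>N\<^esub> y i) A"
        unfolding pairing_def using vc xc yc by (intro N.finsum_cong') (auto simp: N.smult_r_distr)
      also have "\<dots> = pairing N A v x \<oplus>\<^bsub>N\<^esub> pairing N A v y"
        unfolding pairing_def using vc xc yc by (intro N.finsum_addf) auto
      finally show "pairing N A v (x \<oplus>\<^bsub>copower N A\<^esub> y) = pairing N A v x \<oplus>\<^bsub>N\<^esub> pairing N A v y" .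
    }
    fix r assume r: "r \<in> carrier R"
    have "pairing N A v (r \<odot>\<^bsub>copower N A\<^esub> x) = finsum N (\<lambda>i. r \<odot>\<^bsub>N\<^esub> (v i \<odot>\<^bsub>N\<^esub> x i)) A"
      unfolding pairing_def using vc r xc
      by (intro N.finsum_cong') (auto simp flip: N.smult_assoc1 simp: N.R.m_comm)
    also have "\<dots> = r \<odot>\<^bsub>N\<^esub> pairing N A v x"
      unfolding pairing_def using vc r xc assms(2)
      by (intro N.finsum_smult_ldistr[symmetric]) auto
    finally show "pairing N A v (r \<odot>\<^bsub>copower N A\<^esub> x) = r \<odot>\<^bsub>N\<^esub> pairing N A v x" .
  qed
qed

lemma (in abelian_monoid) finsum_delta:
  assumes "finite A" "i \<in> A" "\<And>j. j \<in> A \<Longrightarrow> j \<noteq> i \<Longrightarrow> f j = \<zero>" "f i \<in> carrier G"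
  shows "finsum G f A = f i"
proof -
  have "finsum G f A = finsum G (\<lambda>j. if i = j then f j else \<zero>) A"
    using assms by (intro finsum_cong') auto
  also have "\<dots> = finsum G (\<lambda>j. if i = j then f i else \<zero>) A"
    using assms by (intro finsum_cong') auto
  also have "\<dots> = f i" using assms by (intro finsum_singleton) auto
  finally show ?thesis .
qed

lemma pairing_single_left:
  assumes "module R N" "finite A" "x \<in> A \<rightarrow> carrier N" "i \<in> A"
  shows "pairing N A (single (self_module R) A i \<one>\<^bsub>R\<^esub>) x = x i"
proof -
  interpret N: module R N by fact
  have x: "x j \<in> carrier N" if "j \<in> A" for j using assms(3) that by auto
  have "pairing N A (single (self_module R) A i \<one>\<^bsub>R\<^esub>) x
      = single (self_module R) A i \<one>\<^bsub>R\<^esub> i \<odot>\<^bsub>N\<^esub> x i"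
    unfolding pairing_def using assms(2,4)
    by (intro N.finsum_delta) (auto simp: single_def x)
  then show ?thesis using assms(4) x by (auto simp: single_def)
qed

lemma pairing_single_right:
  assumes "module R N" "finite A" "v \<in> A \<rightarrow> carrier R" "i \<in> A" "y \<in> carrier N"
  shows "pairing N A v (single N A i y) = v i \<odot>\<^bsub>N\<^esub> y"
proof -
  interpret N: module R N by fact
  have v: "v j \<in> carrier R" if "j \<in> A" for j using assms(3) that by auto
  have "pairing N A v (single N A i y) = v i \<odot>\<^bsub>N\<^esub> single N A i y i"
    unfolding pairing_def using assms(2,4,5)
    by (intro N.finsum_delta) (auto simp: single_def v)
  then show ?thesis using assms(4) by (auto simp: single_def)
qed

lemma copower_finite_sum:
  assumes "module R N" "finite \<Lambda>" "f \<in> carrier (copower N \<Lambda>)"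
  shows "f = finsum (copower N \<Lambda>) (\<lambda>i. single N \<Lambda> i (f i)) \<Lambda>"
proof (rule PiE_ext)
  have mC: "module R (copower N \<Lambda>)" using assms(1) by (rule module_copower)
  interpret N: module R N by fact
  interpret C: module R "copower N \<Lambda>" by fact
  have val: "f i \<in> carrier N" if "i \<in> \<Lambda>" for i using assms(3) that by (auto simp: copower_carrier)
  have s: "(\<lambda>i. single N \<Lambda> i (f i)) \<in> \<Lambda> \<rightarrow> carrier (copower N \<Lambda>)"
    using val by (auto intro!: mhomD(1)[OF single_mhom[OF assms(1)]] simp del: PiE_iff)
  then have "finsum (copower N \<Lambda>) (\<lambda>i. single N \<Lambda> i (f i)) \<Lambda> \<in> carrier (copower N \<Lambda>)" by simp
  then show "f \<in> \<Lambda> \<rightarrow>\<^sub>E carrier N"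
    "finsum (copower N \<Lambda>) (\<lambda>i. single N \<Lambda> i (f i)) \<Lambda> \<in> \<Lambda> \<rightarrow>\<^sub>E carrier N"
    using assms(3) by (auto simp: copower_carrier)
  fix j assume j: "j \<in> \<Lambda>"
  have "finsum (copower N \<Lambda>) (\<lambda>i. single N \<Lambda> i (f i)) \<Lambda> j
      = finsum N (\<lambda>i. single N \<Lambda> i (f i) j) \<Lambda>"
    by (rule mhom_finsum[OF mC assms(1) eval_mhom[OF j] assms(2) s])
  also have "\<dots> = single N \<Lambda> j (f j) j"
    using assms(2) j val by (intro N.finsum_delta) (auto simp: single_def)
  also have "\<dots> = f j" using j by (simp add: single_def)
  finally show "f j = finsum (copower N \<Lambda>) (\<lambda>i. single N \<Lambda> i (f i)) \<Lambda> j" ..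
qed

section \<open>Modules of homomorphisms\<close>

lemma matlis_dual_simps [simp]:
  "\<zero>\<^bsub>matlis_dual R E M\<^esub> = (\<lambda>x\<in>carrier M. \<zero>\<^bsub>E\<^esub>)"
  "f \<oplus>\<^bsub>matlis_dual R E M\<^esub> g = (\<lambda>x\<in>carrier M. f x \<oplus>\<^bsub>E\<^esub> g x)"
  "r \<odot>\<^bsub>matlis_dual R E M\<^esub> f = (\<lambda>x\<in>carrier M. r \<odot>\<^bsub>E\<^esub> f x)"
  "carrier (matlis_dual R E M) = mhom R M E \<inter> extensional (carrier M)"
  by (auto simp: matlis_dual_def)

lemma module_matlis_dual:
  assumes "module R E" "module R M" shows "module R (matlis_dual R E M)"
proof -
  interpret E: module R E by fact
  interpret M: module R M by fact
  let ?D = "matlis_dual R E M"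
  have val: "f x \<in> carrier E" if "f \<in> carrier ?D" "x \<in> carrier M" for f x
    using that mhomD(1)[of f R M E] by auto
  have hom: "f (x \<oplus>\<^bsub>M\<^esub> y) = f x \<oplus>\<^bsub>E\<^esub> f y" "r \<in> carrier R \<Longrightarrow> f (r \<odot>\<^bsub>M\<^esub> x) = r \<odot>\<^bsub>E\<^esub> f x"
    if "f \<in> carrier ?D" "x \<in> carrier M" "y \<in> carrier M" for f x y r
    using that mhomD(2,3)[of f R M E] by auto
  have add: "f \<oplus>\<^bsub>?D\<^esub> g \<in> carrier ?D" if "f \<in> carrier ?D" "g \<in> carrier ?D" for f g
    using that val[of f] val[of g] hom[of f] hom[of g]
    by (auto intro!: mhomI simp: E.a_ac E.smult_r_distr)
  have smult: "r \<odot>\<^bsub>?D\<^esub> f \<in> carrier ?D" if "f \<in> carrier ?D" "r \<in> carrier R" for f r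
    using that val[of f] hom[of f]
    by (auto intro!: mhomI simp: E.smult_r_distr E.R.m_comm simp flip: E.smult_assoc1)
  have ext: "(\<lambda>x\<in>carrier M. f x) = f" if "f \<in> carrier ?D" for f
    using that by (auto simp: extensional_restrict)
  have eqI: "(\<lambda>x\<in>carrier M. g x) = f" if "f \<in> carrier ?D" "\<And>x. x \<in> carrier M \<Longrightarrow> g x = f x" for f g
    using ext[OF that(1)] that(2) by (metis restrict_ext)
  show ?thesis
  proof (rule moduleI)
    show "cring R" by (rule E.R.is_cring)
    show "abelian_group ?D"
    proof (rule abelian_groupI)
      show "\<zero>\<^bsub>?D\<^esub> \<in> carrier ?D" by (auto intro!: mhomI)
      fix f assume f: "f \<in> carrier ?D"
      show "\<zero>\<^bsub>?D\<^esub> \<oplus>\<^bsub>?D\<^esub> f = f"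
        using val[OF f] by (auto intro!: eqI[OF f])
      show "\<exists>g\<in>carrier ?D. g \<oplus>\<^bsub>?D\<^esub> f = \<zero>\<^bsub>?D\<^esub>"
        using val[OF f] smult[OF f, of "\<ominus>\<^bsub>R\<^esub> \<one>\<^bsub>R\<^esub>"]
        by (intro bexI[of _ "(\<ominus>\<^bsub>R\<^esub> \<one>\<^bsub>R\<^esub>) \<odot>\<^bsub>?D\<^esub> f"])
          (auto simp: E.smult_l_minus E.l_neg simp del: matlis_dual_simps(4) intro!: restrict_ext)
    next
      fix f g assume "f \<in> carrier ?D" "g \<in> carrier ?D"
      then show "f \<oplus>\<^bsub>?D\<^esub> g \<in> carrier ?D" by (rule add)
    qed (use val in \<open>auto simp: E.a_ac simp del: matlis_dual_simps(4) intro!: restrict_ext\<close>)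
    show "\<one>\<^bsub>R\<^esub> \<odot>\<^bsub>?D\<^esub> f = f" if "f \<in> carrier ?D" for f
      using val[OF that] by (auto intro!: eqI[OF that])
    show "a \<odot>\<^bsub>?D\<^esub> f \<in> carrier ?D" if "a \<in> carrier R" "f \<in> carrier ?D" for a f
      using that by (intro smult)
  qed (use val in \<open>auto simp: E.smult_l_distr E.smult_r_distr E.smult_assoc1
        simp del: matlis_dual_simps(4) intro!: restrict_ext\<close>)
qed

lemma matlis_dual_eval: "x \<in> carrier M \<Longrightarrow> (\<lambda>f. f x) \<in> mhom R (matlis_dual R E M) E"
  by (auto simp: mhom_def)

lemma restrict_mhom:
  assumes "f \<in> mhom R M E" "module R M"
  shows "restrict f (carrier M) \<in> carrier (matlis_dual R E M)"
proof -
  interpret M: module R M by fact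
  show ?thesis using mhomD[OF assms(1)] by (auto intro!: mhomI)
qed

section \<open>Generation by an ideal\<close>

text \<open>
  The right-hand side expresses that the trace of \<open>I\<close> in \<open>M\<close> is \<open>M\<close>. For the converse the copies of
  \<open>I\<close> are indexed by the homomorphisms \<open>I \<rightarrow> M\<close>, restricted to \<open>I\<close> so that they form a set of
  functions of the required type.
\<close>

lemma ideal_generated_iff:
  assumes "cring R" "ideal I R" "module R M"
  shows "ideal_generated R I M \<longleftrightarrow>
    (\<forall>U. submodule U R M \<longrightarrow> (\<forall>g\<in>mhom R (ideal_module R I) M. g ` I \<subseteq> U) \<longrightarrow> U = carrier M)"
    (is "_ \<longleftrightarrow> ?trace")
proof
  let ?I = "ideal_module R I"
  have mI: "module R ?I" using module_ideal assms by blast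
  {
    assume "ideal_generated R I M"
    then obtain \<Lambda> :: "('a \<Rightarrow> 'c) set" and e where
      e: "e \<in> mhom R (copower ?I \<Lambda>) M" "e ` carrier (copower ?I \<Lambda>) = carrier M"
      unfolding ideal_generated_def by blast
    have mC: "module R (copower ?I \<Lambda>)" by (rule module_copower[OF mI])
    show ?trace
    proof (intro allI impI)
      fix U assume U: "submodule U R M" "\<forall>g\<in>mhom R ?I M. g ` I \<subseteq> U"
      have "carrier (copower ?I \<Lambda>) \<subseteq> {F \<in> carrier (copower ?I \<Lambda>). e F \<in> U}"
      proof (rule copower_induct[OF mI submodule_vimage[OF mC assms(3) e(1) U(1)]])
        fix i a assume i: "i \<in> \<Lambda>" and a: "a \<in> carrier ?I"
        have s: "single ?I \<Lambda> i \<in> mhom R ?I (copower ?I \<Lambda>)" by (rule single_mhom[OF mI i])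
        have "(\<lambda>a. e (single ?I \<Lambda> i a)) ` I \<subseteq> U" by (rule bspec[OF U(2) mhom_comp[OF s e(1)]])
        then show "single ?I \<Lambda> i a \<in> {F \<in> carrier (copower ?I \<Lambda>). e F \<in> U}"
          using a mhomD(1)[OF s a] by auto
      qed
      then have "carrier M \<subseteq> U" by (subst e(2)[symmetric]) auto
      then show "U = carrier M" using submoduleD(1)[OF assms(3) U(1)] by blast
    qed
  }
  {
    assume tr: ?trace
    define \<Lambda> where "\<Lambda> = mhom R ?I M \<inter> extensional I"
    define e where "e = copower_map ?I M \<Lambda> (\<lambda>g. g)"
    have e: "e \<in> mhom R (copower ?I \<Lambda>) M"
      "\<And>g a. g \<in> \<Lambda> \<Longrightarrow> a \<in> I \<Longrightarrow> e (single ?I \<Lambda> g a) = g a"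
      using copower_map[OF mI assms(3), of \<Lambda> "\<lambda>g. g"] by (simp_all add: e_def \<Lambda>_def)
    have mC: "module R (copower ?I \<Lambda>)" by (rule module_copower[OF mI])
    interpret C: module R "copower ?I \<Lambda>" by fact
    have "e ` carrier (copower ?I \<Lambda>) = carrier M"
    proof (rule tr[rule_format])
      show "submodule (e ` carrier (copower ?I \<Lambda>)) R M"
        by (rule submodule_image[OF mC assms(3) e(1) C.carrier_is_submodule])
      fix g assume g: "g \<in> mhom R ?I M"
      then have r: "restrict g I \<in> \<Lambda>"
        using restrict_mhom[OF g mI] by (simp add: \<Lambda>_def)
      show "g ` I \<subseteq> e ` carrier (copower ?I \<Lambda>)"
      proof
        fix m assume "m \<in> g ` I"
        then obtain a where a: "a \<in> I" "m = g a" by blast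
        have "e (single ?I \<Lambda> (restrict g I) a) = m" using e(2)[OF r a(1)] a by simp
        moreover have "single ?I \<Lambda> (restrict g I) a \<in> carrier (copower ?I \<Lambda>)"
          using mhomD(1)[OF single_mhom[OF mI r]] a by simp
        ultimately show "m \<in> e ` carrier (copower ?I \<Lambda>)" by blast
      qed
    qed
    then show "ideal_generated R I M"
      unfolding ideal_generated_def using assms(3) e(1) by blast
  }
qed

lemma mhom_pairing:
  assumes "module R M" "module R N" "f \<in> mhom R M N" "finite A"
    and "c \<in> A \<rightarrow> carrier R" "x \<in> A \<rightarrow> carrier M"
  shows "f (pairing M A c x) = pairing N A c (\<lambda>i. f (x i))"
proof -
  interpret M: module R M by fact
  interpret N: module R N by fact
  have c: "c i \<in> carrier R" and x: "x i \<in> carrier M" if "i \<in> A" for i using assms that by auto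
  have "f (pairing M A c x) = finsum N (\<lambda>i. f (c i \<odot>\<^bsub>M\<^esub> x i)) A"
    unfolding pairing_def using c x by (intro mhom_finsum[OF assms(1-4)]) auto
  also have "\<dots> = pairing N A c (\<lambda>i. f (x i))"
    unfolding pairing_def using c x mhomD[OF assms(3)] by (intro N.finsum_cong') auto
  finally show ?thesis .
qed

text \<open>
  Every element of \<open>I\<close> is a combination \<open>\<Sum> v\<^sub>a a\<close> of the generators, and it is sent to \<open>\<Sum> v\<^sub>a x\<^sub>a\<close>. The
  assumption on the relations makes this independent of the coefficients.
\<close>

lemma hom_from_relations:
  assumes "module R N" "ideal I R" "finite A" "I = Idl\<^bsub>R\<^esub> A" "x \<in> A \<rightarrow> carrier N" "A \<subseteq> carrier R"
    and rel: "\<And>v. v \<in> carrier (copower (self_module R) A) \<Longrightarrow>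
      pairing (self_module R) A v (\<lambda>a. a) = \<zero>\<^bsub>R\<^esub> \<Longrightarrow> pairing N A v x = \<zero>\<^bsub>N\<^esub>"
  obtains g where "g \<in> mhom R (ideal_module R I) N" "\<And>a. a \<in> A \<Longrightarrow> g a = x a"
proof -
  interpret N: module R N by fact
  have cr: "cring R" by (rule N.R.is_cring)
  let ?S = "self_module R" and ?C = "copower (self_module R) A"
  have mS: "module R ?S" using cr by (rule module_self)
  have mC: "module R ?C" using mS by (rule module_copower)
  interpret C: module R ?C by fact
  interpret S: module R ?S by fact
  define \<pi> where "\<pi> v = pairing ?S A v (\<lambda>a. a)" for v
  have \<pi>: "\<pi> \<in> mhom R ?C ?S"
    unfolding \<pi>_def using assms(6) by (intro pairing_mhom_left[OF mS assms(3)]) auto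
  have p: "(\<lambda>v. pairing N A v x) \<in> mhom R ?C N" by (rule pairing_mhom_left[OF assms(1,3,5)])
  define e where "e a = single ?S A a \<one>\<^bsub>R\<^esub>" for a
  have e: "e a \<in> carrier ?C" "\<pi> (e a) = a" "pairing N A (e a) x = x a" if "a \<in> A" for a
    using mhomD(1)[OF single_mhom[OF mS that], of "\<one>\<^bsub>R\<^esub>"] assms(6)
      pairing_single_left[OF mS assms(3), of "\<lambda>a. a"] pairing_single_left[OF assms(1,3,5)] that
    by (auto simp: e_def \<pi>_def)
  have "submodule (\<pi> ` carrier ?C) R ?S"
    by (rule submodule_image[OF mC mS \<pi> C.carrier_is_submodule])
  moreover have "A \<subseteq> \<pi> ` carrier ?C" using e by force
  ultimately have I: "I \<subseteq> \<pi> ` carrier ?C"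
    unfolding assms(4) genideal_eq_span[OF cr] using submodule_span_least(3)[OF mS] assms(6) by auto
  define g where "g b = pairing N A (SOME v. v \<in> carrier ?C \<and> \<pi> v = b) x" for b
  have g: "g (\<pi> v) = pairing N A v x" if v: "v \<in> carrier ?C" for v
  proof -
    define w where "w = (SOME w. w \<in> carrier ?C \<and> \<pi> w = \<pi> v)"
    have w: "w \<in> carrier ?C" "\<pi> w = \<pi> v" using someI[of "\<lambda>w. w \<in> carrier ?C \<and> \<pi> w = \<pi> v" v] v
      by (auto simp: w_def)
    have "\<pi> (w \<ominus>\<^bsub>?C\<^esub> v) = \<pi> w \<ominus>\<^bsub>?S\<^esub> \<pi> v" by (rule mhom_minus[OF mC mS \<pi> w(1) v])
    also have "\<dots> = \<zero>\<^bsub>?S\<^esub>" using w(2) mhomD(1)[OF \<pi> v] by (simp only: a_minus_def S.r_neg)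
    finally have "pairing N A (w \<ominus>\<^bsub>?C\<^esub> v) x = \<zero>\<^bsub>N\<^esub>" using w v by (intro rel) (auto simp: \<pi>_def)
    then have "pairing N A w x \<ominus>\<^bsub>N\<^esub> pairing N A v x = \<zero>\<^bsub>N\<^esub>"
      using mhom_minus[OF mC assms(1) p w(1) v] by simp
    moreover have "pairing N A w x \<in> carrier N" "pairing N A v x \<in> carrier N"
      using mhomD(1)[OF p] w v by auto
    ultimately have "pairing N A w x = pairing N A v x"
      by (rule N.eq_if_minus_zero[rotated 2])
    then show ?thesis by (simp add: g_def w_def)
  qed
  have "g \<in> mhom R (ideal_module R I) N"
  proof (rule mhomI; simp)
    fix a assume "a \<in> I"
    then obtain v where v: "v \<in> carrier ?C" "a = \<pi> v" using I by blast
    show "g a \<in> carrier N" using v g mhomD(1)[OF p] by simp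
    show "g (r \<otimes>\<^bsub>R\<^esub> a) = r \<odot>\<^bsub>N\<^esub> g a" if r: "r \<in> carrier R" for r
      using g[OF C.smult_closed[OF r v(1)]] g[OF v(1)] v r mhomD(3)[OF \<pi> r v(1)] mhomD(3)[OF p r v(1)]
      by simp
    fix b assume "b \<in> I"
    then obtain w where w: "w \<in> carrier ?C" "b = \<pi> w" using I by blast
    show "g (a \<oplus>\<^bsub>R\<^esub> b) = g a \<oplus>\<^bsub>N\<^esub> g b"
      using g[OF C.a_closed[OF v(1) w(1)]] g[OF v(1)] g[OF w(1)] v w mhomD(2)[OF \<pi> v(1) w(1)]
        mhomD(2)[OF p v(1) w(1)]
      by simp
  qed
  moreover have "g a = x a" if "a \<in> A" for a using g[OF e(1)[OF that]] e(2,3)[OF that] by simp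
  ultimately show ?thesis using that by blast
qed

text \<open>
  Let \<open>S\<close> generate the module of relations between the generators \<open>A\<close> of \<open>I\<close>. A family
  \<open>x \<in> N\<^sup>A\<close> that is orthogonal to \<open>S\<close> is the family of values of a homomorphism \<open>I \<rightarrow> N\<close>, hence
  \<open>u (x\<^sub>b) = 0\<close> for it. Thus \<open>x \<mapsto> u (x\<^sub>b)\<close> factors through the map \<open>\<tau> : N\<^sup>A \<rightarrow> N\<^sup>S\<close> given by the relations, and
  by injectivity of \<open>Q\<close> the factor is defined on all of \<open>N\<^sup>S\<close>; the \<open>h\<^sub>k\<close> are its components. Evaluating at
  the families that are concentrated at one \<open>a \<in> A\<close> gives \<open>\<Sum> k\<^sub>a h\<^sub>k = \<delta>\<^sub>a\<^sub>b u\<close>.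
\<close>

lemma trace_orthogonal_decomposition:
  assumes "noetherian_ring R" "baer_injective R Q" "module R N" "ideal I R"
    and "finite A" "I = Idl\<^bsub>R\<^esub> A" "A \<subseteq> carrier R" "b \<in> A"
    and u: "u \<in> carrier (matlis_dual R Q N)"
    and trace: "\<And>g a. g \<in> mhom R (ideal_module R I) N \<Longrightarrow> a \<in> I \<Longrightarrow> u (g a) = \<zero>\<^bsub>Q\<^esub>"
  obtains S h where "finite S" "S \<subseteq> carrier (copower (self_module R) A)"
    "\<And>k. k \<in> S \<Longrightarrow> pairing (self_module R) A k (\<lambda>a. a) = \<zero>\<^bsub>R\<^esub>"
    "h \<in> S \<rightarrow> carrier (matlis_dual R Q N)"
    "\<And>a. a \<in> A \<Longrightarrow> pairing (matlis_dual R Q N) S (\<lambda>k. k a) h =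
        (if a = b then u else \<zero>\<^bsub>matlis_dual R Q N\<^esub>)"
proof -
  have mQ: "module R Q" using assms(2) by (simp add: baer_injective_def)
  interpret N: module R N by fact
  interpret Q: module R Q by fact
  have cr: "cring R" by (rule N.R.is_cring)
  let ?S = "self_module R" and ?C = "copower (self_module R) A"
  let ?D = "matlis_dual R Q N"
  have mS: "module R ?S" using cr by (rule module_self)
  have mC: "module R ?C" using mS by (rule module_copower)
  have mD: "module R ?D" by (rule module_matlis_dual[OF mQ assms(3)])
  have uh: "u \<in> mhom R N Q" using u by simp
  define \<pi> where "\<pi> v = pairing ?S A v (\<lambda>a. a)" for v
  have \<pi>: "\<pi> \<in> mhom R ?C ?S"
    unfolding \<pi>_def using assms(7) by (intro pairing_mhom_left[OF mS assms(5)]) auto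
  obtain S where S: "S \<subseteq> {v \<in> carrier ?C. \<pi> v = \<zero>\<^bsub>?S\<^esub>}" "finite S"
    "submodule_span R ?C S = {v \<in> carrier ?C. \<pi> v = \<zero>\<^bsub>?S\<^esub>}"
    using noetherian_finite_copower[OF assms(1) cr assms(5) submodule_kernel[OF mC mS \<pi>]] by blast
  have kA: "k \<in> A \<rightarrow> carrier R" if "k \<in> S" for k using S(1) that by (auto simp: copower_carrier)
  let ?NA = "copower N A" and ?NS = "copower N S"
  have mNA: "module R ?NA" and mNS: "module R ?NS" using assms(3) by (auto intro: module_copower)
  interpret NA: module R ?NA by fact
  define \<tau> where "\<tau> x = (\<lambda>k\<in>S. pairing N A k x)" for x
  have pk: "pairing N A k \<in> mhom R ?NA N" if "k \<in> S" for k
    by (rule pairing_mhom_right[OF assms(3,5) kA[OF that]])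
  have \<tau>: "\<tau> \<in> mhom R ?NA ?NS"
  proof (rule mhomI)
    show "\<tau> x \<in> carrier ?NS" if "x \<in> carrier ?NA" for x
      using mhomD(1)[OF pk that] by (auto simp: \<tau>_def copower_carrier_finite[OF S(2)])
    show "\<tau> (x \<oplus>\<^bsub>?NA\<^esub> y) = \<tau> x \<oplus>\<^bsub>?NS\<^esub> \<tau> y" if "x \<in> carrier ?NA" "y \<in> carrier ?NA" for x y
      using mhomD(2)[OF pk that] by (auto simp: \<tau>_def simp del: copower_simps(2) intro!: restrict_ext)
        (auto simp: restrict_def fun_eq_iff)
    show "\<tau> (r \<odot>\<^bsub>?NA\<^esub> x) = r \<odot>\<^bsub>?NS\<^esub> \<tau> x" if "x \<in> carrier ?NA" "r \<in> carrier R" for x r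
      using mhomD(3)[OF pk that(2,1)] by (auto simp: \<tau>_def simp del: copower_simps(3) intro!: restrict_ext)
        (auto simp: restrict_def fun_eq_iff)
  qed
  have ub: "(\<lambda>x. u (x b)) \<in> mhom R ?NA Q"
    by (rule mhom_comp[OF eval_mhom[OF assms(8)] uh])
  have ker: "u (x b) = \<zero>\<^bsub>Q\<^esub>" if x: "x \<in> carrier ?NA" "\<tau> x = \<zero>\<^bsub>?NS\<^esub>" for x
  proof -
    have xA: "x \<in> A \<rightarrow> carrier N" using x(1) by (auto simp: copower_carrier)
    have p: "(\<lambda>v. pairing N A v x) \<in> mhom R ?C N" by (rule pairing_mhom_left[OF assms(3,5) xA])
    have "pairing N A k x = \<zero>\<^bsub>N\<^esub>" if "k \<in> S" for k
      using fun_cong[OF x(2), of k] that by (simp add: \<tau>_def)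
    then have "S \<subseteq> {v \<in> carrier ?C. pairing N A v x = \<zero>\<^bsub>N\<^esub>}" using S(1) by auto
    then have "submodule_span R ?C S \<subseteq> {v \<in> carrier ?C. pairing N A v x = \<zero>\<^bsub>N\<^esub>}"
      using submodule_span_least(3)[OF mC _ submodule_kernel[OF mC assms(3) p]] S(1) by blast
    then have "pairing N A v x = \<zero>\<^bsub>N\<^esub>" if "v \<in> carrier ?C" "\<pi> v = \<zero>\<^bsub>R\<^esub>" for v
      using S(3) that by auto
    then obtain g where g: "g \<in> mhom R (ideal_module R I) N" "\<And>a. a \<in> A \<Longrightarrow> g a = x a"
      using hom_from_relations[OF assms(3-6) xA assms(7)] unfolding \<pi>_def by blast
    have "b \<in> I" using assms(6-8) submodule_span_least(2)[OF mS, of A] genideal_eq_span[OF cr] by auto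
    then show ?thesis using trace[OF g(1)] g(2)[OF assms(8)] by metis
  qed
  obtain H where H: "H \<in> mhom R ?NS Q" "\<And>x. x \<in> carrier ?NA \<Longrightarrow> H (\<tau> x) = u (x b)"
    by (rule baer_factorization[OF assms(2) mNA mNS \<tau> ub], rule ker, assumption+, rule that)
  define h where "h k = (\<lambda>y\<in>carrier N. H (single N S k y))" for k
  have hD: "h k \<in> carrier ?D" if "k \<in> S" for k
    unfolding h_def by (rule restrict_mhom[OF mhom_comp[OF single_mhom[OF assms(3) that] H(1)] assms(3)])
  interpret D: module R ?D by fact
  have "pairing ?D S (\<lambda>k. k a) h = (if a = b then u else \<zero>\<^bsub>?D\<^esub>)" if a: "a \<in> A" for a
  proof (rule extensionalityI[of _ "carrier N"])
    have c: "(\<lambda>k. k a) \<in> S \<rightarrow> carrier R" using kA a by auto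
    have "pairing ?D S (\<lambda>k. k a) h \<in> carrier ?D"
      unfolding pairing_def using hD c by (intro D.finsum_closed) (auto simp del: matlis_dual_simps)
    then show "pairing ?D S (\<lambda>k. k a) h \<in> extensional (carrier N)" by simp
    show "(if a = b then u else \<zero>\<^bsub>?D\<^esub>) \<in> extensional (carrier N)" using u by auto
    fix y assume y: "y \<in> carrier N"
    have ay: "single N A a y \<in> carrier ?NA" by (rule mhomD(1)[OF single_mhom[OF assms(3) a] y])
    have cy: "k a \<odot>\<^bsub>N\<^esub> y \<in> carrier N" if "k \<in> S" for k using kA[OF that] a y by auto
    have "pairing ?D S (\<lambda>k. k a) h y = pairing Q S (\<lambda>k. k a) (\<lambda>k. h k y)"
      using mhom_pairing[OF mD mQ matlis_dual_eval[OF y] S(2) c] hD by blast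
    also have "\<dots> = finsum Q (\<lambda>k. H (single N S k (k a \<odot>\<^bsub>N\<^esub> y))) S"
      unfolding pairing_def
    proof (intro Q.finsum_cong')
      fix k assume k: "k \<in> S"
      show "k a \<odot>\<^bsub>Q\<^esub> h k y = H (single N S k (k a \<odot>\<^bsub>N\<^esub> y))"
        using mhomD(3)[OF mhom_comp[OF single_mhom[OF assms(3) k] H(1)], of "k a" y]
          funcset_mem[OF kA[OF k] a] y
        by (auto simp: h_def)
    qed (use cy mhomD(1)[OF mhom_comp[OF single_mhom[OF assms(3)] H(1)]] in auto)
    also have "\<dots> = H (finsum ?NS (\<lambda>k. single N S k (\<tau> (single N A a y) k)) S)"
    proof -
      have t: "\<tau> (single N A a y) k = k a \<odot>\<^bsub>N\<^esub> y" if "k \<in> S" for k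
        using pairing_single_right[OF assms(3,5) kA[OF that] a y] that by (simp add: \<tau>_def)
      have "finsum ?NS (\<lambda>k. single N S k (\<tau> (single N A a y) k)) S
          = finsum ?NS (\<lambda>k. single N S k (k a \<odot>\<^bsub>N\<^esub> y)) S"
        using t cy
        by (intro abelian_monoid.finsum_cong'[OF abelian_group.axioms(1)[OF module.axioms(2)[OF mNS]]])
          (auto intro!: mhomD(1)[OF single_mhom[OF assms(3)]])
      then have "H (finsum ?NS (\<lambda>k. single N S k (\<tau> (single N A a y) k)) S)
          = H (finsum ?NS (\<lambda>k. single N S k (k a \<odot>\<^bsub>N\<^esub> y)) S)" by simp
      also have "\<dots> = finsum Q (\<lambda>k. H (single N S k (k a \<odot>\<^bsub>N\<^esub> y))) S"
        using cy by (intro mhom_finsum[OF mNS mQ H(1) S(2)]) (auto intro!: mhomD(1)[OF single_mhom[OF assms(3)]])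
      finally show ?thesis by simp
    qed
    also have "\<dots> = H (\<tau> (single N A a y))"
      using copower_finite_sum[OF assms(3) S(2) mhomD(1)[OF \<tau> ay]] by simp
    also have "\<dots> = u (single N A a y b)"
      by (rule H(2)[OF ay])
    also have "\<dots> = (if a = b then u else \<zero>\<^bsub>?D\<^esub>) y"
      using assms(8) y mhom_zero[OF assms(3) mQ uh] by (auto simp: single_def)
    finally show "pairing ?D S (\<lambda>k. k a) h y = (if a = b then u else \<zero>\<^bsub>?D\<^esub>) y" .
  qed
  moreover have "h \<in> S \<rightarrow> carrier ?D" using hD by blast
  moreover have "S \<subseteq> carrier ?C" "\<And>k. k \<in> S \<Longrightarrow> pairing ?S A k (\<lambda>a. a) = \<zero>\<^bsub>R\<^esub>"
    using S(1) by (auto simp: \<pi>_def)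
  ultimately show ?thesis using that S(2) by blast
qed

text \<open>
  In tensor notation, \<open>b \<otimes> u = \<Sum>\<^sub>a a \<otimes> \<delta>\<^sub>a\<^sub>b u = \<Sum>\<^sub>k (\<Sum>\<^sub>a k\<^sub>a a) \<otimes> h\<^sub>k = 0\<close>, because each \<open>k\<close> is a relation
  between the generators. Stating this for all bilinear maps \<open>\<beta>\<close> avoids the tensor product itself.
\<close>

theorem trace_orthogonal_tensor_zero:
  assumes "noetherian_ring R" "baer_injective R Q" "module R N" "ideal I R" "module R Y"
    and u: "u \<in> carrier (matlis_dual R Q N)"
    and trace: "\<And>g a. g \<in> mhom R (ideal_module R I) N \<Longrightarrow> a \<in> I \<Longrightarrow> u (g a) = \<zero>\<^bsub>Q\<^esub>"
    and \<beta>1: "\<And>a. a \<in> I \<Longrightarrow> \<beta> a \<in> mhom R (matlis_dual R Q N) Y"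
    and \<beta>2: "\<And>h. h \<in> carrier (matlis_dual R Q N) \<Longrightarrow> (\<lambda>a. \<beta> a h) \<in> mhom R (ideal_module R I) Y"
    and "a \<in> I"
  shows "\<beta> a u = \<zero>\<^bsub>Y\<^esub>"
proof -
  let ?D = "matlis_dual R Q N" and ?I = "ideal_module R I" and ?S = "self_module R"
  have mQ: "module R Q" using assms(2) by (simp add: baer_injective_def)
  interpret Y: module R Y by fact
  have cr: "cring R" by (rule Y.R.is_cring)
  have mS: "module R ?S" using cr by (rule module_self)
  have mI: "module R ?I" by (rule module_ideal[OF cr assms(4)])
  have mD: "module R ?D" by (rule module_matlis_dual[OF mQ assms(3)])
  obtain A where A: "A \<subseteq> carrier R" "finite A" "I = Idl\<^bsub>R\<^esub> A"
    using noetherian_ring.finetely_gen[OF assms(1,4)] by blast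
  have AI: "A \<subseteq> I" using A submodule_span_least(2)[OF mS, of A] genideal_eq_span[OF cr] by auto
  have Isub: "I \<subseteq> carrier R" using ideal.Icarr[OF assms(4)] by blast
  have gen: "\<beta> b u = \<zero>\<^bsub>Y\<^esub>" if b: "b \<in> A" for b
  proof -
    obtain S h where S: "finite S" "S \<subseteq> carrier (copower ?S A)"
      "\<And>k. k \<in> S \<Longrightarrow> pairing ?S A k (\<lambda>a. a) = \<zero>\<^bsub>R\<^esub>"
      "h \<in> S \<rightarrow> carrier ?D"
      "\<And>a. a \<in> A \<Longrightarrow> pairing ?D S (\<lambda>k. k a) h = (if a = b then u else \<zero>\<^bsub>?D\<^esub>)"
      by (rule trace_orthogonal_decomposition[OF assms(1-4) A(2,3,1) b u], erule (1) trace, rule that)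
    have kc: "k a \<in> carrier R" if "k \<in> S" "a \<in> A" for k a
      using subsetD[OF S(2) that(1)] that(2) by (auto simp: copower_carrier)
    have hD: "h k \<in> carrier ?D" if "k \<in> S" for k using S(4) that by blast
    have \<beta>Y: "\<beta> a (h k) \<in> carrier Y" if "k \<in> S" "a \<in> A" for k a
      using mhomD(1)[OF \<beta>1] hD that AI by blast
    have z: "\<beta> a \<zero>\<^bsub>?D\<^esub> = \<zero>\<^bsub>Y\<^esub>" if "a \<in> A" for a
      using mhom_zero[OF mD assms(5) \<beta>1] that AI by blast
    have uY: "\<beta> a u \<in> carrier Y" if "a \<in> A" for a using mhomD(1)[OF \<beta>1 u] that AI by blast
    have "\<beta> b u = finsum Y (\<lambda>a. \<beta> a (if a = b then u else \<zero>\<^bsub>?D\<^esub>)) A"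
      using Y.finsum_delta[OF A(2) b, of "\<lambda>a. \<beta> a (if a = b then u else \<zero>\<^bsub>?D\<^esub>)"] z uY[OF b]
      by (auto simp del: matlis_dual_simps)
    also have "\<dots> = finsum Y (\<lambda>a. finsum Y (\<lambda>k. k a \<odot>\<^bsub>Y\<^esub> \<beta> a (h k)) S) A"
    proof (rule Y.finsum_cong')
      fix a assume a: "a \<in> A"
      have "\<beta> a (pairing ?D S (\<lambda>k. k a) h) = pairing Y S (\<lambda>k. k a) (\<lambda>k. \<beta> a (h k))"
        using AI a kc S(4) by (intro mhom_pairing[OF mD assms(5) \<beta>1 S(1)]) blast+
      then show "\<beta> a (if a = b then u else \<zero>\<^bsub>?D\<^esub>) = finsum Y (\<lambda>k. k a \<odot>\<^bsub>Y\<^esub> \<beta> a (h k)) S"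
        using S(5)[OF a] by (simp add: pairing_def del: matlis_dual_simps)
    qed (use kc \<beta>Y in auto)
    also have "\<dots> = finsum Y (\<lambda>k. finsum Y (\<lambda>a. k a \<odot>\<^bsub>Y\<^esub> \<beta> a (h k)) A) S"
      using kc \<beta>Y by (intro Y.finsum_swap[OF A(2) S(1)]) auto
    also have "\<dots> = finsum Y (\<lambda>k. \<zero>\<^bsub>Y\<^esub>) S"
    proof (rule Y.finsum_cong')
      fix k assume k: "k \<in> S"
      have c: "k \<in> A \<rightarrow> carrier R" using kc k by auto
      have "(\<lambda>a. a) \<in> mhom R ?I ?S" using Isub by (auto simp: mhom_def)
      from mhom_pairing[OF mI mS this A(2) c, of "\<lambda>a. a"]
      have "pairing ?I A k (\<lambda>a. a) = \<zero>\<^bsub>?I\<^esub>" using S(3)[OF k] AI by auto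
      moreover have "\<beta> (pairing ?I A k (\<lambda>a. a)) (h k) = pairing Y A k (\<lambda>a. \<beta> a (h k))"
        using AI by (intro mhom_pairing[OF mI assms(5) \<beta>2[OF hD[OF k]] A(2) c]) auto
      moreover have "\<beta> \<zero>\<^bsub>?I\<^esub> (h k) = \<zero>\<^bsub>Y\<^esub>" by (rule mhom_zero[OF mI assms(5) \<beta>2[OF hD[OF k]]])
      ultimately show "finsum Y (\<lambda>a. k a \<odot>\<^bsub>Y\<^esub> \<beta> a (h k)) A = \<zero>\<^bsub>Y\<^esub>"
        by (simp add: pairing_def)
    qed auto
    finally show ?thesis by simp
  qed
  have \<beta>u: "(\<lambda>a. \<beta> a u) \<in> mhom R ?I Y" by (rule \<beta>2[OF u])
  have "submodule {a \<in> I. \<beta> a u = \<zero>\<^bsub>Y\<^esub>} R ?I"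
    using submodule_kernel[OF mI assms(5) \<beta>u] by simp
  from submodule_image[OF mI mS _ this, of "\<lambda>a. a"]
  have "submodule {a \<in> I. \<beta> a u = \<zero>\<^bsub>Y\<^esub>} R ?S" using Isub by (auto simp: mhom_def)
  moreover have "A \<subseteq> {a \<in> I. \<beta> a u = \<zero>\<^bsub>Y\<^esub>}" using AI gen by auto
  ultimately have "I \<subseteq> {a \<in> I. \<beta> a u = \<zero>\<^bsub>Y\<^esub>}"
    using submodule_span_least(3)[OF mS, of A] A(1,3) genideal_eq_span[OF cr] by auto
  then show ?thesis using assms(10) by blast
qed

section \<open>Tensor products and duals of flat modules\<close>

lemma pair_basis_single:
  "pair_basis R A M a x = single (self_module R) (carrier A \<times> carrier M) (a, x) \<one>\<^bsub>R\<^esub>"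
  unfolding pair_basis_def single_def ideal_module_simps by (rule refl)

lemma free_on_pairs_induct:
  fixes R (structure)
  assumes "cring R" "submodule U R (free_on_pairs R A M)"
    and "\<And>a x. a \<in> carrier A \<Longrightarrow> x \<in> carrier M \<Longrightarrow> pair_basis R A M a x \<in> U"
  shows "carrier (free_on_pairs R A M) \<subseteq> U"
proof (rule copower_induct[OF module_self[OF assms(1)] assms(2)])
  interpret cring R by fact
  let ?F = "free_on_pairs R A M"
  have mF: "module R ?F" by (rule module_copower[OF module_self[OF assms(1)]])
  fix p r assume p: "p \<in> carrier A \<times> carrier M" and "r \<in> carrier (self_module R)"
  then have r: "r \<in> carrier R" by simp
  have "r \<odot>\<^bsub>?F\<^esub> single (self_module R) (carrier A \<times> carrier M) p \<one> \<in> U"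
    using assms(3)[of "fst p" "snd p"] p r
    by (intro submoduleD(5)[OF mF assms(2)]) (auto simp: pair_basis_single)
  then show "single (self_module R) (carrier A \<times> carrier M) p r \<in> U"
    using mhomD(3)[OF single_mhom[OF module_self[OF assms(1)] p] r, of \<one>] r by simp
qed

lemma pair_basis_closed:
  assumes "cring R" "a \<in> carrier A" "x \<in> carrier M"
  shows "pair_basis R A M a x \<in> carrier (free_on_pairs R A M)"
proof -
  interpret cring R by fact
  show ?thesis unfolding pair_basis_single
    using assms by (intro mhomD(1)[OF single_mhom[OF module_self]]) auto
qed

lemma bilinear_relations_closed:
  assumes "module R A" "module R M"
  shows "bilinear_relations R A M \<subseteq> carrier (free_on_pairs R A M)"
proof -
  interpret A: module R A by fact
  interpret M: module R M by fact
  have cr: "cring R" by (rule A.R.is_cring)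
  interpret F: module R "free_on_pairs R A M" by (rule module_copower[OF module_self[OF cr]])
  note b = pair_basis_closed[OF cr]
  show ?thesis
    unfolding bilinear_relations_def Let_def
    by (auto simp del: copower_simps intro!: F.minus_closed F.a_closed F.smult_closed b)
qed

lemma tensor_kernel_submodule:
  assumes "module R A" "module R M"
  shows "submodule (tensor_kernel R A M) R (free_on_pairs R A M)"
proof -
  interpret A: module R A by fact
  show ?thesis
    by (intro submodule_span_least(1) module_copower module_self A.R.is_cring
        bilinear_relations_closed assms)
qed

text \<open>
  The universal property of the tensor product, stated on the free module that it is a quotient of:
  this form needs no choice of representatives.
\<close>

lemma tensor_lift:
  assumes "module R A" "module R M" "module R Y"
    and \<beta>1: "\<And>a. a \<in> carrier A \<Longrightarrow> \<beta> a \<in> mhom R M Y"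
    and \<beta>2: "\<And>x. x \<in> carrier M \<Longrightarrow> (\<lambda>a. \<beta> a x) \<in> mhom R A Y"
  obtains \<Phi> where "\<Phi> \<in> mhom R (free_on_pairs R A M) Y"
    "\<And>a x. a \<in> carrier A \<Longrightarrow> x \<in> carrier M \<Longrightarrow> \<Phi> (pair_basis R A M a x) = \<beta> a x"
    "\<And>F. F \<in> tensor_kernel R A M \<Longrightarrow> \<Phi> F = \<zero>\<^bsub>Y\<^esub>"
proof -
  interpret A: module R A by fact
  interpret M: module R M by fact
  interpret Y: module R Y by fact
  have cr: "cring R" by (rule A.R.is_cring)
  let ?F = "free_on_pairs R A M" and ?S = "self_module R"
  have mS: "module R ?S" by (rule module_self[OF cr])
  have mF: "module R ?F" by (rule module_copower[OF mS])
  interpret F: module R ?F by fact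
  define \<Phi> where "\<Phi> = copower_map ?S Y (carrier A \<times> carrier M) (\<lambda>p r. r \<odot>\<^bsub>Y\<^esub> \<beta> (fst p) (snd p))"
  have val: "\<beta> a x \<in> carrier Y" if "a \<in> carrier A" "x \<in> carrier M" for a x
    using mhomD(1)[OF \<beta>1] that by auto
  have h: "(\<lambda>r. r \<odot>\<^bsub>Y\<^esub> \<beta> (fst p) (snd p)) \<in> mhom R ?S Y" if "p \<in> carrier A \<times> carrier M" for p
    using val[of "fst p" "snd p"] that
    by (intro mhomI) (auto simp: Y.smult_l_distr Y.smult_assoc1)
  note cm = copower_map[OF mS assms(3) h]
  have \<Phi>: "\<Phi> \<in> mhom R ?F Y" unfolding \<Phi>_def by (rule cm(1))
  have basis: "\<Phi> (pair_basis R A M a x) = \<beta> a x" if "a \<in> carrier A" "x \<in> carrier M" for a x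
    using cm(2)[where i = "(a, x)" and a = "\<one>\<^bsub>R\<^esub>"] that val by (simp add: \<Phi>_def pair_basis_single)
  note b = pair_basis_closed[OF cr]
  have eq: "\<Phi> (F \<ominus>\<^bsub>?F\<^esub> G) = \<zero>\<^bsub>Y\<^esub>" if "F \<in> carrier ?F" "G \<in> carrier ?F" "\<Phi> F = \<Phi> G" for F G
    using mhom_minus[OF mF assms(3) \<Phi> that(1,2)] that(3) mhomD(1)[OF \<Phi> that(2)]
    by (simp add: a_minus_def Y.r_neg)
  have "bilinear_relations R A M \<subseteq> {F \<in> carrier ?F. \<Phi> F = \<zero>\<^bsub>Y\<^esub>}"
  proof
    fix F assume F: "F \<in> bilinear_relations R A M"
    then have "\<Phi> F = \<zero>\<^bsub>Y\<^esub>"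
      unfolding bilinear_relations_def Let_def
      by (auto simp del: copower_simps intro!: eq b F.a_closed F.smult_closed
          simp: basis mhomD(2)[OF \<Phi>] mhomD(3)[OF \<Phi>] mhomD(2,3)[OF \<beta>1] mhomD(2,3)[OF \<beta>2] b)
    then show "F \<in> {F \<in> carrier ?F. \<Phi> F = \<zero>\<^bsub>Y\<^esub>}"
      using bilinear_relations_closed[OF assms(1,2)] F by auto
  qed
  then have "tensor_kernel R A M \<subseteq> {F \<in> carrier ?F. \<Phi> F = \<zero>\<^bsub>Y\<^esub>}"
    by (intro submodule_span_least(3)[OF mF bilinear_relations_closed[OF assms(1,2)]]
        submodule_kernel[OF mF assms(3) \<Phi>])
  then show ?thesis using that \<Phi> basis by blast
qed

lemma module_tensor:
  assumes "module R A" "module R M"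
  shows "module R (tensor R A M)"
    and "(\<lambda>F. tensor_kernel R A M +>\<^bsub>free_on_pairs R A M\<^esub> F) \<in> mhom R (free_on_pairs R A M) (tensor R A M)"
    and "\<And>F. F \<in> carrier (free_on_pairs R A M) \<Longrightarrow>
      tensor_kernel R A M +>\<^bsub>free_on_pairs R A M\<^esub> F = \<zero>\<^bsub>tensor R A M\<^esub> \<longleftrightarrow> F \<in> tensor_kernel R A M"
proof -
  interpret A: module R A by fact
  have cr: "cring R" by (rule A.R.is_cring)
  have mF: "module R (free_on_pairs R A M)" by (rule module_copower[OF module_self[OF cr]])
  note q = module_quot[OF mF tensor_kernel_submodule[OF assms]]
  show "module R (tensor R A M)"
    "(\<lambda>F. tensor_kernel R A M +>\<^bsub>free_on_pairs R A M\<^esub> F) \<in> mhom R (free_on_pairs R A M) (tensor R A M)"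
    "\<And>F. F \<in> carrier (free_on_pairs R A M) \<Longrightarrow>
      tensor_kernel R A M +>\<^bsub>free_on_pairs R A M\<^esub> F = \<zero>\<^bsub>tensor R A M\<^esub> \<longleftrightarrow> F \<in> tensor_kernel R A M"
    using q(1,2,4) by (simp_all add: tensor_def)
qed

lemma pure_tensor_bilinear:
  assumes "module R A" "module R M"
  shows "a \<in> carrier A \<Longrightarrow> pure_tensor R A M a \<in> mhom R M (tensor R A M)"
    and "x \<in> carrier M \<Longrightarrow> (\<lambda>a. pure_tensor R A M a x) \<in> mhom R A (tensor R A M)"
proof -
  interpret A: module R A by fact
  interpret M: module R M by fact
  have cr: "cring R" by (rule A.R.is_cring)
  let ?F = "free_on_pairs R A M" and ?T = "tensor R A M" and ?b = "pair_basis R A M"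
  have mF: "module R ?F" by (rule module_copower[OF module_self[OF cr]])
  interpret F: module R ?F by fact
  note t = module_tensor[OF assms]
  interpret T: module R ?T by (rule t(1))
  note b = pair_basis_closed[OF cr]
  have rel: "bilinear_relations R A M \<subseteq> tensor_kernel R A M"
    by (rule submodule_span_least(2)[OF mF bilinear_relations_closed[OF assms]])
  define \<kappa> where "\<kappa> F = tensor_kernel R A M +>\<^bsub>?F\<^esub> F" for F
  have \<kappa>: "\<kappa> \<in> mhom R ?F ?T" using t(2) unfolding \<kappa>_def .
  have eq: "\<kappa> F = \<kappa> G" if "F \<ominus>\<^bsub>?F\<^esub> G \<in> bilinear_relations R A M" "F \<in> carrier ?F" "G \<in> carrier ?F" for F G
  proof -
    have "\<kappa> F \<ominus>\<^bsub>?T\<^esub> \<kappa> G = \<zero>\<^bsub>?T\<^esub>"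
      using t(3)[OF F.minus_closed[OF that(2,3)]] mhom_minus[OF mF t(1) \<kappa> that(2,3)] that(1) rel
      by (auto simp: \<kappa>_def)
    then show ?thesis
      by (rule T.eq_if_minus_zero[OF mhomD(1)[OF \<kappa> that(2)] mhomD(1)[OF \<kappa> that(3)]])
  qed
  have p: "pure_tensor R A M a x = \<kappa> (?b a x)" for a x by (simp add: pure_tensor_def \<kappa>_def)
  note intros = mhomI mhomD(1)[OF \<kappa>] b F.a_closed F.smult_closed
  show "pure_tensor R A M a \<in> mhom R M ?T" if a: "a \<in> carrier A"
  proof (rule mhomI)
    fix x assume x: "x \<in> carrier M"
    show "pure_tensor R A M a x \<in> carrier ?T" unfolding p using a x by (intro mhomD(1)[OF \<kappa>] b)
    show "pure_tensor R A M a (x \<oplus>\<^bsub>M\<^esub> y) = pure_tensor R A M a x \<oplus>\<^bsub>?T\<^esub> pure_tensor R A M a y"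
      if y: "y \<in> carrier M" for y
    proof -
      have "\<kappa> (?b a (x \<oplus>\<^bsub>M\<^esub> y)) = \<kappa> (?b a x \<oplus>\<^bsub>?F\<^esub> ?b a y)"
        using a x y unfolding bilinear_relations_def Let_def
        by (intro eq b F.a_closed M.a_closed) (unfold bilinear_relations_def Let_def, blast)
      then show ?thesis unfolding p using mhomD(2)[OF \<kappa> b[OF a x] b[OF a y]] by simp
    qed
    show "pure_tensor R A M a (r \<odot>\<^bsub>M\<^esub> x) = r \<odot>\<^bsub>?T\<^esub> pure_tensor R A M a x"
      if r: "r \<in> carrier R" for r
    proof -
      have "\<kappa> (?b a (r \<odot>\<^bsub>M\<^esub> x)) = \<kappa> (r \<odot>\<^bsub>?F\<^esub> ?b a x)"
        using a x r
        by (intro eq b F.smult_closed M.smult_closed) (unfold bilinear_relations_def Let_def, blast)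
      then show ?thesis unfolding p using mhomD(3)[OF \<kappa> r b[OF a x]] by simp
    qed
  qed
  show "(\<lambda>a. pure_tensor R A M a x) \<in> mhom R A ?T" if x: "x \<in> carrier M"
  proof (rule mhomI)
    fix a assume a: "a \<in> carrier A"
    show "pure_tensor R A M a x \<in> carrier ?T" unfolding p using a x by (intro mhomD(1)[OF \<kappa>] b)
    show "pure_tensor R A M (a \<oplus>\<^bsub>A\<^esub> c) x = pure_tensor R A M a x \<oplus>\<^bsub>?T\<^esub> pure_tensor R A M c x"
      if c: "c \<in> carrier A" for c
    proof -
      have "\<kappa> (?b (a \<oplus>\<^bsub>A\<^esub> c) x) = \<kappa> (?b a x \<oplus>\<^bsub>?F\<^esub> ?b c x)"
        using a x c
        by (intro eq b F.a_closed A.a_closed) (unfold bilinear_relations_def Let_def, blast)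
      then show ?thesis unfolding p using mhomD(2)[OF \<kappa> b[OF a x] b[OF c x]] by simp
    qed
    show "pure_tensor R A M (r \<odot>\<^bsub>A\<^esub> a) x = r \<odot>\<^bsub>?T\<^esub> pure_tensor R A M a x"
      if r: "r \<in> carrier R" for r
    proof -
      have "\<kappa> (?b (r \<odot>\<^bsub>A\<^esub> a) x) = \<kappa> (r \<odot>\<^bsub>?F\<^esub> ?b a x)"
        using a x r
        by (intro eq b F.smult_closed A.smult_closed) (unfold bilinear_relations_def Let_def, blast)
      then show ?thesis unfolding p using mhomD(3)[OF \<kappa> r b[OF a x]] by simp
    qed
  qed
qed

text \<open>
  A homomorphism \<open>g : A \<rightarrow> Hom(M, E)\<close> on an ideal is a homomorphism \<open>A \<otimes> M \<rightarrow> E\<close>. By flatness \<open>A \<otimes> M\<close>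
  embeds into \<open>R \<otimes> M\<close>, which is \<open>M\<close>, so injectivity of \<open>E\<close> extends the map to some \<open>h : M \<rightarrow> E\<close>, and
  \<open>g a = a h\<close>. On the free module, \<open>\<Phi>\<close> is the multiplication map \<open>a \<otimes> x \<mapsto> a x\<close> and \<open>\<Psi>\<close> is the
  map induced by \<open>g\<close>; flatness enters only through the inclusion of their kernels.
\<close>

theorem flat_dual_injective:
  assumes "flat_module R M" "baer_injective R E"
  shows "baer_injective R (matlis_dual R E M)"
  unfolding baer_injective_def
proof (intro conjI allI impI)
  have mM: "module R M" and mE: "module R E"
    using assms by (auto simp: flat_module_def baer_injective_def)
  interpret M: module R M by fact
  interpret E: module R E by fact
  have cr: "cring R" by (rule M.R.is_cring)
  let ?D = "matlis_dual R E M" and ?S = "self_module R"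
  show mD: "module R ?D" by (rule module_matlis_dual[OF mE mM])
  have mS: "module R ?S" by (rule module_self[OF cr])
  fix A g assume "ideal A R \<and> g \<in> mhom R (ideal_module R A) ?D"
  then have A: "ideal A R" and g: "g \<in> mhom R (ideal_module R A) ?D" by auto
  let ?A = "ideal_module R A"
  have mA: "module R ?A" by (rule module_ideal[OF cr A])
  have sub: "a \<in> carrier R" if "a \<in> A" for a using ideal.Icarr[OF A that] .
  have "(\<lambda>a. a) \<in> mhom R ?A ?S" using sub by (auto simp: mhom_def)
  moreover have "inj_on (\<lambda>a. a) (carrier ?A)" by simp
  ultimately obtain \<psi> where \<psi>: "\<psi> \<in> mhom R (tensor R ?A M) (tensor R ?S M)"
    "\<And>a x. a \<in> A \<Longrightarrow> x \<in> carrier M \<Longrightarrow> \<psi> (pure_tensor R ?A M a x) = pure_tensor R ?S M a x"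
    "inj_on \<psi> (carrier (tensor R ?A M))"
    using assms(1) mA mS unfolding flat_module_def by (metis ideal_module_simps(1))
  let ?F = "free_on_pairs R ?A M" and ?T = "tensor R ?A M" and ?T' = "tensor R ?S M"
  have mF: "module R ?F" by (rule module_copower[OF mS])
  interpret F: module R ?F by fact
  note T = module_tensor[OF mA mM] and T' = module_tensor(1)[OF mS mM]
  note p = pure_tensor_bilinear[OF mA mM] and p' = pure_tensor_bilinear[OF mS mM]
  obtain \<Phi> where \<Phi>: "\<Phi> \<in> mhom R ?F M"
    "\<And>a x. a \<in> A \<Longrightarrow> x \<in> carrier M \<Longrightarrow> \<Phi> (pair_basis R ?A M a x) = a \<odot>\<^bsub>M\<^esub> x"
  proof (rule tensor_lift[OF mA mM mM, of "\<lambda>a x. a \<odot>\<^bsub>M\<^esub> x"])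
    show "(\<odot>\<^bsub>M\<^esub>) a \<in> mhom R M M" if "a \<in> carrier ?A" for a
      using sub[of a] that by (intro mhomI)
        (auto simp: M.smult_r_distr M.R.m_comm simp flip: M.smult_assoc1)
    show "(\<lambda>a. a \<odot>\<^bsub>M\<^esub> x) \<in> mhom R ?A M" if "x \<in> carrier M" for x
      using sub that by (intro mhomI) (auto simp: M.smult_l_distr M.smult_assoc1)
  qed auto
  have gD: "g a \<in> carrier ?D" if "a \<in> A" for a using mhomD(1)[OF g, of a] that by (simp del: matlis_dual_simps)
  obtain \<Psi> where \<Psi>: "\<Psi> \<in> mhom R ?F E"
    "\<And>a x. a \<in> A \<Longrightarrow> x \<in> carrier M \<Longrightarrow> \<Psi> (pair_basis R ?A M a x) = g a x"
    "\<And>F. F \<in> tensor_kernel R ?A M \<Longrightarrow> \<Psi> F = \<zero>\<^bsub>E\<^esub>"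
  proof (rule tensor_lift[OF mA mM mE, of g])
    show "g a \<in> mhom R M E" if "a \<in> carrier ?A" for a using gD[of a] that by auto
    show "(\<lambda>a. g a x) \<in> mhom R ?A E" if "x \<in> carrier M" for x
      using mhom_comp[OF g matlis_dual_eval[OF that]] .
  qed auto
  let ?\<kappa> = "\<lambda>F. tensor_kernel R ?A M +>\<^bsub>?F\<^esub> F"
  have one: "\<one>\<^bsub>R\<^esub> \<in> carrier ?S" by simp
  have lhs: "(\<lambda>F. \<psi> (?\<kappa> F)) \<in> mhom R ?F ?T'" by (rule mhom_comp[OF T(2) \<psi>(1)])
  have rhs: "(\<lambda>F. pure_tensor R ?S M \<one>\<^bsub>R\<^esub> (\<Phi> F)) \<in> mhom R ?F ?T'"
    by (rule mhom_comp[OF \<Phi>(1) p'(1)[OF one]])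
  \<comment> \<open>The embedding A \<otimes> M \<rightarrow> R \<otimes> M followed by R \<otimes> M = M is the multiplication map.\<close>
  have comm: "\<psi> (?\<kappa> F) = pure_tensor R ?S M \<one>\<^bsub>R\<^esub> (\<Phi> F)" if "F \<in> carrier ?F" for F
  proof -
    let ?U = "{F \<in> carrier ?F. \<psi> (?\<kappa> F) = pure_tensor R ?S M \<one>\<^bsub>R\<^esub> (\<Phi> F)}"
    have "carrier ?F \<subseteq> ?U"
    proof (rule free_on_pairs_induct[OF cr])
      show "submodule ?U R ?F"
        by (rule submodule_equalizer[OF mF T' lhs rhs])
      fix a x assume a: "a \<in> carrier ?A" and x: "x \<in> carrier M"
      have "\<psi> (?\<kappa> (pair_basis R ?A M a x)) = pure_tensor R ?S M (a \<odot>\<^bsub>?S\<^esub> \<one>\<^bsub>R\<^esub>) x"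
        using \<psi>(2)[of a x] a x sub[of a] by (simp add: pure_tensor_def)
      also have "\<dots> = a \<odot>\<^bsub>?T'\<^esub> pure_tensor R ?S M \<one>\<^bsub>R\<^esub> x"
        using mhomD(3)[OF p'(2)[OF x] sub[of a] one] a by simp
      also have "\<dots> = pure_tensor R ?S M \<one>\<^bsub>R\<^esub> (a \<odot>\<^bsub>M\<^esub> x)"
        using mhomD(3)[OF p'(1)[OF one] sub[of a] x] a by simp
      finally show "pair_basis R ?A M a x \<in> ?U"
        using pair_basis_closed[OF cr a x] \<Phi>(2)[of a x] a x by simp
    qed
    then show ?thesis using that by blast
  qed
  have ker: "\<Psi> F = \<zero>\<^bsub>E\<^esub>" if F: "F \<in> carrier ?F" "\<Phi> F = \<zero>\<^bsub>M\<^esub>" for F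
  proof -
    interpret T: module R ?T by (rule T(1))
    have "\<psi> (?\<kappa> F) = \<zero>\<^bsub>?T'\<^esub>"
      using comm[OF F(1)] F(2) mhom_zero[OF mM T' p'(1)[OF one]] by simp
    also have "\<dots> = \<psi> \<zero>\<^bsub>?T\<^esub>" using mhom_zero[OF T(1) T' \<psi>(1)] by simp
    finally have "?\<kappa> F = \<zero>\<^bsub>?T\<^esub>"
      using inj_onD[OF \<psi>(3)] mhomD(1)[OF T(2) F(1)] T.zero_closed by blast
    then show ?thesis using T(3)[OF F(1)] \<Psi>(3) by simp
  qed
  obtain h where h: "h \<in> mhom R M E" "\<And>F. F \<in> carrier ?F \<Longrightarrow> h (\<Phi> F) = \<Psi> F"
    by (rule baer_factorization[OF assms(2) mF mM \<Phi>(1) \<Psi>(1)], rule ker, assumption+, rule that)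
  show "\<exists>q\<in>carrier ?D. \<forall>a\<in>A. g a = a \<odot>\<^bsub>?D\<^esub> q"
  proof (intro bexI ballI)
    show "restrict h (carrier M) \<in> carrier ?D" by (rule restrict_mhom[OF h(1) mM])
    fix a assume a: "a \<in> A"
    show "g a = a \<odot>\<^bsub>?D\<^esub> restrict h (carrier M)"
    proof (rule extensionalityI[of _ "carrier M"])
      show "g a \<in> extensional (carrier M)" using gD[OF a] by simp
      show "a \<odot>\<^bsub>?D\<^esub> restrict h (carrier M) \<in> extensional (carrier M)" by simp
      fix x assume x: "x \<in> carrier M"
      have "h (a \<odot>\<^bsub>M\<^esub> x) = g a x"
        using h(2)[OF pair_basis_closed[OF cr, of a ?A x M]] \<Phi>(2)[OF a x] \<Psi>(2)[OF a x] a x by simp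
      then show "g a x = (a \<odot>\<^bsub>?D\<^esub> restrict h (carrier M)) x"
        using mhomD(3)[OF h(1) sub[OF a] x] x by simp
    qed
  qed
qed

section \<open>The injective hull of the residue field is artinian\<close>

lemma noetherian_maximal_ideal_in_family:
  assumes "noetherian_ring R" "\<A> \<noteq> {}" "\<And>A. A \<in> \<A> \<Longrightarrow> ideal A R"
  obtains P where "P \<in> \<A>" "\<And>A. A \<in> \<A> \<Longrightarrow> P \<subseteq> A \<Longrightarrow> A = P"
proof -
  have "\<exists>P\<in>\<A>. \<forall>A\<in>\<A>. P \<subseteq> A \<longrightarrow> A = P"
  proof (rule subset_Zorn_nonempty[OF assms(2)])
    fix C assume C: "C \<noteq> {}" "subset.chain \<A> C"
    then have "subset.chain {I. ideal I R} C" using assms(3) by (auto simp: subset.chain_def)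
    from noetherian_ring.ideal_chain_is_trivial[OF assms(1) C(1) this] C(2)
    show "\<Union>C \<in> \<A>" by (auto simp: subset.chain_def)
  qed
  then show ?thesis using that by blast
qed

lemma noetherian_local_ring_proper_ideal:
  assumes "noetherian_local_ring R \<mm>" "ideal J R" "\<one>\<^bsub>R\<^esub> \<notin> J"
  shows "J \<subseteq> \<mm>"
proof -
  have n: "noetherian_ring R" and cr: "cring R" and uniq: "\<And>\<nn>. maximalideal \<nn> R \<Longrightarrow> \<nn> = \<mm>"
    using assms(1) by (auto simp: noetherian_local_ring_def)
  obtain P where P: "P \<in> {A. ideal A R \<and> J \<subseteq> A \<and> \<one>\<^bsub>R\<^esub> \<notin> A}"
    "\<And>A. A \<in> {A. ideal A R \<and> J \<subseteq> A \<and> \<one>\<^bsub>R\<^esub> \<notin> A} \<Longrightarrow> P \<subseteq> A \<Longrightarrow> A = P"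
    by (rule noetherian_maximal_ideal_in_family[OF n, of "{A. ideal A R \<and> J \<subseteq> A \<and> \<one>\<^bsub>R\<^esub> \<notin> A}"])
      (use assms(2,3) in auto)
  interpret cring R by fact
  have "maximalideal P R"
  proof (rule maximalidealI)
    show "ideal P R" using P(1) by blast
    show "carrier R \<noteq> P" using P(1) by blast
    fix A assume A: "ideal A R" "P \<subseteq> A" "A \<subseteq> carrier R"
    show "A = P \<or> A = carrier R"
    proof (cases "\<one>\<^bsub>R\<^esub> \<in> A")
      case True
      then show ?thesis using ideal.one_imp_carrier[OF A(1)] by simp
    next
      case False
      then show ?thesis using P A by blast
    qed
  qed
  then show ?thesis using uniq P(1) by blast
qed

lemma maximalideal_comaximal:
  fixes R (structure)
  assumes "cring R" "maximalideal \<mm> R" "r \<in> carrier R" "r \<notin> \<mm>"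
  obtains a t where "a \<in> \<mm>" "t \<in> carrier R" "\<one> = a \<oplus> t \<otimes> r"
proof -
  interpret cring R by fact
  interpret m: maximalideal \<mm> R by fact
  define J where "J = {a \<oplus> t \<otimes> r | a t. a \<in> \<mm> \<and> t \<in> carrier R}"
  have JI: "a \<oplus> t \<otimes> r \<in> J" if "a \<in> \<mm>" "t \<in> carrier R" for a t
    using that unfolding J_def by blast
  have "submodule J R (self_module R)"
  proof (rule submoduleI'[OF module_self[OF assms(1)]]; simp)
    show "J \<subseteq> carrier R" using assms(3) by (auto simp: J_def)
    show "\<zero> \<in> J" using JI[of \<zero> \<zero>] assms(3) by simp
    fix x assume "x \<in> J"
    then obtain a t where x: "x = a \<oplus> t \<otimes> r" "a \<in> \<mm>" "t \<in> carrier R" unfolding J_def by blast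
    show "s \<otimes> x \<in> J" if "s \<in> carrier R" for s
      using JI[of "s \<otimes> a" "s \<otimes> t"] x that assms(3) by (simp add: r_distr m_assoc m.I_l_closed)
    fix y assume "y \<in> J"
    then obtain b u where y: "y = b \<oplus> u \<otimes> r" "b \<in> \<mm>" "u \<in> carrier R" unfolding J_def by blast
    have "x \<oplus> y = (a \<oplus> b) \<oplus> (t \<oplus> u) \<otimes> r"
      using x y assms(3) by (simp add: l_distr a_ac)
    then show "x \<oplus> y \<in> J" using JI[of "a \<oplus> b" "t \<oplus> u"] x y by simp
  qed
  then have J: "ideal J R" using ideal_iff_submodule[OF assms(1)] by simp
  have "\<mm> \<subseteq> J"
  proof
    fix a assume "a \<in> \<mm>"
    then show "a \<in> J" using JI[of a \<zero>] assms(3) by simp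
  qed
  moreover have "r \<in> J" using JI[of \<zero> \<one>] assms(3) by simp
  ultimately have "J = carrier R"
    using m.I_maximal[OF J] assms(4) ideal.Icarr[OF J] by blast
  then have "\<one> \<in> J" by simp
  then show ?thesis using that unfolding J_def by blast
qed

text \<open>
  The element \<open>e\<close> is the image of \<open>1\<close>; the last clause is the essentiality of the residue field,
  applied to the cyclic submodule generated by \<open>y\<close>.
\<close>

lemma injective_hull_residue_field:
  assumes "noetherian_local_ring R \<mm>" "injective_hull R (quot_module (self_module R) \<mm>) E"
  obtains e where "e \<in> carrier E" "e \<noteq> \<zero>\<^bsub>E\<^esub>" "\<And>r. r \<in> \<mm> \<Longrightarrow> r \<odot>\<^bsub>E\<^esub> e = \<zero>\<^bsub>E\<^esub>"
    "\<And>y. y \<in> carrier E \<Longrightarrow> y \<noteq> \<zero>\<^bsub>E\<^esub> \<Longrightarrow>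
      \<exists>r\<in>carrier R. \<exists>s\<in>carrier R. r \<odot>\<^bsub>E\<^esub> y \<noteq> \<zero>\<^bsub>E\<^esub> \<and> r \<odot>\<^bsub>E\<^esub> y = s \<odot>\<^bsub>E\<^esub> e"
proof -
  have cr: "cring R" and mm: "maximalideal \<mm> R"
    using assms(1) by (auto simp: noetherian_local_ring_def)
  interpret m: maximalideal \<mm> R by fact
  let ?S = "self_module R" and ?K = "quot_module (self_module R) \<mm>"
  have mS: "module R ?S" by (rule module_self[OF cr])
  have mE: "module R E" using assms(2) by (simp add: injective_hull_def injective_module_def)
  interpret E: module R E by fact
  interpret S: module R ?S by fact
  have sm: "submodule \<mm> R ?S" using ideal_iff_submodule[OF cr] m.is_ideal by blast
  note q = module_quot[OF mS sm]
  obtain \<iota> where \<iota>: "\<iota> \<in> mhom R ?K E" "inj_on \<iota> (carrier ?K)"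
    "\<And>U. submodule U R E \<Longrightarrow> U \<noteq> {\<zero>\<^bsub>E\<^esub>} \<Longrightarrow> U \<inter> \<iota> ` carrier ?K \<noteq> {\<zero>\<^bsub>E\<^esub>}"
    using assms(2) unfolding injective_hull_def by blast
  define j where "j r = \<iota> (\<mm> +>\<^bsub>?S\<^esub> r)" for r
  have j: "j \<in> mhom R ?S E" unfolding j_def by (rule mhom_comp[OF q(2) \<iota>(1)])
  have j0: "j r = \<zero>\<^bsub>E\<^esub> \<longleftrightarrow> r \<in> \<mm>" if r: "r \<in> carrier R" for r
  proof -
    interpret K: module R ?K by (rule q(1))
    have "j r = \<zero>\<^bsub>E\<^esub> \<longleftrightarrow> \<iota> (\<mm> +>\<^bsub>?S\<^esub> r) = \<iota> \<zero>\<^bsub>?K\<^esub>"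
      using mhom_zero[OF q(1) mE \<iota>(1)] by (simp add: j_def)
    also have "\<dots> \<longleftrightarrow> \<mm> +>\<^bsub>?S\<^esub> r = \<zero>\<^bsub>?K\<^esub>"
      using inj_on_eq_iff[OF \<iota>(2)] mhomD(1)[OF q(2), of r] r K.zero_closed by simp
    also have "\<dots> \<longleftrightarrow> r \<in> \<mm>" using q(4)[of r] r by simp
    finally show ?thesis .
  qed
  have jr: "j r = r \<odot>\<^bsub>E\<^esub> j \<one>\<^bsub>R\<^esub>" if "r \<in> carrier R" for r
    using mhomD(3)[OF j that, of "\<one>\<^bsub>R\<^esub>"] that by simp
  have im: "\<iota> ` carrier ?K = j ` carrier R" using q(3) by (simp add: j_def image_image)
  show ?thesis
  proof (rule that)
    show "j \<one>\<^bsub>R\<^esub> \<in> carrier E" using mhomD(1)[OF j] by simp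
    have "\<one>\<^bsub>R\<^esub> \<notin> \<mm>" using m.I_notcarr m.one_imp_carrier by blast
    then show "j \<one>\<^bsub>R\<^esub> \<noteq> \<zero>\<^bsub>E\<^esub>" using j0 by simp
    show "r \<odot>\<^bsub>E\<^esub> j \<one>\<^bsub>R\<^esub> = \<zero>\<^bsub>E\<^esub>" if "r \<in> \<mm>" for r
      using j0[of r] jr[of r] that m.Icarr by simp
    fix y assume y: "y \<in> carrier E" "y \<noteq> \<zero>\<^bsub>E\<^esub>"
    have h: "(\<lambda>r. r \<odot>\<^bsub>E\<^esub> y) \<in> mhom R ?S E"
      using y by (intro mhomI) (auto simp: E.smult_l_distr E.smult_assoc1)
    have "submodule ((\<lambda>r. r \<odot>\<^bsub>E\<^esub> y) ` carrier R) R E"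
      using submodule_image[OF mS mE h S.carrier_is_submodule] by simp
    moreover have "y \<in> (\<lambda>r. r \<odot>\<^bsub>E\<^esub> y) ` carrier R"
      using y by (intro image_eqI[of _ _ "\<one>\<^bsub>R\<^esub>"]) auto
    ultimately have "(\<lambda>r. r \<odot>\<^bsub>E\<^esub> y) ` carrier R \<inter> j ` carrier R \<noteq> {\<zero>\<^bsub>E\<^esub>}"
      using \<iota>(3) im y(2) by (metis singletonD)
    moreover have "\<zero>\<^bsub>E\<^esub> \<in> (\<lambda>r. r \<odot>\<^bsub>E\<^esub> y) ` carrier R \<inter> j ` carrier R"
      using mhom_zero[OF mS mE j] y by (auto intro!: image_eqI[of _ _ "\<zero>\<^bsub>R\<^esub>"])
    ultimately obtain z where "z \<in> (\<lambda>r. r \<odot>\<^bsub>E\<^esub> y) ` carrier R" "z \<in> j ` carrier R" "z \<noteq> \<zero>\<^bsub>E\<^esub>" by blast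
    then show "\<exists>r\<in>carrier R. \<exists>s\<in>carrier R. r \<odot>\<^bsub>E\<^esub> y \<noteq> \<zero>\<^bsub>E\<^esub> \<and> r \<odot>\<^bsub>E\<^esub> y = s \<odot>\<^bsub>E\<^esub> j \<one>\<^bsub>R\<^esub>"
    proof -
      from \<open>z \<in> (\<lambda>r. r \<odot>\<^bsub>E\<^esub> y) ` carrier R\<close> obtain r where r: "r \<in> carrier R" "z = r \<odot>\<^bsub>E\<^esub> y" by blast
      from \<open>z \<in> j ` carrier R\<close> obtain s where s: "s \<in> carrier R" "z = j s" by blast
      show ?thesis
        using r s \<open>z \<noteq> \<zero>\<^bsub>E\<^esub>\<close> jr[OF s(1)] by (intro bexI[of _ r] bexI[of _ s]) auto
    qed
  qed
qed

text \<open>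
  The chain condition for the submodule \<open>W\<close> of \<open>E\<close>, phrased inside \<open>E\<close> so that \<open>W\<close> can vary.
\<close>

definition dcc_in :: "('r, 'x) ring_scheme \<Rightarrow> ('r, 'm) module \<Rightarrow> 'm set \<Rightarrow> bool" where
  "dcc_in R E W \<longleftrightarrow> (\<forall>U :: nat \<Rightarrow> 'm set.
     (\<forall>n. submodule (U n) R E \<and> U n \<subseteq> W \<and> U (Suc n) \<subseteq> U n) \<longrightarrow> (\<exists>k. \<forall>n\<ge>k. U n = U k))"

lemma dcc_inE:
  assumes "dcc_in R E W" "\<And>n. submodule (U n) R E" "\<And>n. U n \<subseteq> W" "\<And>n. U (Suc n) \<subseteq> U n"
  obtains k where "\<And>n. n \<ge> k \<Longrightarrow> U n = U k"
  using assms unfolding dcc_in_def by meson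

text \<open>
  This is the dual of Hilbert's basis theorem. The leading terms of a submodule \<open>V\<close> in degree \<open>i\<close> are
  the elements \<open>x\<^sup>i e\<close> with \<open>e \<in> V\<close> and \<open>x\<^sup>i\<^sup>+\<^sup>1 e = 0\<close>; they form a submodule \<open>D i V\<close> of the kernel of \<open>x\<close>.
  It decreases with growing \<open>i\<close> and with shrinking \<open>V\<close>. For a descending chain of submodules all
  these leading terms therefore become stationary simultaneously, and nested submodules with the
  same leading terms agree: divide by leading terms, by induction on the power of \<open>x\<close> that kills an
  element.
\<close>

lemma dcc_of_kernel:
  assumes "module R E" "x \<in> carrier R" "submodule W R E"
    and torsion: "\<And>e. e \<in> W \<Longrightarrow> \<exists>n. x [^]\<^bsub>R\<^esub> (n::nat) \<odot>\<^bsub>E\<^esub> e = \<zero>\<^bsub>E\<^esub>"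
    and dcc: "dcc_in R E {e \<in> W. x \<odot>\<^bsub>E\<^esub> e = \<zero>\<^bsub>E\<^esub>}"
  shows "dcc_in R E W"
  unfolding dcc_in_def
proof (intro allI impI)
  interpret E: module R E by fact
  note W = submoduleD[OF assms(1,3)]
  fix U :: "nat \<Rightarrow> _" assume "\<forall>n. submodule (U n) R E \<and> U n \<subseteq> W \<and> U (Suc n) \<subseteq> U n"
  then have U: "submodule (U n) R E" "U n \<subseteq> W" "U (Suc n) \<subseteq> U n" for n by auto
  have anti: "U n \<subseteq> U m" if "m \<le> n" for m n by (rule lift_Suc_antimono_le[of U, OF U(3) that])
  have p: "x [^]\<^bsub>R\<^esub> (n::nat) \<in> carrier R" for n using assms(2) by simp
  have pS: "x [^]\<^bsub>R\<^esub> Suc n \<odot>\<^bsub>E\<^esub> e = x [^]\<^bsub>R\<^esub> n \<odot>\<^bsub>E\<^esub> (x \<odot>\<^bsub>E\<^esub> e)"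
    "x [^]\<^bsub>R\<^esub> Suc n \<odot>\<^bsub>E\<^esub> e = x \<odot>\<^bsub>E\<^esub> (x [^]\<^bsub>R\<^esub> n \<odot>\<^bsub>E\<^esub> e)" if "e \<in> carrier E" for e n
    using that assms(2) E.R.m_comm[OF p assms(2)] by (simp_all flip: E.smult_assoc1)
  have hp: "(\<lambda>e. x [^]\<^bsub>R\<^esub> (n::nat) \<odot>\<^bsub>E\<^esub> e) \<in> mhom R E E" for n
    by (rule mhomI) (simp_all add: p E.smult_r_distr E.R.m_comm[OF p] flip: E.smult_assoc1)
  define D where "D i V = (\<lambda>e. x [^]\<^bsub>R\<^esub> i \<odot>\<^bsub>E\<^esub> e) ` {e \<in> V. x [^]\<^bsub>R\<^esub> Suc i \<odot>\<^bsub>E\<^esub> e = \<zero>\<^bsub>E\<^esub>}" for i :: nat and V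
  \<comment> \<open>The exponents i and i + 1 differ so that D i V lies in the kernel of x.\<close>
  have Dsub: "submodule (D i (U n)) R E" for i n
    unfolding D_def
  proof (rule submodule_image[OF assms(1,1) hp])
    have "{e \<in> U n. x [^]\<^bsub>R\<^esub> Suc i \<odot>\<^bsub>E\<^esub> e = \<zero>\<^bsub>E\<^esub>}
        = U n \<inter> {e \<in> carrier E. x [^]\<^bsub>R\<^esub> Suc i \<odot>\<^bsub>E\<^esub> e = \<zero>\<^bsub>E\<^esub>}"
      using submoduleD(1)[OF assms(1) U(1)[of n]] by blast
    then show "submodule {e \<in> U n. x [^]\<^bsub>R\<^esub> Suc i \<odot>\<^bsub>E\<^esub> e = \<zero>\<^bsub>E\<^esub>} R E"
      using submodule_Int[OF assms(1) U(1) submodule_kernel[OF assms(1,1) hp[of "Suc i"]]] by simp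
  qed
  have Dker: "D i (U n) \<subseteq> {e \<in> W. x \<odot>\<^bsub>E\<^esub> e = \<zero>\<^bsub>E\<^esub>}" for i n
  proof
    fix y assume "y \<in> D i (U n)"
    then obtain e where e: "e \<in> U n" "x [^]\<^bsub>R\<^esub> Suc i \<odot>\<^bsub>E\<^esub> e = \<zero>\<^bsub>E\<^esub>" "y = x [^]\<^bsub>R\<^esub> i \<odot>\<^bsub>E\<^esub> e"
      unfolding D_def by blast
    have "e \<in> W" using e(1) U(2) by auto
    then show "y \<in> {e \<in> W. x \<odot>\<^bsub>E\<^esub> e = \<zero>\<^bsub>E\<^esub>}"
      using e pS(2)[of e i] W(1) W(5)[OF p] by auto
  qed
  have DSuc: "D (Suc i) (U n) \<subseteq> D i (U n)" for i n
  proof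
    fix y assume "y \<in> D (Suc i) (U n)"
    then obtain e where e: "e \<in> U n" "x [^]\<^bsub>R\<^esub> Suc (Suc i) \<odot>\<^bsub>E\<^esub> e = \<zero>\<^bsub>E\<^esub>" "y = x [^]\<^bsub>R\<^esub> Suc i \<odot>\<^bsub>E\<^esub> e"
      unfolding D_def by blast
    have eE: "e \<in> carrier E" using e(1) submoduleD(1)[OF assms(1) U(1)] by auto
    have "x \<odot>\<^bsub>E\<^esub> e \<in> U n" by (rule submoduleD(5)[OF assms(1) U(1) assms(2) e(1)])
    moreover have "x [^]\<^bsub>R\<^esub> Suc i \<odot>\<^bsub>E\<^esub> (x \<odot>\<^bsub>E\<^esub> e) = \<zero>\<^bsub>E\<^esub>"
      using e(2) pS(1)[OF eE, of "Suc i"] by (simp only:)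
    moreover have "y = x [^]\<^bsub>R\<^esub> i \<odot>\<^bsub>E\<^esub> (x \<odot>\<^bsub>E\<^esub> e)" using e(3) pS(1)[OF eE, of i] by (simp only:)
    ultimately show "y \<in> D i (U n)" unfolding D_def by blast
  qed
  have Dmono: "D i (U n) \<subseteq> D j (U m)" if "j \<le> i" "m \<le> n" for i j m n
  proof -
    have "D i (U n) \<subseteq> D j (U n)" by (rule lift_Suc_antimono_le[of "\<lambda>i. D i (U n)", OF DSuc that(1)])
    also have "\<dots> \<subseteq> D j (U m)" using anti[OF that(2)] unfolding D_def by blast
    finally show ?thesis .
  qed
  \<comment> \<open>The diagonal takes care of all degrees from s on; the finitely many others are treated one by one.\<close>
  obtain s where s: "\<And>n. n \<ge> s \<Longrightarrow> D n (U n) = D s (U s)"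
    by (rule dcc_inE[OF dcc, of "\<lambda>n. D n (U n)"]) (use Dsub Dker Dmono in auto)
  have "\<exists>k. \<forall>n\<ge>k. D i (U n) = D i (U k)" for i
    by (rule dcc_inE[OF dcc, of "\<lambda>n. D i (U n)"]) (use Dsub Dker Dmono in auto)
  then obtain k where k: "\<And>i n. n \<ge> k i \<Longrightarrow> D i (U n) = D i (U (k i))" by metis
  define K where "K = Max (insert s (k ` {..<s}))"
  have K: "s \<le> K" "\<And>i. i < s \<Longrightarrow> k i \<le> K" unfolding K_def by (auto intro!: Max_ge)
  have stable: "D i (U n) = D i (U K)" if n: "n \<ge> K" for i n
  proof (cases "i < s")
    case True
    then show ?thesis using k[of i n] k[of i K] K n by fastforce
  next
    case False
    have "D i (U m) = D s (U s)" if "m \<ge> s" for m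
    proof
      show "D i (U m) \<subseteq> D s (U s)" using False that by (intro Dmono) auto
      have "D s (U s) = D (max i m) (U (max i m))" using s[of "max i m"] that by auto
      also have "\<dots> \<subseteq> D i (U m)" by (intro Dmono) auto
      finally show "D s (U s) \<subseteq> D i (U m)" .
    qed
    then show ?thesis using n K by auto
  qed
  have "U n = U K" if n: "n \<ge> K" for n
  proof
    show "U n \<subseteq> U K" by (rule anti[OF n])
    have Un: "U n \<subseteq> U K" by (rule anti[OF n])
    note VK = submoduleD[OF assms(1) U(1)[of K]] and Vn = submoduleD[OF assms(1) U(1)[of n]]
    have ind: "v \<in> U n" if "v \<in> U K" "x [^]\<^bsub>R\<^esub> i \<odot>\<^bsub>E\<^esub> v = \<zero>\<^bsub>E\<^esub>" for i :: nat and v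
      using that
    proof (induction i arbitrary: v)
      case 0
      then have "v = \<zero>\<^bsub>E\<^esub>" using VK(1) by auto
      then show ?case using Vn(2) by simp
    next
      case (Suc i)
      have vE: "v \<in> carrier E" using Suc.prems(1) VK(1) by auto
      have "x [^]\<^bsub>R\<^esub> i \<odot>\<^bsub>E\<^esub> v \<in> D i (U K)" using Suc.prems unfolding D_def by blast
      then have "x [^]\<^bsub>R\<^esub> i \<odot>\<^bsub>E\<^esub> v \<in> D i (U n)" using stable[OF n] by simp
      then obtain u where u: "u \<in> U n" "x [^]\<^bsub>R\<^esub> i \<odot>\<^bsub>E\<^esub> v = x [^]\<^bsub>R\<^esub> i \<odot>\<^bsub>E\<^esub> u" unfolding D_def by blast
      have uE: "u \<in> carrier E" using u(1) Vn(1) by auto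
      have "x [^]\<^bsub>R\<^esub> i \<odot>\<^bsub>E\<^esub> (v \<ominus>\<^bsub>E\<^esub> u) = \<zero>\<^bsub>E\<^esub>"
        using mhom_minus[OF assms(1,1) hp vE uE, of i] u(2) uE p by (simp add: a_minus_def E.r_neg)
      moreover have "v \<ominus>\<^bsub>E\<^esub> u \<in> U K" using Suc.prems(1) u(1) Un by (intro VK(4)) auto
      ultimately have "v \<ominus>\<^bsub>E\<^esub> u \<in> U n" using Suc.IH by blast
      then have "(v \<ominus>\<^bsub>E\<^esub> u) \<oplus>\<^bsub>E\<^esub> u \<in> U n" using u(1) by (rule Vn(3))
      moreover have "(v \<ominus>\<^bsub>E\<^esub> u) \<oplus>\<^bsub>E\<^esub> u = v" using vE uE by (simp add: a_minus_def E.a_assoc E.l_neg)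
      ultimately show ?case by simp
    qed
    show "U K \<subseteq> U n" using ind torsion U(2) by blast
  qed
  then show "\<exists>k. \<forall>n\<ge>k. U n = U k" by blast
qed

text \<open>
  Every \<open>x \<in> \<mm>\<close> acts locally nilpotently: if the annihilators of \<open>x\<^sup>k y\<close> are stationary from \<open>k\<close> on and
  \<open>x\<^sup>k y \<noteq> 0\<close>, then a nonzero multiple of \<open>x\<^sup>k y\<close> lies in the residue field and is killed by \<open>x\<close>,
  which is impossible. The elements killed by all generators of \<open>\<mm>\<close> form the residue field, a simple
  module. Dropping one generator after the other, \<open>dcc_of_kernel\<close> carries the chain condition from
  there to \<open>E\<close>.
\<close>

theorem injective_hull_artinian:
  assumes "noetherian_local_ring R \<mm>" "injective_hull R (quot_module (self_module R) \<mm>) E"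
  shows "dcc_in R E (carrier E)"
proof -
  have n: "noetherian_ring R" and cr: "cring R" and mm: "maximalideal \<mm> R"
    using assms(1) by (auto simp: noetherian_local_ring_def)
  interpret m: maximalideal \<mm> R by fact
  have mE: "module R E" using assms(2) by (simp add: injective_hull_def injective_module_def)
  interpret E: module R E by fact
  have mS: "module R (self_module R)" by (rule module_self[OF cr])
  obtain e where e: "e \<in> carrier E" "e \<noteq> \<zero>\<^bsub>E\<^esub>" "\<And>r. r \<in> \<mm> \<Longrightarrow> r \<odot>\<^bsub>E\<^esub> e = \<zero>\<^bsub>E\<^esub>"
    "\<And>y. y \<in> carrier E \<Longrightarrow> y \<noteq> \<zero>\<^bsub>E\<^esub> \<Longrightarrow>
      \<exists>r\<in>carrier R. \<exists>s\<in>carrier R. r \<odot>\<^bsub>E\<^esub> y \<noteq> \<zero>\<^bsub>E\<^esub> \<and> r \<odot>\<^bsub>E\<^esub> y = s \<odot>\<^bsub>E\<^esub> e"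
    by (rule injective_hull_residue_field[OF assms], rule that)
  have scalar: "(\<lambda>r. r \<odot>\<^bsub>E\<^esub> y) \<in> mhom R (self_module R) E" if "y \<in> carrier E" for y
    using that by (intro mhomI) (auto simp: E.smult_l_distr E.smult_assoc1)
  have ann_ideal: "ideal {r \<in> carrier R. r \<odot>\<^bsub>E\<^esub> y = \<zero>\<^bsub>E\<^esub>} R" if "y \<in> carrier E" for y
    using submodule_kernel[OF mS mE scalar[OF that]] ideal_iff_submodule[OF cr] by simp
  have torsion: "\<exists>n. x [^]\<^bsub>R\<^esub> (n::nat) \<odot>\<^bsub>E\<^esub> y = \<zero>\<^bsub>E\<^esub>" if x: "x \<in> \<mm>" and y: "y \<in> carrier E" for x y
  proof -
    have xR: "x \<in> carrier R" using x by (rule m.Icarr)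
    have pc: "x [^]\<^bsub>R\<^esub> (n::nat) \<odot>\<^bsub>E\<^esub> y \<in> carrier E" for n using xR y by simp
    define C where "C k = {r \<in> carrier R. r \<odot>\<^bsub>E\<^esub> (x [^]\<^bsub>R\<^esub> k \<odot>\<^bsub>E\<^esub> y) = \<zero>\<^bsub>E\<^esub>}" for k :: nat
    have shift: "r \<odot>\<^bsub>E\<^esub> (x [^]\<^bsub>R\<^esub> Suc k \<odot>\<^bsub>E\<^esub> y) = x \<odot>\<^bsub>E\<^esub> (r \<odot>\<^bsub>E\<^esub> (x [^]\<^bsub>R\<^esub> k \<odot>\<^bsub>E\<^esub> y))"
      if "r \<in> carrier R" for r k
      using that xR y by (simp add: E.R.m_ac flip: E.smult_assoc1)
    have CS: "C k \<subseteq> C (Suc k)" for k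
      using xR shift by (auto simp: C_def simp del: nat_pow_Suc)
    have Cm: "C j \<subseteq> C k" if "j \<le> k" for j k by (rule lift_Suc_mono_le[of C, OF CS that])
    have "\<Union>(range C) \<in> range C"
    proof (rule noetherian_ring.ideal_chain_is_trivial[OF n])
      show "subset.chain {I. ideal I R} (range C)"
        unfolding subset_chain_def
      proof (intro conjI ballI)
        show "range C \<subseteq> {I. ideal I R}" using ann_ideal[OF pc] by (auto simp: C_def)
        show "A \<subseteq> B \<or> B \<subseteq> A" if "A \<in> range C" "B \<in> range C" for A B
          using that Cm nat_le_linear by (metis imageE)
      qed
    qed simp
    then obtain k where k: "\<Union>(range C) = C k" by blast
    have "x [^]\<^bsub>R\<^esub> k \<odot>\<^bsub>E\<^esub> y = \<zero>\<^bsub>E\<^esub>"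
    proof (rule ccontr)
      assume "x [^]\<^bsub>R\<^esub> k \<odot>\<^bsub>E\<^esub> y \<noteq> \<zero>\<^bsub>E\<^esub>"
      then obtain r s where rs: "r \<in> carrier R" "s \<in> carrier R"
        "r \<odot>\<^bsub>E\<^esub> (x [^]\<^bsub>R\<^esub> k \<odot>\<^bsub>E\<^esub> y) \<noteq> \<zero>\<^bsub>E\<^esub>" "r \<odot>\<^bsub>E\<^esub> (x [^]\<^bsub>R\<^esub> k \<odot>\<^bsub>E\<^esub> y) = s \<odot>\<^bsub>E\<^esub> e"
        using e(4)[OF pc] by blast
      have "x \<odot>\<^bsub>E\<^esub> (s \<odot>\<^bsub>E\<^esub> e) = s \<odot>\<^bsub>E\<^esub> (x \<odot>\<^bsub>E\<^esub> e)"
        using xR rs(2) e(1) by (simp add: E.R.m_comm flip: E.smult_assoc1)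
      then have "r \<in> C (Suc k)" using shift[OF rs(1), of k] rs e(3)[OF x] by (simp add: C_def del: nat_pow_Suc)
      then have "r \<in> C k" using k by blast
      then show False using rs(3) by (simp add: C_def)
    qed
    then show ?thesis by blast
  qed
  obtain A where A: "A \<subseteq> carrier R" "finite A" "\<mm> = Idl\<^bsub>R\<^esub> A"
    using noetherian_ring.finetely_gen[OF n m.is_ideal] by blast
  have Am: "A \<subseteq> \<mm>" using A submodule_span_least(2)[OF mS, of A] genideal_eq_span[OF cr] by auto
  define W where "W F = {y \<in> carrier E. \<forall>a\<in>A - F. a \<odot>\<^bsub>E\<^esub> y = \<zero>\<^bsub>E\<^esub>}" for F
  have Wsub: "submodule (W F) R E" for F
  proof (rule submoduleI'[OF mE])
    show "r \<odot>\<^bsub>E\<^esub> y \<in> W F" if r: "r \<in> carrier R" and y: "y \<in> W F" for r y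
    proof -
      have "a \<odot>\<^bsub>E\<^esub> (r \<odot>\<^bsub>E\<^esub> y) = r \<odot>\<^bsub>E\<^esub> (a \<odot>\<^bsub>E\<^esub> y)" if "a \<in> A" for a
        using r y A(1) that E.R.m_comm[of a r] by (auto simp: W_def simp flip: E.smult_assoc1)
      then show ?thesis using r y by (auto simp: W_def)
    qed
  qed (use A(1) in \<open>auto simp: W_def E.smult_r_distr subset_iff\<close>)
  have soc: "y \<in> (\<lambda>r. r \<odot>\<^bsub>E\<^esub> e) ` carrier R" if y: "y \<in> W {}" for y
  proof (cases "y = \<zero>\<^bsub>E\<^esub>")
    case True
    then show ?thesis using e(1) by (intro image_eqI[of _ _ "\<zero>\<^bsub>R\<^esub>"]) auto
  next
    case False
    have yE: "y \<in> carrier E" using y by (simp add: W_def)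
    have "A \<subseteq> {r \<in> carrier R. r \<odot>\<^bsub>E\<^esub> y = \<zero>\<^bsub>E\<^esub>}" using y A(1) by (auto simp: W_def)
    then have my: "\<mm> \<subseteq> {r \<in> carrier R. r \<odot>\<^bsub>E\<^esub> y = \<zero>\<^bsub>E\<^esub>}"
      unfolding A(3) using ann_ideal[OF yE] m.genideal_minimal by blast
    obtain r s where rs: "r \<in> carrier R" "s \<in> carrier R" "r \<odot>\<^bsub>E\<^esub> y \<noteq> \<zero>\<^bsub>E\<^esub>" "r \<odot>\<^bsub>E\<^esub> y = s \<odot>\<^bsub>E\<^esub> e"
      using e(4)[OF yE False] by blast
    have "r \<notin> \<mm>" using rs(3) my by auto
    then obtain a t where at: "a \<in> \<mm>" "t \<in> carrier R" "\<one>\<^bsub>R\<^esub> = a \<oplus>\<^bsub>R\<^esub> t \<otimes>\<^bsub>R\<^esub> r"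
      using maximalideal_comaximal[OF cr mm rs(1)] by blast
    have "y = (a \<oplus>\<^bsub>R\<^esub> t \<otimes>\<^bsub>R\<^esub> r) \<odot>\<^bsub>E\<^esub> y" using yE by (simp flip: at(3))
    also have "\<dots> = a \<odot>\<^bsub>E\<^esub> y \<oplus>\<^bsub>E\<^esub> t \<odot>\<^bsub>E\<^esub> (r \<odot>\<^bsub>E\<^esub> y)"
      using yE at(1,2) rs(1) m.Icarr by (simp add: E.smult_l_distr E.smult_assoc1)
    also have "\<dots> = (t \<otimes>\<^bsub>R\<^esub> s) \<odot>\<^bsub>E\<^esub> e"
      using subsetD[OF my at(1)] rs at(2) e(1) by (simp add: E.smult_assoc1)
    finally show ?thesis using at(2) rs(2) by blast
  qed
  have base: "dcc_in R E (W {})"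
    unfolding dcc_in_def
  proof (intro allI impI)
    fix U :: "nat \<Rightarrow> _" assume "\<forall>n. submodule (U n) R E \<and> U n \<subseteq> W {} \<and> U (Suc n) \<subseteq> U n"
    then have U: "submodule (U n) R E" "U n \<subseteq> W {}" "U (Suc n) \<subseteq> U n" for n by auto
    have simple: "U n = W {}" if ne: "U n \<noteq> {\<zero>\<^bsub>E\<^esub>}" for n
    proof -
      note V = submoduleD[OF mE U(1)[of n]]
      obtain y where y: "y \<in> U n" "y \<noteq> \<zero>\<^bsub>E\<^esub>" using ne V(2) by blast
      then obtain s where s: "s \<in> carrier R" "y = s \<odot>\<^bsub>E\<^esub> e" using soc U(2) by blast
      have "s \<notin> \<mm>" using s(2) y(2) e(3) by auto
      then obtain a t where at: "a \<in> \<mm>" "t \<in> carrier R" "\<one>\<^bsub>R\<^esub> = a \<oplus>\<^bsub>R\<^esub> t \<otimes>\<^bsub>R\<^esub> s"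
        using maximalideal_comaximal[OF cr mm s(1)] by blast
      have "e = (a \<oplus>\<^bsub>R\<^esub> t \<otimes>\<^bsub>R\<^esub> s) \<odot>\<^bsub>E\<^esub> e" using e(1) by (simp flip: at(3))
      also have "\<dots> = a \<odot>\<^bsub>E\<^esub> e \<oplus>\<^bsub>E\<^esub> t \<odot>\<^bsub>E\<^esub> y"
        using e(1) at(1,2) s m.Icarr by (simp add: E.smult_l_distr E.smult_assoc1)
      also have "\<dots> = t \<odot>\<^bsub>E\<^esub> y" using e(3)[OF at(1)] at(2) s e(1) by simp
      also have "\<dots> \<in> U n" using at(2) y(1) by (rule V(5))
      finally have "e \<in> U n" .
      then have "W {} \<subseteq> U n" using soc V(5) by blast
      then show ?thesis using U(2) by blast
    qed
    show "\<exists>k. \<forall>n\<ge>k. U n = U k"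
    proof (cases "\<exists>k. U k = {\<zero>\<^bsub>E\<^esub>}")
      case True
      then obtain k where k: "U k = {\<zero>\<^bsub>E\<^esub>}" by blast
      have "U n = U k" if "n \<ge> k" for n
        using lift_Suc_antimono_le[of U, OF U(3) that] k submoduleD(2)[OF mE U(1)[of n]] by auto
      then show ?thesis by blast
    next
      case False
      then show ?thesis using simple by auto
    qed
  qed
  have "dcc_in R E (W F)" if "finite F" "F \<subseteq> A" for F
    using that
  proof (induction F rule: finite_induct)
    case empty
    show ?case by (rule base)
  next
    case (insert x F)
    have xm: "x \<in> \<mm>" using insert.prems Am by auto
    have "{y \<in> W (insert x F). x \<odot>\<^bsub>E\<^esub> y = \<zero>\<^bsub>E\<^esub>} = W F"
      using insert.hyps insert.prems by (auto simp: W_def)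
    then show ?case
      using insert torsion[OF xm] m.Icarr[OF xm]
      by (intro dcc_of_kernel[OF mE _ Wsub]) (auto simp: W_def)
  qed
  from this[OF A(2) subset_refl] show ?thesis by (simp add: W_def)
qed

text \<open>
  The quotient by the kernel embeds into \<open>E\<close>; its chains are compared with their images there.
\<close>

lemma dcc_artinian_quotient:
  assumes "module R M" "module R E" "f \<in> mhom R M E" "dcc_in R E (carrier E)"
  shows "artinian_module R (quot_module M {x \<in> carrier M. f x = \<zero>\<^bsub>E\<^esub>})"
proof -
  interpret M: module R M by fact
  interpret E: module R E by fact
  let ?U = "{x \<in> carrier M. f x = \<zero>\<^bsub>E\<^esub>}"
  let ?Q = "quot_module M ?U"
  have sU: "submodule ?U R M" by (rule submodule_kernel[OF assms(1-3)])
  note q = module_quot[OF assms(1) sU]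
  show ?thesis
    unfolding artinian_module_def
  proof (intro conjI allI impI)
    show "module R ?Q" by (rule q(1))
    fix V :: "nat \<Rightarrow> _" assume "(\<forall>n. submodule (V n) R ?Q) \<and> (\<forall>n. V (Suc n) \<subseteq> V n)"
    then have V: "submodule (V n) R ?Q" "V (Suc n) \<subseteq> V n" for n by auto
    define P where "P n = {x \<in> carrier M. ?U +>\<^bsub>M\<^esub> x \<in> V n}" for n
    have P: "submodule (P n) R M" for n
      unfolding P_def by (rule submodule_vimage[OF assms(1) q(1,2) V(1)])
    have "submodule (f ` P n) R E" for n by (rule submodule_image[OF assms(1-3) P])
    moreover have "f ` P n \<subseteq> carrier E" for n using mhomD(1)[OF assms(3)] by (auto simp: P_def)
    moreover have "f ` P (Suc n) \<subseteq> f ` P n" for n using V(2) by (auto simp: P_def)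
    ultimately obtain k where k: "\<And>n. n \<ge> k \<Longrightarrow> f ` P n = f ` P k"
      using dcc_inE[OF assms(4), of "\<lambda>n. f ` P n"] by blast
    have "V n = V k" if n: "n \<ge> k" for n
    proof
      show "V n \<subseteq> V k" by (rule lift_Suc_antimono_le[of V, OF V(2) n])
      show "V k \<subseteq> V n"
      proof
        fix C assume C: "C \<in> V k"
        then obtain x where x: "x \<in> carrier M" "C = ?U +>\<^bsub>M\<^esub> x"
          using submoduleD(1)[OF q(1) V(1)] q(3) by blast
        then have "f x \<in> f ` P n" using C k[OF n] by (auto simp: P_def)
        then obtain y where y: "y \<in> P n" "f x = f y" by blast
        have yM: "y \<in> carrier M" using y by (simp add: P_def)
        have "f (x \<ominus>\<^bsub>M\<^esub> y) = \<zero>\<^bsub>E\<^esub>"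
          using mhom_minus[OF assms(1-3) x(1) yM] y(2) mhomD(1)[OF assms(3) yM]
          by (simp add: a_minus_def E.r_neg)
        then have "?U +>\<^bsub>M\<^esub> (x \<ominus>\<^bsub>M\<^esub> y) = \<zero>\<^bsub>?Q\<^esub>" using q(4)[of "x \<ominus>\<^bsub>M\<^esub> y"] x(1) yM by simp
        then have z: "C \<ominus>\<^bsub>?Q\<^esub> (?U +>\<^bsub>M\<^esub> y) = \<zero>\<^bsub>?Q\<^esub>"
          using mhom_minus[OF assms(1) q(1,2) x(1) yM] x(2) by simp
        interpret Q: module R ?Q by (rule q(1))
        have "C \<in> carrier ?Q" "?U +>\<^bsub>M\<^esub> y \<in> carrier ?Q"
          using mhomD(1)[OF q(2)] x yM by auto
        then have "C = ?U +>\<^bsub>M\<^esub> y" using z by (rule Q.eq_if_minus_zero)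
        then show "C \<in> V n" using y(1) by (simp add: P_def)
      qed
    qed
    then show "\<exists>k. \<forall>n\<ge>k. V n = V k" by blast
  qed
qed

text \<open>
  Among the nonzero \<open>g : M \<rightarrow> E\<close> killed by \<open>J\<close> choose one whose annihilator \<open>\<pp>\<close> is maximal. If
  \<open>a b \<in> \<pp>\<close> and \<open>b \<notin> \<pp>\<close>, then \<open>b g\<close> is again such a map, and its annihilator contains \<open>\<pp>\<close> and \<open>a\<close>;
  hence \<open>a \<in> \<pp>\<close>. Since \<open>M\<close> modulo the kernel of \<open>g\<close> is artinian, \<open>\<pp>\<close> is coassociated.
\<close>

theorem Koass_above_annihilator:
  assumes "noetherian_ring R" "module R M" "module R E" "dcc_in R E (carrier E)"
    and "f \<in> mhom R M E" "\<exists>x\<in>carrier M. f x \<noteq> \<zero>\<^bsub>E\<^esub>"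
    and "J \<subseteq> carrier R" "\<And>a x. a \<in> J \<Longrightarrow> x \<in> carrier M \<Longrightarrow> a \<odot>\<^bsub>E\<^esub> f x = \<zero>\<^bsub>E\<^esub>"
  obtains \<pp> where "\<pp> \<in> Koass R M" "J \<subseteq> \<pp>"
proof -
  interpret M: module R M by fact
  interpret E: module R E by fact
  have cr: "cring R" by (rule M.R.is_cring)
  define ann where "ann g = {r \<in> carrier R. \<forall>x\<in>carrier M. r \<odot>\<^bsub>E\<^esub> g x = \<zero>\<^bsub>E\<^esub>}" for g
  define \<F> where "\<F> = {g \<in> mhom R M E. (\<exists>x\<in>carrier M. g x \<noteq> \<zero>\<^bsub>E\<^esub>) \<and> J \<subseteq> ann g}"
  have ideal: "ideal (ann g) R" if g: "g \<in> mhom R M E" for g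
  proof -
    have "submodule (ann g) R (self_module R)"
      using mhomD(1)[OF g]
      by (intro submoduleI'[OF module_self[OF cr]])
        (auto simp: ann_def E.smult_l_distr E.smult_assoc1)
    then show ?thesis using ideal_iff_submodule[OF cr] by blast
  qed
  have "f \<in> \<F>" using assms(5-8) by (auto simp: \<F>_def ann_def)
  obtain \<pp> where \<pp>: "\<pp> \<in> ann ` \<F>" and max: "\<And>A. A \<in> ann ` \<F> \<Longrightarrow> \<pp> \<subseteq> A \<Longrightarrow> A = \<pp>"
  proof (rule noetherian_maximal_ideal_in_family[OF assms(1), of "ann ` \<F>"])
    show "ann ` \<F> \<noteq> {}" using \<open>f \<in> \<F>\<close> by blast
    show "ideal A R" if "A \<in> ann ` \<F>" for A using that ideal by (auto simp: \<F>_def)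
  qed (rule that)
  then obtain g where g: "g \<in> mhom R M E" "\<exists>x\<in>carrier M. g x \<noteq> \<zero>\<^bsub>E\<^esub>" "J \<subseteq> ann g" "\<pp> = ann g"
    by (auto simp: \<F>_def)
  have gE: "g x \<in> carrier E" if "x \<in> carrier M" for x using mhomD(1)[OF g(1) that] .
  have "primeideal \<pp> R"
  proof (rule primeidealI)
    show "ideal \<pp> R" using ideal g by simp
    show "cring R" by (rule cr)
    have "\<one>\<^bsub>R\<^esub> \<notin> \<pp>" using g(2,4) gE by (auto simp: ann_def)
    then show "carrier R \<noteq> \<pp>" by auto
    fix a b assume ab: "a \<in> carrier R" "b \<in> carrier R" "a \<otimes>\<^bsub>R\<^esub> b \<in> \<pp>"
    show "a \<in> \<pp> \<or> b \<in> \<pp>"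
    proof (rule disjCI)
      assume b: "b \<notin> \<pp>"
      define h where "h x = b \<odot>\<^bsub>E\<^esub> g x" for x
      have h: "h \<in> mhom R M E"
        using ab(2) mhomD[OF g(1)]
        by (intro mhomI) (auto simp: h_def E.smult_r_distr M.R.m_comm simp flip: E.smult_assoc1)
      have sub: "ann g \<subseteq> ann h"
      proof
        fix r assume r: "r \<in> ann g"
        then have "r \<odot>\<^bsub>E\<^esub> (b \<odot>\<^bsub>E\<^esub> g x) = \<zero>\<^bsub>E\<^esub>" if "x \<in> carrier M" for x
          using ab(2) gE[OF that] that M.R.m_comm[of r b] E.smult_assoc1[of b r "g x"]
            E.smult_assoc1[of r b "g x"] by (simp add: ann_def)
        then show "r \<in> ann h" using r by (auto simp: ann_def h_def)
      qed
      have "h \<in> \<F>" using h b ab(2) g(3,4) sub by (auto simp: \<F>_def h_def ann_def)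
      then have "ann h = \<pp>" using max sub g(4) by blast
      moreover have "a \<in> ann h" using ab g(4) gE by (auto simp: ann_def h_def E.smult_assoc1)
      ultimately show "a \<in> \<pp>" by simp
    qed
  qed
  moreover have "annihilator R (quot_module M {x \<in> carrier M. g x = \<zero>\<^bsub>E\<^esub>}) = \<pp>"
  proof -
    let ?U = "{x \<in> carrier M. g x = \<zero>\<^bsub>E\<^esub>}"
    note q = module_quot[OF assms(2) submodule_kernel[OF assms(2,3) g(1)]]
    have "r \<odot>\<^bsub>quot_module M ?U\<^esub> (?U +>\<^bsub>M\<^esub> x) = \<zero>\<^bsub>quot_module M ?U\<^esub> \<longleftrightarrow> r \<odot>\<^bsub>E\<^esub> g x = \<zero>\<^bsub>E\<^esub>"
      if "r \<in> carrier R" "x \<in> carrier M" for r x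
      using that q(4)[of "r \<odot>\<^bsub>M\<^esub> x"] mhomD(3)[OF q(2) that] mhomD(3)[OF g(1) that] by auto
    then show ?thesis unfolding annihilator_def g(4) ann_def q(3) by auto
  qed
  ultimately have "\<pp> \<in> Koass R M"
    unfolding Koass_def
    using submodule_kernel[OF assms(2,3) g(1)] dcc_artinian_quotient[OF assms(2,3) g(1) assms(4)]
    by blast
  then show ?thesis using that g(3,4) by blast
qed

section \<open>Localization at a prime ideal\<close>

text \<open>
  Sums and products of fractions are unions over all pairs of representatives; once every pair
  yields the same class, this class is the union.
\<close>

lemma UN_pairs_const:
  assumes "p \<in> C" "q \<in> D" "\<And>a s b t. (a, s) \<in> C \<Longrightarrow> (b, t) \<in> D \<Longrightarrow> h a s b t = c"
  shows "(\<Union>(a, s)\<in>C. \<Union>(b, t)\<in>D. h a s b t) = c"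
proof -
  have "(\<Union>(b, t)\<in>D. h a s b t) = c" if "(a, s) \<in> C" for a s
    using assms that by (intro SUP_eq_const) auto
  note inner = this
  show ?thesis
  proof (rule SUP_eq_const)
    show "C \<noteq> {}" using assms(1) by blast
    fix i assume "i \<in> C"
    then show "(case i of (a, s) \<Rightarrow> \<Union>(b, t)\<in>D. h a s b t) = c" using inner by (cases i) simp
  qed
qed

context
  fixes R :: "('r, 'x) ring_scheme" (structure) and \<pp> :: "'r set"
  assumes prime: "primeideal \<pp> R"
begin

interpretation primeideal \<pp> R by (rule prime)

lemma outside_mult: "s \<in> carrier R - \<pp> \<Longrightarrow> t \<in> carrier R - \<pp> \<Longrightarrow> s \<otimes> t \<in> carrier R - \<pp>"
  using I_prime by auto

lemma outside_one: "\<one> \<in> carrier R - \<pp>"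
  using I_notcarr one_imp_carrier by auto

lemma fraction_eq_iff:
  assumes "a \<in> carrier R" "s \<in> carrier R - \<pp>" "b \<in> carrier R" "t \<in> carrier R - \<pp>"
  shows "fraction R \<pp> a s = fraction R \<pp> b t \<longleftrightarrow>
    (\<exists>u\<in>carrier R - \<pp>. u \<otimes> (t \<otimes> a) = u \<otimes> (s \<otimes> b))"
proof
  assume "fraction R \<pp> a s = fraction R \<pp> b t"
  moreover have "(b, t) \<in> fraction R \<pp> b t"
    using assms outside_one by (auto simp: fraction_def intro!: bexI[of _ \<one>])
  ultimately have "(b, t) \<in> fraction R \<pp> a s" by simp
  then show "\<exists>u\<in>carrier R - \<pp>. u \<otimes> (t \<otimes> a) = u \<otimes> (s \<otimes> b)" by (auto simp: fraction_def)
next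
  have sub: "fraction R \<pp> a s \<subseteq> fraction R \<pp> b t"
    if *: "a \<in> carrier R" "s \<in> carrier R - \<pp>" "b \<in> carrier R" "t \<in> carrier R - \<pp>"
      "u \<in> carrier R - \<pp>" "u \<otimes> (t \<otimes> a) = u \<otimes> (s \<otimes> b)" for a s b t u
  proof clarify
    fix c v assume "(c, v) \<in> fraction R \<pp> a s"
    then obtain w where cv: "c \<in> carrier R" "v \<in> carrier R - \<pp>" "w \<in> carrier R - \<pp>"
      "w \<otimes> (v \<otimes> a) = w \<otimes> (s \<otimes> c)" by (auto simp: fraction_def)
    let ?u = "(u \<otimes> w) \<otimes> s"
    have "?u \<otimes> (v \<otimes> b) = (w \<otimes> v) \<otimes> (u \<otimes> (s \<otimes> b))"
      using *(1-5) cv(1-3) by (simp add: m_ac)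
    also have "\<dots> = (u \<otimes> t) \<otimes> (w \<otimes> (v \<otimes> a))"
      unfolding *(6)[symmetric] using *(1-5) cv(1-3) by (simp add: m_ac)
    also have "\<dots> = ?u \<otimes> (t \<otimes> c)"
      unfolding cv(4) using *(1-5) cv(1-3) by (simp add: m_ac)
    finally have "?u \<otimes> (v \<otimes> b) = ?u \<otimes> (t \<otimes> c)" .
    moreover have "?u \<in> carrier R - \<pp>" using * cv by (intro outside_mult)
    ultimately show "(c, v) \<in> fraction R \<pp> b t" using cv by (auto simp: fraction_def)
  qed
  assume "\<exists>u\<in>carrier R - \<pp>. u \<otimes> (t \<otimes> a) = u \<otimes> (s \<otimes> b)"
  then obtain u where u: "u \<in> carrier R - \<pp>" "u \<otimes> (t \<otimes> a) = u \<otimes> (s \<otimes> b)" by blast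
  show "fraction R \<pp> a s = fraction R \<pp> b t"
    using sub[OF assms u] sub[OF assms(3,4,1,2) u(1) u(2)[symmetric]] by blast
qed

lemma fraction_eqI:
  assumes "a \<in> carrier R" "s \<in> carrier R - \<pp>" "b \<in> carrier R" "t \<in> carrier R - \<pp>" "t \<otimes> a = s \<otimes> b"
  shows "fraction R \<pp> a s = fraction R \<pp> b t"
  using fraction_eq_iff[OF assms(1-4)] assms(5) outside_one by metis

lemma mem_fraction:
  assumes "a \<in> carrier R" "s \<in> carrier R - \<pp>" "(b, t) \<in> fraction R \<pp> a s"
  shows "b \<in> carrier R" "t \<in> carrier R - \<pp>" "fraction R \<pp> b t = fraction R \<pp> a s"
proof -
  show b: "b \<in> carrier R" and t: "t \<in> carrier R - \<pp>" using assms(3) by (auto simp: fraction_def)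
  show "fraction R \<pp> b t = fraction R \<pp> a s"
    using fraction_eq_iff[OF assms(1,2) b t] assms(3) by (auto simp: fraction_def)
qed

lemma self_mem_fraction:
  "a \<in> carrier R \<Longrightarrow> s \<in> carrier R - \<pp> \<Longrightarrow> (a, s) \<in> fraction R \<pp> a s"
  using outside_one by (auto simp: fraction_def intro!: bexI[of _ \<one>])

lemma fraction_mult:
  assumes "a \<in> carrier R" "s \<in> carrier R - \<pp>" "b \<in> carrier R" "t \<in> carrier R - \<pp>"
  shows "fraction R \<pp> a s \<otimes>\<^bsub>localization R \<pp>\<^esub> fraction R \<pp> b t = fraction R \<pp> (a \<otimes> b) (s \<otimes> t)"
proof -
  have "fraction R \<pp> (a' \<otimes> b') (s' \<otimes> t') = fraction R \<pp> (a \<otimes> b) (s \<otimes> t)"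
    if "(a', s') \<in> fraction R \<pp> a s" "(b', t') \<in> fraction R \<pp> b t" for a' s' b' t'
  proof -
    note 1 = mem_fraction[OF assms(1,2) that(1)] and 2 = mem_fraction[OF assms(3,4) that(2)]
    obtain u where u: "u \<in> carrier R - \<pp>" "u \<otimes> (s \<otimes> a') = u \<otimes> (s' \<otimes> a)"
      using fraction_eq_iff[OF 1(1,2) assms(1,2)] 1(3) by auto
    obtain v where v: "v \<in> carrier R - \<pp>" "v \<otimes> (t \<otimes> b') = v \<otimes> (t' \<otimes> b)"
      using fraction_eq_iff[OF 2(1,2) assms(3,4)] 2(3) by auto
    have "(u \<otimes> v) \<otimes> ((s \<otimes> t) \<otimes> (a' \<otimes> b')) = (u \<otimes> (s \<otimes> a')) \<otimes> (v \<otimes> (t \<otimes> b'))"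
      using u(1) v(1) 1(1,2) 2(1,2) assms by (simp add: m_ac)
    also have "\<dots> = (u \<otimes> v) \<otimes> ((s' \<otimes> t') \<otimes> (a \<otimes> b))"
      unfolding u(2) v(2) using u(1) v(1) 1(1,2) 2(1,2) assms by (simp add: m_ac)
    finally show ?thesis
      using fraction_eq_iff[of "a' \<otimes> b'" "s' \<otimes> t'" "a \<otimes> b" "s \<otimes> t"] outside_mult u(1) v(1) 1(1,2) 2(1,2) assms
      by blast
  qed
  from UN_pairs_const[OF self_mem_fraction[OF assms(1,2)] self_mem_fraction[OF assms(3,4)] this]
  show ?thesis by (simp add: localization_def)
qed

lemma fraction_add:
  assumes "a \<in> carrier R" "s \<in> carrier R - \<pp>" "b \<in> carrier R" "t \<in> carrier R - \<pp>"
  shows "fraction R \<pp> a s \<oplus>\<^bsub>localization R \<pp>\<^esub> fraction R \<pp> b t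
    = fraction R \<pp> ((a \<otimes> t) \<oplus> (b \<otimes> s)) (s \<otimes> t)"
proof -
  have "fraction R \<pp> ((a' \<otimes> t') \<oplus> (b' \<otimes> s')) (s' \<otimes> t') = fraction R \<pp> ((a \<otimes> t) \<oplus> (b \<otimes> s)) (s \<otimes> t)"
    if "(a', s') \<in> fraction R \<pp> a s" "(b', t') \<in> fraction R \<pp> b t" for a' s' b' t'
  proof -
    note 1 = mem_fraction[OF assms(1,2) that(1)] and 2 = mem_fraction[OF assms(3,4) that(2)]
    obtain u where u: "u \<in> carrier R - \<pp>" "u \<otimes> (s \<otimes> a') = u \<otimes> (s' \<otimes> a)"
      using fraction_eq_iff[OF 1(1,2) assms(1,2)] 1(3) by auto
    obtain v where v: "v \<in> carrier R - \<pp>" "v \<otimes> (t \<otimes> b') = v \<otimes> (t' \<otimes> b)"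
      using fraction_eq_iff[OF 2(1,2) assms(3,4)] 2(3) by auto
    note c = u(1) v(1) 1(1,2) 2(1,2) assms
    have "(u \<otimes> v) \<otimes> ((s \<otimes> t) \<otimes> ((a' \<otimes> t') \<oplus> (b' \<otimes> s')))
        = (u \<otimes> (s \<otimes> a')) \<otimes> (v \<otimes> (t \<otimes> t')) \<oplus> (v \<otimes> (t \<otimes> b')) \<otimes> (u \<otimes> (s \<otimes> s'))"
      using c by (simp add: r_distr m_ac)
    also have "\<dots> = (u \<otimes> v) \<otimes> ((s' \<otimes> t') \<otimes> ((a \<otimes> t) \<oplus> (b \<otimes> s)))"
      unfolding u(2) v(2) using c by (simp add: r_distr m_ac)
    finally show ?thesis
      using fraction_eq_iff[of "(a' \<otimes> t') \<oplus> (b' \<otimes> s')" "s' \<otimes> t'" "(a \<otimes> t) \<oplus> (b \<otimes> s)" "s \<otimes> t"]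
        outside_mult c by blast
  qed
  from UN_pairs_const[OF self_mem_fraction[OF assms(1,2)] self_mem_fraction[OF assms(3,4)] this]
  show ?thesis by (simp add: localization_def)
qed

lemma localization_zero_one:
  "\<zero>\<^bsub>localization R \<pp>\<^esub> = fraction R \<pp> \<zero> \<one>" "\<one>\<^bsub>localization R \<pp>\<^esub> = fraction R \<pp> \<one> \<one>"
  by (simp_all add: localization_def)

lemma localization_carrier:
  "carrier (localization R \<pp>) = {fraction R \<pp> a s | a s. a \<in> carrier R \<and> s \<in> carrier R - \<pp>}"
  by (simp add: localization_def)

lemma fraction_closed:
  "a \<in> carrier R \<Longrightarrow> s \<in> carrier R - \<pp> \<Longrightarrow> fraction R \<pp> a s \<in> carrier (localization R \<pp>)"
  by (auto simp: localization_carrier)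

lemma localizationE:
  assumes "z \<in> carrier (localization R \<pp>)"
  obtains a s where "z = fraction R \<pp> a s" "a \<in> carrier R" "s \<in> carrier R - \<pp>"
  using assms by (auto simp: localization_carrier)

lemma localization_cring: "cring (localization R \<pp>)"
proof -
  let ?L = "localization R \<pp>"
  show ?thesis
  proof (rule cringI)
    show "abelian_group ?L"
    proof (rule abelian_groupI)
      show "\<zero>\<^bsub>?L\<^esub> \<in> carrier ?L" unfolding localization_zero_one by (intro fraction_closed outside_one) simp
      fix x assume "x \<in> carrier ?L"
      then obtain a s where x: "x = fraction R \<pp> a s" "a \<in> carrier R" "s \<in> carrier R - \<pp>" by (rule localizationE)
      show "\<zero>\<^bsub>?L\<^esub> \<oplus>\<^bsub>?L\<^esub> x = x"
        unfolding x(1) localization_zero_one fraction_add[OF zero_closed outside_one x(2,3)]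
        using x(2,3) by simp
      have "fraction R \<pp> (\<ominus> a) s \<oplus>\<^bsub>?L\<^esub> x = \<zero>\<^bsub>?L\<^esub>"
        unfolding x(1) localization_zero_one fraction_add[OF a_inv_closed[OF x(2)] x(3) x(2,3)]
        using x(2,3) by (intro fraction_eqI outside_mult outside_one) (simp_all add: l_minus l_neg)
      then show "\<exists>y\<in>carrier ?L. y \<oplus>\<^bsub>?L\<^esub> x = \<zero>\<^bsub>?L\<^esub>"
        using fraction_closed[of "\<ominus> a" s] x by auto
      fix y assume "y \<in> carrier ?L"
      then obtain b t where y: "y = fraction R \<pp> b t" "b \<in> carrier R" "t \<in> carrier R - \<pp>" by (rule localizationE)
      note c = x(2,3) y(2,3)
      show "x \<oplus>\<^bsub>?L\<^esub> y \<in> carrier ?L"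
        unfolding x(1) y(1) fraction_add[OF c] using c by (intro fraction_closed outside_mult) auto
      show "x \<oplus>\<^bsub>?L\<^esub> y = y \<oplus>\<^bsub>?L\<^esub> x"
        unfolding x(1) y(1) fraction_add[OF c] fraction_add[OF c(3,4,1,2)]
        using c by (intro fraction_eqI outside_mult) (simp_all add: m_ac a_ac)
      fix z assume "z \<in> carrier ?L"
      then obtain d v where z: "z = fraction R \<pp> d v" "d \<in> carrier R" "v \<in> carrier R - \<pp>" by (rule localizationE)
      have st: "s \<otimes> t \<in> carrier R - \<pp>" "t \<otimes> v \<in> carrier R - \<pp>"
        using c z by (intro outside_mult; simp)+
      have ab: "a \<otimes> t \<oplus> b \<otimes> s \<in> carrier R" "b \<otimes> v \<oplus> d \<otimes> t \<in> carrier R" using c z by auto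
      show "x \<oplus>\<^bsub>?L\<^esub> y \<oplus>\<^bsub>?L\<^esub> z = x \<oplus>\<^bsub>?L\<^esub> (y \<oplus>\<^bsub>?L\<^esub> z)"
        unfolding x(1) y(1) z(1) fraction_add[OF c] fraction_add[OF c(3,4) z(2,3)]
          fraction_add[OF ab(1) st(1) z(2,3)] fraction_add[OF c(1,2) ab(2) st(2)]
        using c z(2,3) by (intro fraction_eqI outside_mult) (simp_all add: l_distr r_distr m_ac a_ac)
    qed
    show "Group.comm_monoid ?L"
    proof (rule comm_monoidI)
      show "\<one>\<^bsub>?L\<^esub> \<in> carrier ?L" unfolding localization_zero_one by (intro fraction_closed outside_one) simp
      fix x assume "x \<in> carrier ?L"
      then obtain a s where x: "x = fraction R \<pp> a s" "a \<in> carrier R" "s \<in> carrier R - \<pp>" by (rule localizationE)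
      show "\<one>\<^bsub>?L\<^esub> \<otimes>\<^bsub>?L\<^esub> x = x"
        unfolding x(1) localization_zero_one fraction_mult[OF one_closed outside_one x(2,3)]
        using x(2,3) by simp
      fix y assume "y \<in> carrier ?L"
      then obtain b t where y: "y = fraction R \<pp> b t" "b \<in> carrier R" "t \<in> carrier R - \<pp>" by (rule localizationE)
      note c = x(2,3) y(2,3)
      show "x \<otimes>\<^bsub>?L\<^esub> y \<in> carrier ?L"
        unfolding x(1) y(1) fraction_mult[OF c] using c by (intro fraction_closed outside_mult) auto
      show "x \<otimes>\<^bsub>?L\<^esub> y = y \<otimes>\<^bsub>?L\<^esub> x"
        unfolding x(1) y(1) fraction_mult[OF c] fraction_mult[OF c(3,4,1,2)]
        using c by (simp add: m_ac)
      fix z assume "z \<in> carrier ?L"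
      then obtain d v where z: "z = fraction R \<pp> d v" "d \<in> carrier R" "v \<in> carrier R - \<pp>" by (rule localizationE)
      have st: "s \<otimes> t \<in> carrier R - \<pp>" "t \<otimes> v \<in> carrier R - \<pp>"
        using c z by (intro outside_mult; simp)+
      have ab: "a \<otimes> b \<in> carrier R" "b \<otimes> d \<in> carrier R" using c z by auto
      show "x \<otimes>\<^bsub>?L\<^esub> y \<otimes>\<^bsub>?L\<^esub> z = x \<otimes>\<^bsub>?L\<^esub> (y \<otimes>\<^bsub>?L\<^esub> z)"
        unfolding x(1) y(1) z(1) fraction_mult[OF c] fraction_mult[OF c(3,4) z(2,3)]
          fraction_mult[OF ab(1) st(1) z(2,3)] fraction_mult[OF c(1,2) ab(2) st(2)]
        using c z(2,3) by (simp add: m_ac)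
    qed
    fix x y z assume "x \<in> carrier ?L" "y \<in> carrier ?L" "z \<in> carrier ?L"
    then obtain a s b t d v where x: "x = fraction R \<pp> a s" and y: "y = fraction R \<pp> b t"
      and z: "z = fraction R \<pp> d v"
      and c: "a \<in> carrier R" "s \<in> carrier R - \<pp>" "b \<in> carrier R" "t \<in> carrier R - \<pp>"
        "d \<in> carrier R" "v \<in> carrier R - \<pp>"
      by (metis localizationE)
    have st: "s \<otimes> t \<in> carrier R - \<pp>" "s \<otimes> v \<in> carrier R - \<pp>" "t \<otimes> v \<in> carrier R - \<pp>"
      using c by (intro outside_mult; simp)+
    have ab: "a \<otimes> t \<oplus> b \<otimes> s \<in> carrier R" "a \<otimes> d \<in> carrier R" "b \<otimes> d \<in> carrier R" using c by auto
    show "(x \<oplus>\<^bsub>?L\<^esub> y) \<otimes>\<^bsub>?L\<^esub> z = x \<otimes>\<^bsub>?L\<^esub> z \<oplus>\<^bsub>?L\<^esub> y \<otimes>\<^bsub>?L\<^esub> z"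
      unfolding x y z fraction_add[OF c(1-4)] fraction_mult[OF c(1,2,5,6)] fraction_mult[OF c(3,4,5,6)]
        fraction_mult[OF ab(1) st(1) c(5,6)] fraction_add[OF ab(2) st(2) ab(3) st(3)]
      using c by (intro fraction_eqI outside_mult) (simp_all add: l_distr r_distr m_ac a_ac)
  qed
qed

lemma localized_ideal_eq:
  assumes "ideal I R"
  shows "localized_ideal R \<pp> I = {fraction R \<pp> a s | a s. a \<in> I \<and> s \<in> carrier R - \<pp>}" (is "_ = ?J")
proof
  let ?L = "localization R \<pp>"
  interpret I: ideal I R by fact
  interpret L: cring ?L by (rule localization_cring)
  have IR: "a \<in> carrier R" if "a \<in> I" for a using I.Icarr[OF that] .
  have gen: "(\<lambda>a. fraction R \<pp> a \<one>) ` I \<subseteq> carrier ?L" using IR outside_one by (auto intro!: fraction_closed)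
  have "submodule ?J ?L (self_module ?L)"
  proof (rule submoduleI'[OF module_self[OF localization_cring]])
    show "?J \<subseteq> carrier (self_module ?L)" using IR by (auto intro!: fraction_closed)
    show "\<zero>\<^bsub>self_module ?L\<^esub> \<in> ?J" 
      unfolding ideal_module_simps localization_zero_one using I.zero_closed outside_one by blast
    fix x assume "x \<in> ?J"
    then obtain a s where x: "x = fraction R \<pp> a s" "a \<in> I" "s \<in> carrier R - \<pp>" by blast
    show "z \<odot>\<^bsub>self_module ?L\<^esub> x \<in> ?J" if z: "z \<in> carrier ?L" for z
    proof -
      obtain b t where b: "z = fraction R \<pp> b t" "b \<in> carrier R" "t \<in> carrier R - \<pp>"
        using z by (rule localizationE)
      have "z \<odot>\<^bsub>self_module ?L\<^esub> x = fraction R \<pp> (b \<otimes> a) (t \<otimes> s)"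
        using fraction_mult[OF b(2,3) IR[OF x(2)] x(3)] b x by simp
      then show ?thesis using outside_mult[OF b(3) x(3)] I.I_l_closed[OF x(2) b(2)] by blast
    qed
    fix y assume "y \<in> ?J"
    then obtain b t where y: "y = fraction R \<pp> b t" "b \<in> I" "t \<in> carrier R - \<pp>" by blast
    have "x \<oplus>\<^bsub>self_module ?L\<^esub> y = fraction R \<pp> (a \<otimes> t \<oplus> b \<otimes> s) (s \<otimes> t)"
      using fraction_add[OF IR[OF x(2)] x(3) IR[OF y(2)] y(3)] x y by simp
    moreover have "a \<otimes> t \<oplus> b \<otimes> s \<in> I" using x y by (auto intro!: I.a_closed I.I_r_closed)
    ultimately show "x \<oplus>\<^bsub>self_module ?L\<^esub> y \<in> ?J" using outside_mult[OF x(3) y(3)] by blast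
  qed
  then have "ideal ?J ?L" using ideal_iff_submodule[OF localization_cring] by blast
  then show "localized_ideal R \<pp> I \<subseteq> ?J"
    unfolding localized_ideal_def using outside_one by (intro L.genideal_minimal) blast+
  interpret G: ideal "localized_ideal R \<pp> I" ?L
    unfolding localized_ideal_def by (rule L.genideal_ideal[OF gen])
  show "?J \<subseteq> localized_ideal R \<pp> I"
  proof
    fix x assume "x \<in> ?J"
    then obtain a s where x: "x = fraction R \<pp> a s" "a \<in> I" "s \<in> carrier R - \<pp>" by blast
    have "fraction R \<pp> a \<one> \<in> localized_ideal R \<pp> I"
      unfolding localized_ideal_def using L.genideal_self[OF gen] x(2) by blast
    moreover have "fraction R \<pp> \<one> s \<in> carrier ?L" using x(3) by (intro fraction_closed) auto
    ultimately have "fraction R \<pp> \<one> s \<otimes>\<^bsub>?L\<^esub> fraction R \<pp> a \<one> \<in> localized_ideal R \<pp> I" by (rule G.I_l_closed)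
    then show "x \<in> localized_ideal R \<pp> I"
      using fraction_mult[OF one_closed x(3) IR[OF x(2)] outside_one] IR[OF x(2)] x by simp
  qed
qed

text \<open>
  The localization \<open>b/s \<mapsto> g(b)/s\<close> of \<open>g\<close> is an isomorphism. It is surjective since \<open>g(a)\<close> is a unit of
  \<open>R\<^sub>\<pp>\<close>. It is injective by \<open>g(a) b = g(b) a\<close>, which follows from evaluating \<open>g\<close> at \<open>a b\<close> in two ways.
\<close>

lemma localized_ideal_free_if_trace:
  assumes "ideal I R" "g \<in> mhom R (ideal_module R I) (self_module R)" "a \<in> I" "g a \<notin> \<pp>"
  shows "mod_iso (localization R \<pp>) (ideal_module (localization R \<pp>) (localized_ideal R \<pp> I))
    (self_module (localization R \<pp>))"
proof -
  let ?L = "localization R \<pp>" and ?J = "localized_ideal R \<pp> I"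
  interpret I: ideal I R by fact
  have IR: "b \<in> carrier R" if "b \<in> I" for b using I.Icarr[OF that] .
  have gR: "g b \<in> carrier R" if "b \<in> I" for b using mhomD(1)[OF assms(2), of b] that by simp
  have gm: "g (r \<otimes> b) = r \<otimes> g b" if "r \<in> carrier R" "b \<in> I" for r b
    using mhomD(3)[OF assms(2), of r b] that by simp
  have ga: "g (b \<oplus> c) = g b \<oplus> g c" if "b \<in> I" "c \<in> I" for b c
    using mhomD(2)[OF assms(2), of b c] that by simp
  have swap: "g a \<otimes> b = g b \<otimes> a" if "b \<in> I" for b
    using gm[of a b] gm[of b a] that assms(3) IR gR m_comm by (metis m_comm)
  have s: "g a \<in> carrier R - \<pp>" using gR assms(3,4) by auto
  define F where "F z = (THE w. \<forall>b s. b \<in> I \<longrightarrow> s \<in> carrier R - \<pp> \<longrightarrow> z = fraction R \<pp> b s \<longrightarrow>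
    w = fraction R \<pp> (g b) s)" for z
  have wd: "fraction R \<pp> (g b) s = fraction R \<pp> (g c) t"
    if that: "b \<in> I" "s \<in> carrier R - \<pp>" "c \<in> I" "t \<in> carrier R - \<pp>"
      "fraction R \<pp> b s = fraction R \<pp> c t"
    for b s c t
  proof -
    from that(5) have "\<exists>u\<in>carrier R - \<pp>. u \<otimes> (t \<otimes> b) = u \<otimes> (s \<otimes> c)"
      using fraction_eq_iff[OF IR[OF that(1)] that(2) IR[OF that(3)] that(4)] by blast
    then obtain u where u: "u \<in> carrier R - \<pp>" "u \<otimes> (t \<otimes> b) = u \<otimes> (s \<otimes> c)" by blast
    have "g (u \<otimes> (t \<otimes> b)) = u \<otimes> (t \<otimes> g b)" "g (u \<otimes> (s \<otimes> c)) = u \<otimes> (s \<otimes> g c)"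
      using u(1) that by (simp_all add: gm I.I_l_closed)
    then have "u \<otimes> (t \<otimes> g b) = u \<otimes> (s \<otimes> g c)" using u(2) by simp
    then show ?thesis using u(1) fraction_eq_iff[OF gR[OF that(1)] that(2) gR[OF that(3)] that(4)] by blast
  qed
  have F: "F (fraction R \<pp> b s) = fraction R \<pp> (g b) s" if "b \<in> I" "s \<in> carrier R - \<pp>" for b s
    unfolding F_def using wd that by (intro the_equality) blast+
  note J = localized_ideal_eq[OF assms(1)]
  have "F \<in> mhom ?L (ideal_module ?L ?J) (self_module ?L)"
  proof (rule mhomI; simp)
    fix x assume "x \<in> ?J"
    then obtain b s where x: "x = fraction R \<pp> b s" "b \<in> I" "s \<in> carrier R - \<pp>" unfolding J by blast
    show "F x \<in> carrier ?L" using x F gR by (auto intro!: fraction_closed)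
    show "F (z \<otimes>\<^bsub>?L\<^esub> x) = z \<otimes>\<^bsub>?L\<^esub> F x" if z: "z \<in> carrier ?L" for z
    proof -
      obtain c t where c: "z = fraction R \<pp> c t" "c \<in> carrier R" "t \<in> carrier R - \<pp>"
        using z by (rule localizationE)
      show ?thesis
        unfolding c(1) x(1) fraction_mult[OF c(2,3) IR[OF x(2)] x(3)] F[OF x(2,3)]
          fraction_mult[OF c(2,3) gR[OF x(2)] x(3)]
          F[OF I.I_l_closed[OF x(2) c(2)] outside_mult[OF c(3) x(3)]] gm[OF c(2) x(2)] ..
    qed
    fix y assume "y \<in> ?J"
    then obtain c t where y: "y = fraction R \<pp> c t" "c \<in> I" "t \<in> carrier R - \<pp>" unfolding J by blast
    have i: "b \<otimes> t \<in> I" "c \<otimes> s \<in> I" using x y by (auto intro!: I.I_r_closed)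
    have "g (b \<otimes> t) = g b \<otimes> t" "g (c \<otimes> s) = g c \<otimes> s"
      using gm[of t b] gm[of s c] x y IR gR by (simp_all add: m_comm)
    then show "F (x \<oplus>\<^bsub>?L\<^esub> y) = F x \<oplus>\<^bsub>?L\<^esub> F y"
      unfolding x(1) y(1) fraction_add[OF IR[OF x(2)] x(3) IR[OF y(2)] y(3)] F[OF x(2,3)] F[OF y(2,3)]
        fraction_add[OF gR[OF x(2)] x(3) gR[OF y(2)] y(3)]
      using F[OF I.a_closed[OF i] outside_mult[OF x(3) y(3)]] ga[OF i] by simp
  qed
  moreover have "bij_betw F (carrier (ideal_module ?L ?J)) (carrier (self_module ?L))"
    unfolding bij_betw_def
  proof
    show "inj_on F (carrier (ideal_module ?L ?J))"
    proof (rule inj_onI)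
      fix x y assume "x \<in> carrier (ideal_module ?L ?J)" "y \<in> carrier (ideal_module ?L ?J)" "F x = F y"
      then obtain b s' c t where x: "x = fraction R \<pp> b s'" "b \<in> I" "s' \<in> carrier R - \<pp>"
        and y: "y = fraction R \<pp> c t" "c \<in> I" "t \<in> carrier R - \<pp>" and eq: "F x = F y"
        by (auto simp: J)
      obtain u where u: "u \<in> carrier R - \<pp>" "u \<otimes> (t \<otimes> g b) = u \<otimes> (s' \<otimes> g c)"
        using eq F[OF x(2,3)] F[OF y(2,3)] x(1) y(1)
          fraction_eq_iff[OF gR[OF x(2)] x(3) gR[OF y(2)] y(3)] by auto
      note c' = u(1) x(2,3) y(2,3) IR gR assms(3)
      have "(u \<otimes> g a) \<otimes> (t \<otimes> b) = (u \<otimes> t) \<otimes> (g a \<otimes> b)" using c' by (simp add: m_ac)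
      also have "\<dots> = (u \<otimes> (t \<otimes> g b)) \<otimes> a" unfolding swap[OF x(2)] using c' by (simp add: m_ac)
      also have "\<dots> = (u \<otimes> s') \<otimes> (g c \<otimes> a)" unfolding u(2) using c' by (simp add: m_ac)
      also have "\<dots> = (u \<otimes> g a) \<otimes> (s' \<otimes> c)" unfolding swap[OF y(2), symmetric] using c' by (simp add: m_ac)
      finally have "(u \<otimes> g a) \<otimes> (t \<otimes> b) = (u \<otimes> g a) \<otimes> (s' \<otimes> c)" .
      then show "x = y"
        using fraction_eq_iff[OF IR[OF x(2)] x(3) IR[OF y(2)] y(3)] outside_mult[OF u(1) s] x(1) y(1) by blast
    qed
    show "F ` carrier (ideal_module ?L ?J) = carrier (self_module ?L)"
    proof
      show "F ` carrier (ideal_module ?L ?J) \<subseteq> carrier (self_module ?L)"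
        using F gR by (auto simp: J intro!: fraction_closed)
      show "carrier (self_module ?L) \<subseteq> F ` carrier (ideal_module ?L ?J)"
      proof
        fix z assume "z \<in> carrier (self_module ?L)"
        then have "z \<in> carrier ?L" by simp
        then obtain c t where c: "z = fraction R \<pp> c t" "c \<in> carrier R" "t \<in> carrier R - \<pp>"
          by (rule localizationE)
        have "F (fraction R \<pp> (c \<otimes> a) (t \<otimes> g a)) = fraction R \<pp> (c \<otimes> g a) (t \<otimes> g a)"
          using F[OF I.I_l_closed[OF assms(3) c(2)] outside_mult[OF c(3) s]] gm[OF c(2) assms(3)] by simp
        also have "\<dots> = z"
          unfolding c(1) using c s by (intro fraction_eqI outside_mult) (auto simp: m_ac)
        finally show "z \<in> F ` carrier (ideal_module ?L ?J)"
          using I.I_l_closed[OF assms(3) c(2)] outside_mult[OF c(3) s] by (auto simp: J intro!: image_eqI)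
      qed
    qed
  qed
  ultimately show ?thesis unfolding mod_iso_def by blast
qed

text \<open>
  The preimage of \<open>1\<close> under the isomorphism is a generator \<open>a/s\<close> of \<open>I\<^sub>\<pp>\<close> with zero annihilator. Since
  \<open>I\<close> and the annihilator of \<open>a\<close> in \<open>R\<close> are finitely generated, single elements \<open>t, u \<notin> \<pp>\<close> achieve
  \<open>t I \<subseteq> R a\<close> and \<open>u r = 0\<close> for all \<open>r\<close> with \<open>r a = 0\<close>. Then \<open>g b = u r\<close>, where \<open>t b = r a\<close>, is well defined, and
  \<open>g a = u t \<notin> \<pp>\<close>.
\<close>

lemma trace_if_localized_ideal_free:
  assumes "noetherian_ring R" "ideal I R"
    and "mod_iso (localization R \<pp>) (ideal_module (localization R \<pp>) (localized_ideal R \<pp> I))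
      (self_module (localization R \<pp>))"
  obtains g a where "g \<in> mhom R (ideal_module R I) (self_module R)" "a \<in> I" "g a \<notin> \<pp>"
proof -
  let ?L = "localization R \<pp>" and ?J = "localized_ideal R \<pp> I"
  have cr: "cring R" by (rule is_cring)
  interpret I: ideal I R by fact
  interpret L: cring ?L by (rule localization_cring)
  note J = localized_ideal_eq[OF assms(2)]
  have IR: "b \<in> carrier R" if "b \<in> I" for b using I.Icarr[OF that] .
  have mS: "module R (self_module R)" by (rule module_self[OF cr])
  have idealI': "ideal K R" if "submodule K R (self_module R)" for K
    using that ideal_iff_submodule[OF cr] by blast
  obtain F where F: "F \<in> mhom ?L (ideal_module ?L ?J) (self_module ?L)" "bij_betw F ?J (carrier ?L)"
    using assms(3) unfolding mod_iso_def by auto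
  have Fm: "F (z \<otimes>\<^bsub>?L\<^esub> x) = z \<otimes>\<^bsub>?L\<^esub> F x" if "z \<in> carrier ?L" "x \<in> ?J" for z x
    using mhomD(3)[OF F(1), of z x] that by simp
  have "\<one>\<^bsub>?L\<^esub> \<in> F ` ?J" using F(2) by (simp add: bij_betw_def)
  then obtain y where y: "y \<in> ?J" "F y = \<one>\<^bsub>?L\<^esub>" by auto
  obtain a s where a: "y = fraction R \<pp> a s" "a \<in> I" "s \<in> carrier R - \<pp>" using y(1) unfolding J by blast
  have Jmult: "z \<otimes>\<^bsub>?L\<^esub> x \<in> ?J" if "z \<in> carrier ?L" "x \<in> ?J" for z x
  proof -
    have "ideal ?J ?L" unfolding localized_ideal_def
      by (rule L.genideal_ideal) (use IR outside_one in \<open>auto intro!: fraction_closed\<close>)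
    then show ?thesis using ideal.I_l_closed that by metis
  qed
  have multiple: "\<exists>t\<in>carrier R - \<pp>. \<exists>r\<in>carrier R. t \<otimes> b = r \<otimes> a" if b: "b \<in> I" for b
  proof -
    have bJ: "fraction R \<pp> b \<one> \<in> ?J" unfolding J using b outside_one by blast
    then have FL: "F (fraction R \<pp> b \<one>) \<in> carrier ?L" using mhomD(1)[OF F(1)] by simp
    then obtain c t where c: "F (fraction R \<pp> b \<one>) = fraction R \<pp> c t" "c \<in> carrier R" "t \<in> carrier R - \<pp>"
      by (rule localizationE)
    have "F (fraction R \<pp> c t \<otimes>\<^bsub>?L\<^esub> y) = F (fraction R \<pp> b \<one>)"
      using Fm[OF fraction_closed[OF c(2,3)] y(1)] y(2) c FL by simp
    then have "fraction R \<pp> c t \<otimes>\<^bsub>?L\<^esub> y = fraction R \<pp> b \<one>"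
      using inj_onD[OF bij_betw_imp_inj_on[OF F(2)]] Jmult[OF fraction_closed[OF c(2,3)] y(1)] bJ by blast
    then have "fraction R \<pp> (c \<otimes> a) (t \<otimes> s) = fraction R \<pp> b \<one>"
      using fraction_mult[OF c(2,3) IR[OF a(2)] a(3)] a(1) by simp
    then obtain u where u: "u \<in> carrier R - \<pp>" "u \<otimes> (\<one> \<otimes> (c \<otimes> a)) = u \<otimes> ((t \<otimes> s) \<otimes> b)"
      using fraction_eq_iff[of "c \<otimes> a" "t \<otimes> s" b \<one>] c a IR b outside_mult outside_one by auto
    show ?thesis
    proof (intro bexI)
      show "(u \<otimes> (t \<otimes> s)) \<otimes> b = (u \<otimes> c) \<otimes> a" using u c a IR b by (simp add: m_assoc)
      show "u \<otimes> c \<in> carrier R" using u c by simp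
      show "u \<otimes> (t \<otimes> s) \<in> carrier R - \<pp>" using u c a by (intro outside_mult)
    qed
  qed
  have regular: "\<exists>u\<in>carrier R - \<pp>. u \<otimes> r = \<zero>" if r: "r \<in> carrier R" "r \<otimes> a = \<zero>" for r
  proof -
    have rL: "fraction R \<pp> r \<one> \<in> carrier ?L" by (rule fraction_closed[OF r(1) outside_one])
    have "fraction R \<pp> r \<one> \<otimes>\<^bsub>?L\<^esub> y = fraction R \<pp> \<zero> (\<one> \<otimes> s)"
      using fraction_mult[OF r(1) outside_one IR[OF a(2)] a(3)] a r by simp
    also have "\<dots> = fraction R \<pp> \<zero> \<one>"
      using a(3) outside_one by (intro fraction_eqI) auto
    also have "\<dots> = \<zero>\<^bsub>?L\<^esub> \<otimes>\<^bsub>?L\<^esub> y"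
      using L.l_null Jmult y(1) localization_zero_one(1) a IR fraction_closed by auto
    finally have "F (fraction R \<pp> r \<one> \<otimes>\<^bsub>?L\<^esub> y) = F (\<zero>\<^bsub>?L\<^esub> \<otimes>\<^bsub>?L\<^esub> y)" by simp
    then have "fraction R \<pp> r \<one> = \<zero>\<^bsub>?L\<^esub>"
      using Fm[OF rL y(1)] Fm[OF L.zero_closed y(1)] y(2) rL by simp
    then obtain u where "u \<in> carrier R - \<pp>" "u \<otimes> (\<one> \<otimes> r) = u \<otimes> (\<one> \<otimes> \<zero>)"
      using fraction_eq_iff[OF r(1) outside_one zero_closed outside_one] localization_zero_one(1) by auto
    then show ?thesis using r by auto
  qed
  \<comment> \<open>A denominator that works for finitely many generators works for the whole ideal.\<close>
  have uniform: "\<exists>t\<in>carrier R - \<pp>. \<forall>b\<in>K. t \<otimes> b \<in> K'"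
    if K: "ideal K R" and K': "ideal K' R" and loc: "\<And>b. b \<in> K \<Longrightarrow> \<exists>t\<in>carrier R - \<pp>. t \<otimes> b \<in> K'" for K K'
  proof -
    interpret K': ideal K' R by fact
    obtain B where B: "B \<subseteq> carrier R" "finite B" "K = Idl B"
      using noetherian_ring.finetely_gen[OF assms(1) K] by blast
    have BK: "B \<subseteq> K" using genideal_self[OF B(1)] B(3) by simp
    have "\<exists>t\<in>carrier R - \<pp>. \<forall>b\<in>C. t \<otimes> b \<in> K'" if "finite C" "C \<subseteq> B" for C
      using that
    proof (induction C rule: finite_induct)
      case empty
      then show ?case using outside_one by blast
    next
      case (insert c C)
      then obtain t where t: "t \<in> carrier R - \<pp>" "\<forall>b\<in>C. t \<otimes> b \<in> K'" by auto
      have cK: "c \<in> K" "c \<in> carrier R" using insert.prems BK B(1) by auto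
      obtain u where u: "u \<in> carrier R - \<pp>" "u \<otimes> c \<in> K'" using loc[OF cK(1)] by blast
      show ?case
      proof (intro bexI[of _ "t \<otimes> u"] ballI)
        show "t \<otimes> u \<in> carrier R - \<pp>" using t(1) u(1) by (rule outside_mult)
        fix b assume b: "b \<in> insert c C"
        have bR: "b \<in> carrier R" using b insert.prems B(1) by auto
        show "(t \<otimes> u) \<otimes> b \<in> K'"
        proof (cases "b = c")
          case True
          then show ?thesis using K'.I_l_closed[OF u(2)] t(1) u(1) cK by (simp add: m_assoc)
        next
          case False
          then have "t \<otimes> b \<in> K'" using b t(2) by auto
          then have "u \<otimes> (t \<otimes> b) \<in> K'" using K'.I_l_closed u(1) by auto
          then show ?thesis using t(1) u(1) bR by (simp add: m_ac)
        qed
      qed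
    qed
    then obtain t where t: "t \<in> carrier R - \<pp>" "\<forall>b\<in>B. t \<otimes> b \<in> K'" using B(2) by blast
    have h: "(\<lambda>b. t \<otimes> b) \<in> mhom R (self_module R) (self_module R)"
      using t(1) by (intro mhomI) (auto simp: r_distr m_ac)
    have "submodule K' R (self_module R)" using K' ideal_iff_submodule[OF cr] by blast
    from submodule_vimage[OF mS mS h this]
    have "ideal {b \<in> carrier R. t \<otimes> b \<in> K'} R" using idealI' by simp
    then have "K \<subseteq> {b \<in> carrier R. t \<otimes> b \<in> K'}"
      unfolding B(3) using t(2) B(1) by (intro genideal_minimal) auto
    then show ?thesis using t(1) by blast
  qed
  have ha: "(\<lambda>r. r \<otimes> a) \<in> mhom R (self_module R) (self_module R)"
    using IR[OF a(2)] by (intro mhomI) (auto simp: l_distr m_assoc)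
  interpret S: module R "self_module R" by (rule mS)
  have Ra: "ideal ((\<lambda>r. r \<otimes> a) ` carrier R) R"
    using idealI'[OF submodule_image[OF mS mS ha S.carrier_is_submodule]] by simp
  have ann: "ideal {r \<in> carrier R. r \<otimes> a = \<zero>} R"
    using idealI'[OF submodule_kernel[OF mS mS ha]] by simp
  obtain t where t: "t \<in> carrier R - \<pp>" "\<forall>b\<in>I. t \<otimes> b \<in> (\<lambda>r. r \<otimes> a) ` carrier R"
    using uniform[OF assms(2) Ra] multiple by blast
  obtain u where u: "u \<in> carrier R - \<pp>" "\<forall>r\<in>{r \<in> carrier R. r \<otimes> a = \<zero>}. u \<otimes> r \<in> {\<zero>}"
    using uniform[OF ann zeroideal] regular by blast
  define q where "q b = (SOME r. r \<in> carrier R \<and> t \<otimes> b = r \<otimes> a)" for b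
  have q: "q b \<in> carrier R" "t \<otimes> b = q b \<otimes> a" if "b \<in> I" for b
    using someI_ex[of "\<lambda>r. r \<in> carrier R \<and> t \<otimes> b = r \<otimes> a"] t(2) that unfolding q_def by blast+
  define g where "g b = u \<otimes> q b" for b
  have g: "g b = u \<otimes> r" if "b \<in> I" "r \<in> carrier R" "t \<otimes> b = r \<otimes> a" for b r
  proof -
    have "(q b \<ominus> r) \<otimes> a = q b \<otimes> a \<ominus> r \<otimes> a"
      using q(1)[OF that(1)] that(2) IR[OF a(2)] by (simp add: a_minus_def l_distr l_minus)
    also have "\<dots> = \<zero>" using q[OF that(1)] that IR[OF a(2)] by (simp add: a_minus_def r_neg)
    finally have "u \<otimes> (q b \<ominus> r) = \<zero>" using u(2) q(1)[OF that(1)] that(2) by auto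
    then have "u \<otimes> q b \<ominus> u \<otimes> r = \<zero>"
      using q(1)[OF that(1)] that(2) u(1) by (simp add: a_minus_def r_distr r_minus)
    then show ?thesis unfolding g_def using q(1)[OF that(1)] that(2) u(1) by simp
  qed
  have "g \<in> mhom R (ideal_module R I) (self_module R)"
  proof (rule mhomI; simp)
    fix b assume b: "b \<in> I"
    show "g b \<in> carrier R" using q(1)[OF b] u(1) by (simp add: g_def)
    show "g (r \<otimes> b) = r \<otimes> g b" if r: "r \<in> carrier R" for r
    proof -
      have "t \<otimes> (r \<otimes> b) = (r \<otimes> q b) \<otimes> a"
        using q[OF b] r t(1) IR[OF a(2)] IR[OF b] m_lcomm[of t r b] by (simp add: m_assoc)
      then have "g (r \<otimes> b) = u \<otimes> (r \<otimes> q b)"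
        using g[OF I.I_l_closed[OF b r]] q(1)[OF b] r by simp
      then show ?thesis using q(1)[OF b] r u(1) by (simp add: g_def m_lcomm)
    qed
    fix c assume c: "c \<in> I"
    have "t \<otimes> (b \<oplus> c) = (q b \<oplus> q c) \<otimes> a"
      using q[OF b] q[OF c] t(1) IR[OF a(2)] IR[OF b] IR[OF c] by (simp add: r_distr l_distr)
    then have "g (b \<oplus> c) = u \<otimes> (q b \<oplus> q c)"
      using g[OF I.a_closed[OF b c]] q(1)[OF b] q(1)[OF c] by simp
    then show "g (b \<oplus> c) = g b \<oplus> g c" using q(1)[OF b] q(1)[OF c] u(1) by (simp add: g_def r_distr)
  qed
  moreover have "g a = u \<otimes> t" using g[OF a(2), of t] t(1) by simp
  ultimately show ?thesis using that a(2) outside_mult[OF u(1) t(1)] by auto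
qed

end

section \<open>Bidual modules, flat modules and coassociated primes\<close>

lemma injective_hull_baer: "injective_hull R K E \<Longrightarrow> baer_injective R E"
  by (rule injective_module_baer) (simp add: injective_hull_def)

text \<open>
  The multipliers of \<open>x\<close> into \<open>V\<close> form a proper ideal, hence lie in \<open>\<mm>\<close>, so \<open>x\<close> may be sent to the
  generator of the residue field.
\<close>

lemma injective_hull_cogenerates:
  assumes "noetherian_local_ring R \<mm>" "injective_hull R (quot_module (self_module R) \<mm>) E"
    and "module R N" "submodule V R N" "x \<in> carrier N" "x \<notin> V"
  obtains f where "f \<in> mhom R N E" "\<And>v. v \<in> V \<Longrightarrow> f v = \<zero>\<^bsub>E\<^esub>" "f x \<noteq> \<zero>\<^bsub>E\<^esub>"
proof -
  interpret N: module R N by fact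
  have cr: "cring R" by (rule N.R.is_cring)
  have mS: "module R (self_module R)" by (rule module_self[OF cr])
  obtain e where e: "e \<in> carrier E" "e \<noteq> \<zero>\<^bsub>E\<^esub>" "\<And>r. r \<in> \<mm> \<Longrightarrow> r \<odot>\<^bsub>E\<^esub> e = \<zero>\<^bsub>E\<^esub>"
    by (rule injective_hull_residue_field[OF assms(1,2)], rule that)
  have "(\<lambda>r. r \<odot>\<^bsub>N\<^esub> x) \<in> mhom R (self_module R) N"
    using assms(5) by (intro mhomI) (auto simp: N.smult_l_distr N.smult_assoc1)
  from submodule_vimage[OF mS assms(3) this assms(4)]
  have "ideal {r \<in> carrier R. r \<odot>\<^bsub>N\<^esub> x \<in> V} R" using ideal_iff_submodule[OF cr] by simp
  then have "{r \<in> carrier R. r \<odot>\<^bsub>N\<^esub> x \<in> V} \<subseteq> \<mm>"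
    by (rule noetherian_local_ring_proper_ideal[OF assms(1)]) (use assms(5,6) in simp)
  then have ann: "r \<odot>\<^bsub>E\<^esub> e = \<zero>\<^bsub>E\<^esub>" if "r \<in> carrier R" "r \<odot>\<^bsub>N\<^esub> x \<in> V" for r
    using e(3) that by blast
  obtain f where f: "f \<in> mhom R N E" "\<And>v. v \<in> V \<Longrightarrow> f v = \<zero>\<^bsub>E\<^esub>" "f x = e"
    by (rule baer_separates[OF injective_hull_baer[OF assms(2)] assms(3-5) e(1) ann], assumption+, rule that)
  show ?thesis
  proof (rule that[OF f(1)])
    show "f v = \<zero>\<^bsub>E\<^esub>" if "v \<in> V" for v using that by (rule f(2))
    show "f x \<noteq> \<zero>\<^bsub>E\<^esub>" using f(3) e(2) by simp
  qed
qed

lemma ideal_generated_if_bidual: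
  assumes "noetherian_local_ring R \<mm>" "ideal I R"
    and "injective_hull R (quot_module (self_module R) \<mm>) E" "module R M"
    and gen: "ideal_generated R I (matlis_dual R E (matlis_dual R E M))"
  shows "ideal_generated R I M"
proof -
  have n: "noetherian_ring R" and cr: "cring R" using assms(1) by (auto simp: noetherian_local_ring_def)
  have bE: "baer_injective R E" by (rule injective_hull_baer[OF assms(3)])
  then have mE: "module R E" by (simp add: baer_injective_def)
  let ?D = "matlis_dual R E M" and ?DD = "matlis_dual R E (matlis_dual R E M)"
  have mD: "module R ?D" by (rule module_matlis_dual[OF mE assms(4)])
  have mDD: "module R ?DD" by (rule module_matlis_dual[OF mE mD])
  show ?thesis
    unfolding ideal_generated_iff[OF cr assms(2,4)]
  proof (intro allI impI)
    fix U assume U: "submodule U R M" "\<forall>g\<in>mhom R (ideal_module R I) M. g ` I \<subseteq> U"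
    show "U = carrier M"
    proof (rule ccontr)
      assume "U \<noteq> carrier M"
      then obtain x where x: "x \<in> carrier M" "x \<notin> U" using submoduleD(1)[OF assms(4) U(1)] by blast
      obtain f where f: "f \<in> mhom R M E" "\<And>v. v \<in> U \<Longrightarrow> f v = \<zero>\<^bsub>E\<^esub>" "f x \<noteq> \<zero>\<^bsub>E\<^esub>"
        using injective_hull_cogenerates[OF assms(1,3,4) U(1) x] by blast
      let ?u = "restrict f (carrier M)"
      have u: "?u \<in> carrier ?D" by (rule restrict_mhom[OF f(1) assms(4)])
      have trace: "?u (g a) = \<zero>\<^bsub>E\<^esub>" if "g \<in> mhom R (ideal_module R I) M" "a \<in> I" for g a
        using f(2) U(2) that mhomD(1)[OF that(1), of a] by auto
      have "{\<psi> \<in> carrier ?DD. \<psi> ?u = \<zero>\<^bsub>E\<^esub>} = carrier ?DD"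
      proof (rule gen[unfolded ideal_generated_iff[OF cr assms(2) mDD], rule_format])
        show "submodule {\<psi> \<in> carrier ?DD. \<psi> ?u = \<zero>\<^bsub>E\<^esub>} R ?DD"
          by (rule submodule_kernel[OF mDD mE matlis_dual_eval[OF u]])
        fix g assume g: "g \<in> mhom R (ideal_module R I) ?DD"
        have gD: "g a \<in> carrier ?DD" if "a \<in> I" for a using mhomD(1)[OF g, of a] that by (simp only: ideal_module_simps)
        have "g a ?u = \<zero>\<^bsub>E\<^esub>" if a: "a \<in> I" for a
        proof (rule trace_orthogonal_tensor_zero[OF n bE assms(4,2) mE u _ _ _ a])
          show "g a \<in> mhom R ?D E" if "a \<in> I" for a using gD[OF that] by simp
          show "(\<lambda>a. g a h) \<in> mhom R (ideal_module R I) E" if "h \<in> carrier ?D" for h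
            by (rule mhom_comp[OF g matlis_dual_eval[OF that]])
        qed (rule trace)
        then show "g ` I \<subseteq> {\<psi> \<in> carrier ?DD. \<psi> ?u = \<zero>\<^bsub>E\<^esub>}" using gD by blast
      qed
      moreover have "(\<lambda>h\<in>carrier ?D. h x) \<in> carrier ?DD"
        by (rule restrict_mhom[OF matlis_dual_eval[OF x(1)] mD])
      ultimately have "(\<lambda>h\<in>carrier ?D. h x) ?u = \<zero>\<^bsub>E\<^esub>" by blast
      then show False using f(3) u x(1) by (simp del: matlis_dual_simps)
    qed
  qed
qed

text \<open>
  This applies \<open>trace_orthogonal_tensor_zero\<close> to \<open>R\<close> and the injective module \<open>Hom(M, E)\<close>, with \<open>u\<close> the
  map \<open>r \<mapsto> r f\<close>. A homomorphism \<open>g : I \<rightarrow> M\<close> yields the bilinear map \<open>(a, h) \<mapsto> h(1)(g a)\<close>, whose value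
  at \<open>(a, u)\<close> is \<open>f (g a)\<close>.
\<close>

lemma flat_ideal_generated_trace:
  assumes "noetherian_ring R" "ideal I R" "baer_injective R E" "flat_module R M" "ideal_generated R I M"
    and f: "f \<in> mhom R M E"
    and trace: "\<And>g a x. g \<in> mhom R (ideal_module R I) (self_module R) \<Longrightarrow> a \<in> I \<Longrightarrow> x \<in> carrier M \<Longrightarrow>
      g a \<odot>\<^bsub>E\<^esub> f x = \<zero>\<^bsub>E\<^esub>"
    and "x \<in> carrier M"
  shows "f x = \<zero>\<^bsub>E\<^esub>"
proof -
  have mM: "module R M" using assms(4) by (simp add: flat_module_def)
  have mE: "module R E" using assms(3) by (simp add: baer_injective_def)
  interpret M: module R M by fact
  have cr: "cring R" by (rule M.R.is_cring)
  let ?S = "self_module R" and ?D = "matlis_dual R E M"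
  have mS: "module R ?S" by (rule module_self[OF cr])
  have mD: "module R ?D" by (rule module_matlis_dual[OF mE mM])
  interpret D: module R ?D by fact
  have bD: "baer_injective R ?D" by (rule flat_dual_injective[OF assms(4,3)])
  let ?f = "restrict f (carrier M)"
  have fD: "?f \<in> carrier ?D" by (rule restrict_mhom[OF f mM])
  have "(\<lambda>r. r \<odot>\<^bsub>?D\<^esub> ?f) \<in> mhom R ?S ?D"
    using fD by (intro mhomI) (simp_all add: D.smult_l_distr D.smult_assoc1 del: matlis_dual_simps)
  from restrict_mhom[OF this mS]
  have u: "(\<lambda>r\<in>carrier R. r \<odot>\<^bsub>?D\<^esub> ?f) \<in> carrier (matlis_dual R ?D ?S)" by (simp only: ideal_module_simps)
  have one: "\<one>\<^bsub>R\<^esub> \<in> carrier ?S" by simp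
  have "{x \<in> carrier M. f x = \<zero>\<^bsub>E\<^esub>} = carrier M"
  proof (rule assms(5)[unfolded ideal_generated_iff[OF cr assms(2) mM], rule_format])
    show "submodule {x \<in> carrier M. f x = \<zero>\<^bsub>E\<^esub>} R M" by (rule submodule_kernel[OF mM mE f])
    fix g assume g: "g \<in> mhom R (ideal_module R I) M"
    have gM: "g a \<in> carrier M" if "a \<in> I" for a using mhomD(1)[OF g, of a] that by simp
    have "(\<lambda>r\<in>carrier R. r \<odot>\<^bsub>?D\<^esub> ?f) \<one>\<^bsub>R\<^esub> (g a) = \<zero>\<^bsub>E\<^esub>" if a: "a \<in> I" for a
    proof (rule trace_orthogonal_tensor_zero[OF assms(1) bD mS assms(2) mE u _ _ _ a,
          where \<beta> = "\<lambda>a h. h \<one>\<^bsub>R\<^esub> (g a)"])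
      show "(\<lambda>r\<in>carrier R. r \<odot>\<^bsub>?D\<^esub> ?f) (g' a) = \<zero>\<^bsub>?D\<^esub>"
        if "g' \<in> mhom R (ideal_module R I) ?S" "a \<in> I" for g' a
        using trace[OF that] mhomD(1)[OF that(1), of a] that(2) by (auto intro!: restrict_ext)
      show "(\<lambda>h. h \<one>\<^bsub>R\<^esub> (g a)) \<in> mhom R (matlis_dual R ?D ?S) E" if "a \<in> I" for a
        by (rule mhom_comp[OF matlis_dual_eval[OF one] matlis_dual_eval[OF gM[OF that]]])
      show "(\<lambda>a. h \<one>\<^bsub>R\<^esub> (g a)) \<in> mhom R (ideal_module R I) E"
        if "h \<in> carrier (matlis_dual R ?D ?S)" for h
        using mhomD(1)[OF matlis_dual_eval[OF one] that] by (intro mhom_comp[OF g]) simp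
    qed
    note vanish = this
    have "f (g a) = \<zero>\<^bsub>E\<^esub>" if "a \<in> I" for a
      using vanish[OF that] gM[OF that] D.smult_one[OF fD] by (simp del: matlis_dual_simps)
    then show "g ` I \<subseteq> {x \<in> carrier M. f x = \<zero>\<^bsub>E\<^esub>}" using gM by blast
  qed
  then show ?thesis using assms(8) by blast
qed

theorem mainTheorem5:
  fixes R :: "('r, 'x) ring_scheme" and \<mm> I :: "'r set"
    and E :: "('r, 'e) module" and M :: "('r, 'm) module"
  assumes "noetherian_local_ring R \<mm>"
    and "ideal I R"
    and "injective_hull R (quot_module (self_module R) \<mm>) E"
    and "module R M"
  shows "(ideal_generated R I (matlis_dual R E (matlis_dual R E M)) \<longrightarrow> ideal_generated R I M) \<and>
    (flat_module R M \<longrightarrow>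
      (ideal_generated R I M \<longleftrightarrow>
        (\<forall>\<pp>\<in>Koass R M. mod_iso (localization R \<pp>)
           (ideal_module (localization R \<pp>) (localized_ideal R \<pp> I))
           (self_module (localization R \<pp>)))))"
proof (intro conjI impI iffI ballI)
  show "ideal_generated R I M" if "ideal_generated R I (matlis_dual R E (matlis_dual R E M))"
    using ideal_generated_if_bidual[OF assms that] .
next
  have n: "noetherian_ring R" using assms(1) by (simp add: noetherian_local_ring_def)
  have bE: "baer_injective R E" by (rule injective_hull_baer[OF assms(3)])
  then have mE: "module R E" by (simp add: baer_injective_def)
  interpret M: module R M by fact
  interpret E: module R E by fact
  have cr: "cring R" by (rule M.R.is_cring)
  {
    fix \<pp> assume flat: "flat_module R M" and gen: "ideal_generated R I M" and "\<pp> \<in> Koass R M"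
    then obtain V where \<pp>: "primeideal \<pp> R" "submodule V R M" "\<pp> = annihilator R (quot_module M V)"
      unfolding Koass_def by blast
    interpret \<pp>: primeideal \<pp> R by (rule \<pp>(1))
    note q = module_quot[OF assms(4) \<pp>(2)]
    have ann: "r \<in> \<pp> \<longleftrightarrow> (\<forall>x\<in>carrier M. r \<odot>\<^bsub>M\<^esub> x \<in> V)" if r: "r \<in> carrier R" for r
    proof -
      have "r \<odot>\<^bsub>quot_module M V\<^esub> (V +>\<^bsub>M\<^esub> x) = \<zero>\<^bsub>quot_module M V\<^esub> \<longleftrightarrow> r \<odot>\<^bsub>M\<^esub> x \<in> V" if "x \<in> carrier M" for x
        using mhomD(3)[OF q(2) r that] q(4)[of "r \<odot>\<^bsub>M\<^esub> x"] r that by simp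
      moreover have "r \<in> \<pp> \<longleftrightarrow> (\<forall>C\<in>carrier (quot_module M V). r \<odot>\<^bsub>quot_module M V\<^esub> C = \<zero>\<^bsub>quot_module M V\<^esub>)"
        using r by (subst \<pp>(3)) (simp add: annihilator_def)
      ultimately show ?thesis unfolding q(3) by blast
    qed
    have "\<one>\<^bsub>R\<^esub> \<notin> \<pp>" using \<pp>.I_notcarr \<pp>.one_imp_carrier by blast
    then obtain x where x: "x \<in> carrier M" "x \<notin> V" using ann[of "\<one>\<^bsub>R\<^esub>"] by auto
    obtain f where f: "f \<in> mhom R M E" "\<And>v. v \<in> V \<Longrightarrow> f v = \<zero>\<^bsub>E\<^esub>" "f x \<noteq> \<zero>\<^bsub>E\<^esub>"
      using injective_hull_cogenerates[OF assms(1,3,4) \<pp>(2) x] by blast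
    have "\<exists>g\<in>mhom R (ideal_module R I) (self_module R). \<exists>a\<in>I. g a \<notin> \<pp>"
    proof (rule ccontr)
      assume *: "\<not> ?thesis"
      have "g a \<odot>\<^bsub>E\<^esub> f y = \<zero>\<^bsub>E\<^esub>"
        if "g \<in> mhom R (ideal_module R I) (self_module R)" "a \<in> I" "y \<in> carrier M" for g a y
      proof -
        have ga: "g a \<in> carrier R" "g a \<in> \<pp>" using * that mhomD(1)[OF that(1), of a] by auto
        then show ?thesis using ann[OF ga(1)] that(3) f(2) mhomD(3)[OF f(1) ga(1) that(3)] by metis
      qed
      then show False
        using flat_ideal_generated_trace[OF n assms(2) bE flat gen f(1) _ x(1)] f(3) by blast
    qed
    then show "mod_iso (localization R \<pp>) (ideal_module (localization R \<pp>) (localized_ideal R \<pp> I))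
        (self_module (localization R \<pp>))"
      using localized_ideal_free_if_trace[OF \<pp>(1) assms(2)] by blast
  }
  {
    assume free: "\<forall>\<pp>\<in>Koass R M. mod_iso (localization R \<pp>)
      (ideal_module (localization R \<pp>) (localized_ideal R \<pp> I)) (self_module (localization R \<pp>))"
    show "ideal_generated R I M"
      unfolding ideal_generated_iff[OF cr assms(2,4)]
    proof (intro allI impI)
      fix U assume U: "submodule U R M" "\<forall>g\<in>mhom R (ideal_module R I) M. g ` I \<subseteq> U"
      define T where "T = {g a | g a. g \<in> mhom R (ideal_module R I) (self_module R) \<and> a \<in> I}"
      have TR: "T \<subseteq> carrier R" 
      proof
        fix t assume "t \<in> T"
        then obtain g a where "t = g a" "g \<in> mhom R (ideal_module R I) (self_module R)" "a \<in> I"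
          unfolding T_def by blast
        then show "t \<in> carrier R" using mhomD(1)[of g R "ideal_module R I" "self_module R" a] by simp
      qed
      show "U = carrier M"
      proof (rule ccontr)
        assume "U \<noteq> carrier M"
        then obtain x where x: "x \<in> carrier M" "x \<notin> U" using submoduleD(1)[OF assms(4) U(1)] by blast
        obtain f where f: "f \<in> mhom R M E" "\<And>v. v \<in> U \<Longrightarrow> f v = \<zero>\<^bsub>E\<^esub>" "f x \<noteq> \<zero>\<^bsub>E\<^esub>"
          using injective_hull_cogenerates[OF assms(1,3,4) U(1) x] by blast
        have "t \<odot>\<^bsub>E\<^esub> f y = \<zero>\<^bsub>E\<^esub>" if t: "t \<in> T" and y: "y \<in> carrier M" for t y
        proof -
          obtain g a where g: "t = g a" "g \<in> mhom R (ideal_module R I) (self_module R)" "a \<in> I"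
            using t unfolding T_def by blast
          have "(\<lambda>r. r \<odot>\<^bsub>M\<^esub> y) \<in> mhom R (self_module R) M"
            using y by (intro mhomI) (auto simp: M.smult_l_distr M.smult_assoc1)
          from U(2)[rule_format, OF mhom_comp[OF g(2) this]]
          have "t \<odot>\<^bsub>M\<^esub> y \<in> U" using g by blast
          then show ?thesis using f(2)[of "t \<odot>\<^bsub>M\<^esub> y"] mhomD(3)[OF f(1) subsetD[OF TR t] y] by simp
        qed
        then obtain \<pp> where \<pp>: "\<pp> \<in> Koass R M" "T \<subseteq> \<pp>"
          using Koass_above_annihilator[OF n assms(4) mE injective_hull_artinian[OF assms(1,3)] f(1) _ TR]
            f(3) x(1) by blast
        have pr: "primeideal \<pp> R" using \<pp>(1) by (simp add: Koass_def)
        obtain g a where "g \<in> mhom R (ideal_module R I) (self_module R)" "a \<in> I" "g a \<notin> \<pp>"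
          using trace_if_localized_ideal_free[OF pr n assms(2)] free \<pp>(1) by blast
        then show False using \<pp>(2) unfolding T_def by blast
      qed
    qed
  }
qed

end
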